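(* Let $N\ge3$, let $\mathbb S^N_+$ be the open upper hemisphere of the unit sphere $\mathbb S^N$ with its standard metric $g$, let $a_0$ be the north pole, let $a_1\neq a_2$ be points of $\mathbb S^N_+$, and put $\delta:=\max\big(d(a_0,a_1),d(a_0,a_2)\big)$. For every $2\le p<N$ and every $u\in C_c^\infty(\mathbb S^N_+)$, $$\begin{aligned}\int_{\mathbb S^N_+}|\nabla_g u|^p\,dv_g\ge{}&C_1(2,p)\int_{\mathbb S^N_+}\left|\frac{\nabla_g d_1}{d_1}-\frac{\nabla_g d_2}{d_2}\right|^2|v|^{p-2}|u|^p\,dv_g+(N-1)C_2(2,p)\,c(\delta)\int_{\mathbb S^N_+}|v|^{p-2}|u|^p\,dv_g\\&+(p-2)C_2(2,p)\int_{\mathbb S^N_+}\left(4+c(\delta)(d_1^2+d_2^2)\right)\frac{1-G_{12}^2}{d_1^2d_2^2}|v|^{p-4}|u|^p\,dv_g,\end{aligned}$$ where $$c(\delta)=\frac{7\pi^2-3\left(\delta+\frac{\pi}{2}\right)^2}{\pi^2\left(\left(\delta+\frac{\pi}{2}\right)^2-\pi^2\right)}.$$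
   Context: The metric $g$ on $\mathbb S^N\subset\mathbb R^{N+1}$ is the one inherited from $\mathbb R^{N+1}$ (constant sectional curvature $1$); $d$ is the geodesic distance, $d_i(x)=d(x,a_i)$ for $i=1,2$; $\nabla_g$ is the Riemannian gradient, $dv_g$ the volume form, $|X|=g(X,X)^{1/2}$. Notation: $$v:=\frac{\nabla_g d_1}{d_1}+\frac{\nabla_g d_2}{d_2},\quad G_{12}:=g(\nabla_g d_1,\nabla_g d_2),\quad C_1(2,p)=\frac{(N-p)^p}{2^p(p-1)^{p-1}},\quad C_2(2,p)=\frac{(N-p)^{p-1}}{2^{p-1}(p-1)^{p-1}}.$$ *)

theory Defs
  imports "HOL-Analysis.Analysis"
begin

text \<open>
  The ambient space \<open>\<real>\<^sup>N\<^sup>+\<^sup>1\<close> is \<open>(real ^ 'n) \<times> real\<close> with \<open>CARD('n) = N\<close>; its library inner product is the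
  Euclidean one, and the second component is the height above the equator. The metric \<open>g\<close> is
  the restriction of the ambient inner product to tangent vectors, so \<open>inner\<close> and \<open>norm\<close> serve
  as \<open>g\<close> and \<open>|\<cdot>|\<close> on them.
\<close>

type_synonym 'n amb = "(real ^ 'n) \<times> real"

definition unit_sphere :: "'n::finite amb set"
  where "unit_sphere = sphere 0 1"

definition upper_hemisphere :: "'n::finite amb set"
  where "upper_hemisphere = {x \<in> unit_sphere. snd x > 0}"

definition north_pole :: "'n::finite amb"
  where "north_pole = (0, 1)"

text \<open>
  Integrability of the speed must be demanded: \<open>valid_path\<close> admits curves of infinite length,
  for which \<open>integral\<close> would return the junk value 0.
\<close>

definition admissible_curve :: "(real \<Rightarrow> 'n::finite amb) \<Rightarrow> bool"
  where "admissible_curve \<gamma> \<longleftrightarrow> valid_path \<gamma> \<and> path_image \<gamma> \<subseteq> unit_sphere \<and>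
    (\<lambda>t. norm (vector_derivative \<gamma> (at t))) integrable_on {0..1}"

definition curve_length :: "(real \<Rightarrow> 'n::finite amb) \<Rightarrow> real"
  where "curve_length \<gamma> = integral {0..1} (\<lambda>t. norm (vector_derivative \<gamma> (at t)))"

definition geodesic_dist :: "'n::finite amb \<Rightarrow> 'n amb \<Rightarrow> real"
  where "geodesic_dist x y =
    Inf {curve_length \<gamma> | \<gamma>. admissible_curve \<gamma> \<and> pathstart \<gamma> = x \<and> pathfinish \<gamma> = y}"

text \<open>
  The derivative within the sphere is determined on the tangent space
  \<open>{w. x \<bullet> w = 0}\<close> only; the gradient is the tangent vector representing it there.
  Where \<open>f\<close> is not differentiable along the sphere the value is unspecified.
\<close>

definition sphere_grad :: "('n::finite amb \<Rightarrow> real) \<Rightarrow> 'n amb \<Rightarrow> 'n amb"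
  where "sphere_grad f x =
    (THE w. x \<bullet> w = 0 \<and> (f has_derivative (\<lambda>h. w \<bullet> h)) (at x within unit_sphere))"

text \<open>Global chart of the open hemisphere, with domain \<open>ball 0 1\<close>: the hemisphere as a graph.\<close>

definition graph_chart :: "real ^ 'n::finite \<Rightarrow> 'n amb"
  where "graph_chart y = (y, sqrt (1 - (norm y)\<^sup>2))"

text \<open>Coefficients \<open>g\<^sub>i\<^sub>j = g(\<partial>\<^sub>i, \<partial>\<^sub>j)\<close> of the metric in this chart.\<close>

definition metric_matrix :: "real ^ 'n::finite \<Rightarrow> real ^ 'n ^ 'n"
  where "metric_matrix y = (\<chi> i j.
    frechet_derivative graph_chart (at y) (axis i 1) \<bullet>
    frechet_derivative graph_chart (at y) (axis j 1))"

text \<open>The Riemannian volume \<open>dv\<^sub>g = sqrt (det (g\<^sub>i\<^sub>j)) dy\<close> of the hemisphere, as a measure on the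
  ambient space.\<close>

definition hemisphere_vol :: "'n::finite amb measure"
  where "hemisphere_vol =
    distr (density lborel
             (\<lambda>y. ennreal (indicator (ball 0 1) y * sqrt (det (metric_matrix y)))))
          borel graph_chart"

fun Ck_on :: "nat \<Rightarrow> 'b::euclidean_space set \<Rightarrow> ('b \<Rightarrow> real) \<Rightarrow> bool"
  where
    "Ck_on 0 U f \<longleftrightarrow> continuous_on U f"
  | "Ck_on (Suc k) U f \<longleftrightarrow> (\<forall>x\<in>U. f differentiable (at x)) \<and>
       (\<forall>b\<in>Basis. Ck_on k U (\<lambda>x. frechet_derivative f (at x) b))"

text \<open>
  \<open>C\<^sub>c\<^sup>\<infinity>\<close> on the open hemisphere. Functions are total on the ambient space, but only
  their values on the hemisphere matter. The closure is taken in the ambient space; for a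
  subset of the hemisphere this gives the same compactly supported functions as the relative closure.
\<close>

definition test_functions :: "('n::finite amb \<Rightarrow> real) set"
  where "test_functions =
    {u. (\<forall>k. Ck_on k (ball 0 1) (u \<circ> graph_chart)) \<and>
        compact (closure (support_on upper_hemisphere u)) \<and>
        closure (support_on upper_hemisphere u) \<subseteq> upper_hemisphere}"

definition C1_2 :: "nat \<Rightarrow> real \<Rightarrow> real"
  where "C1_2 N p = (real N - p) powr p / (2 powr p * (p - 1) powr (p - 1))"

definition C2_2 :: "nat \<Rightarrow> real \<Rightarrow> real"
  where "C2_2 N p = (real N - p) powr (p - 1) / (2 powr (p - 1) * (p - 1) powr (p - 1))"

definition c_const :: "real \<Rightarrow> real"
  where "c_const \<delta> = (7 * pi\<^sup>2 - 3 * (\<delta> + pi / 2)\<^sup>2) / (pi\<^sup>2 * ((\<delta> + pi / 2)\<^sup>2 - pi\<^sup>2))"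

end

theory Submission
  imports Defs
begin

text \<open>
  Write \<open>f = log d\<^sub>1 + log d\<^sub>2\<close>, so that \<open>v\<close> is the gradient of \<open>f\<close>, and put
  \<open>C = (N - p) / (2 (p - 1))\<close> and \<open>V = |v|^(p-2) v\<close>. The ground state one has in mind is
  \<open>(d\<^sub>1 d\<^sub>2)^(-C)\<close>; its \<open>p\<close>-flux is proportional to \<open>V\<close>, and \<open>C^(p-1)\<close> is the constant
  \<open>C\<^sub>2(2,p)\<close>. Young's inequality for the product of \<open>|\<nabla>u|\<close> and \<open>(C |v| |u|)^(p-1)\<close> gives,
  at every point where everything is defined,

  \<open>|\<nabla>u|^p + C^(p-1) div (|u|^p V) \<ge> C^(p-1) |u|^p (div V - (N - p)/2 |v|^p)\<close>.

  It remains to bound the right-hand side from below and to see that the divergence integrates to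
  zero.

  For the lower bound, the Hessian of \<open>log d\<close> on the sphere involves only the number \<open>d cot d\<close>.
  The resulting expression for \<open>div V\<close> is a polynomial in \<open>1/d\<^sub>1\<close>, \<open>1/d\<^sub>2\<close>, \<open>d\<^sub>i cot d\<^sub>i\<close> and the
  cosine of the angle between the two gradients, times powers of \<open>|v|\<close>; with \<open>d cot d = 1\<close> it
  produces exactly the first weight and the \<open>4\<close> in the third one (\<open>two_pole_algebra\<close>). The curvature
  enters through \<open>d cot d - 1\<close>, which the product formula of the sine bounds below by
  \<open>c(\<delta>) d\<^sup>2 / 2\<close> as long as \<open>d \<le> \<delta> + \<pi>/2\<close> (\<open>cot_bound_c_const\<close>); on the hemisphere this
  range is guaranteed by the triangle inequality through the north pole (\<open>arccos_triangle_pole\<close>).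

  For the integration everything is moved to the graph chart of the hemisphere, where the field
  \<open>|u|^p V\<close>, divided by the height, has coordinates \<open>F\<^sub>i\<close> whose partial derivatives \<open>D\<^sub>i\<close> sum up to
  the Riemannian divergence against the volume (\<open>divergence_identity\<close>). The field is
  singular at the two poles and need not be differentiable where \<open>v\<close> vanishes, which happens at one
  point at most. Almost every line parallel to a coordinate axis misses these finitely many
  points, so the fundamental theorem of calculus applies on it. By Fubini's theorem
  \<open>\<integral> D\<^sub>i = 0\<close>, provided that \<open>D\<^sub>i\<close> is integrable (\<open>directional_derivative_integral_zero\<close>). Near a pole
  \<open>D\<^sub>i\<close> grows like the distance to the power \<open>-p\<close>, and this is integrable because \<open>p < N\<close>.
\<close>

section \<open>A lower bound for the cotangent\<close>

text \<open>
  The factor \<open>1 - x\<^sup>2 / k\<^sup>2\<close> of the sine product, with \<open>s = x\<^sup>2\<close> and \<open>K = k\<^sup>2\<close>, decreases in \<open>s\<close>. Its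
  logarithmic derivative is at least \<open>- 1 / (K - 1)\<close> on \<open>[0, 1]\<close>, and the exponential compensates for
  just that.
\<close>

lemma cotangent_factor_mono:
  fixes K s t :: real
  assumes K: "4 \<le> K" and st: "s \<le> t" "t \<le> 1"
  shows "(1 - s / K) * exp (s / (K - 1)) \<le> (1 - t / K) * exp (t / (K - 1))"
proof (rule DERIV_nonneg_imp_nondecreasing [OF st(1)])
  fix r :: real assume r: "s \<le> r" "r \<le> t"
  have "((\<lambda>s. (1 - s / K) * exp (s / (K - 1))) has_real_derivative
      exp (r / (K - 1)) * ((1 - r) / (K * (K - 1)))) (at r)"
  proof -
    have eq: "- (1 / K) + (1 - r / K) * (1 / (K - 1)) = (1 - r) / (K * (K - 1))"
      using K by (simp add: divide_simps)
    have "exp (r / (K - 1)) * ((1 - r) / (K * (K - 1)))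
        = exp (r / (K - 1)) * (- (1 / K)) + exp (r / (K - 1)) * ((1 - r / K) * (1 / (K - 1)))"
      by (simp only: eq [symmetric] distrib_left)
    also have "\<dots> = - (1 / K) * exp (r / (K - 1)) + exp (r / (K - 1)) * (1 / (K - 1)) * (1 - r / K)"
      by (simp add: ac_simps)
    finally have "exp (r / (K - 1)) * ((1 - r) / (K * (K - 1))) = \<dots>" .
    then show ?thesis by (auto intro!: derivative_eq_intros)
  qed
  moreover have "0 \<le> exp (r / (K - 1)) * ((1 - r) / (K * (K - 1)))"
    using K r st by simp
  ultimately show "\<exists>y. ((\<lambda>s. (1 - s / K) * exp (s / (K - 1))) has_real_derivative y) (at r) \<and> 0 \<le> y"
    by blast
qed

lemma sum_inverse_square_minus_one:
  "(\<Sum>k=2..n + 1. 1 / ((real k)\<^sup>2 - 1)) = 3/4 - 1 / (2 * (real n + 1)) - 1 / (2 * (real n + 2))"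
proof (induction n)
  case (Suc n)
  have e: "(real n + 2)\<^sup>2 - 1 = (real n + 1) * (real n + 3)"
    by (simp add: power2_eq_square algebra_simps)
  have "(\<Sum>k=2..Suc n + 1. 1 / ((real k)\<^sup>2 - 1))
      = (\<Sum>k=2..n + 1. 1 / ((real k)\<^sup>2 - 1)) + 1 / ((real n + 2)\<^sup>2 - 1)"
  proof -
    have "{2..Suc n + 1} = insert (n + 2) {2..n + 1}" by auto
    then show ?thesis by (simp add: add.commute)
  qed
  also have "\<dots> = 3/4 - 1 / (2 * (real n + 1)) - 1 / (2 * (real n + 2)) + 1 / ((real n + 1) * (real n + 3))"
    by (simp only: Suc.IH e)
  also have "1 / ((real n + 1) * (real n + 3)) = 1 / (2 * (real n + 1)) - 1 / (2 * (real n + 3))"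
    by (simp add: divide_simps) (simp add: algebra_simps)
  finally show ?case by (simp add: add.commute)
qed simp

text \<open>
  The sine product without its linear factor and its factor for \<open>k = 1\<close>, every other factor being
  multiplied by its compensating exponential. The exponents add up to \<open>3/4 x\<^sup>2\<close> by
  \<open>sum_inverse_square_minus_one\<close>. Monotonicity passes to the limit of the partial products, so the
  product never has to be differentiated term by term.
\<close>

lemma sin_quotient_mono:
  fixes x y :: real
  assumes "0 < x" "x \<le> y" "y < 1"
  defines "g \<equiv> \<lambda>x::real. sin (pi * x) / (pi * x) / (1 - x\<^sup>2) * exp (3/4 * x\<^sup>2)"
  shows "g x \<le> g y"
proof -
  define P where "P = (\<lambda>x n. \<Prod>k=2..n + 1. (1 - x\<^sup>2 / (real k)\<^sup>2) * exp (x\<^sup>2 / ((real k)\<^sup>2 - 1)))"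
  have K: "4 \<le> (real k)\<^sup>2" if "2 \<le> k" for k
  proof -
    have "(2::real)\<^sup>2 \<le> (real k)\<^sup>2" using that by (intro power_mono) auto
    then show ?thesis by simp
  qed
  have lim: "P x \<longlonglongrightarrow> g x" if x: "0 < x" "x < 1" for x
  proof -
    have x2: "x\<^sup>2 < 1" using x by (simp add: abs_square_less_1)
    have "P x n = (\<Prod>k=1..n+1. 1 - x\<^sup>2 / (real k)\<^sup>2) / (1 - x\<^sup>2)
        * exp (x\<^sup>2 * (3/4 - 1 / (2 * (real n + 1)) - 1 / (2 * (real n + 2))))" for n
    proof -
      have "(\<Prod>k=1..n+1. 1 - x\<^sup>2 / (real k)\<^sup>2) = (1 - x\<^sup>2) * (\<Prod>k=2..n+1. 1 - x\<^sup>2 / (real k)\<^sup>2)"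
        by (subst prod.atLeast_Suc_atMost) (auto simp: numeral_2_eq_2)
      moreover have "(\<Prod>k=2..n+1. exp (x\<^sup>2 / ((real k)\<^sup>2 - 1)))
          = exp (x\<^sup>2 * (\<Sum>k=2..n+1. 1 / ((real k)\<^sup>2 - 1)))"
        by (simp only: exp_sum [symmetric] finite_atLeastAtMost sum_distrib_left) simp
      ultimately show ?thesis
        unfolding P_def prod.distrib sum_inverse_square_minus_one using x2 by simp
    qed
    then have "P x = (\<lambda>n. (\<Prod>k=1..n+1. 1 - x\<^sup>2 / (real k)\<^sup>2) / (1 - x\<^sup>2)
        * exp (x\<^sup>2 * (3/4 - 1 / (2 * (real n + 1)) - 1 / (2 * (real n + 2)))))" ..
    moreover have "(\<lambda>n. (\<Prod>k=1..n+1. 1 - x\<^sup>2 / (real k)\<^sup>2)) \<longlonglongrightarrow> sin (pi * x) / (pi * x)"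
      using LIMSEQ_ignore_initial_segment[OF sin_product_formula_real'[of x], of 1] x by simp
    moreover have "(\<lambda>n. 3/4 - 1 / (2 * (real n + 1)) - 1 / (2 * (real n + 2))) \<longlonglongrightarrow> 3/4 - 0 - 0"
      by real_asymp
    ultimately have "P x \<longlonglongrightarrow> sin (pi * x) / (pi * x) / (1 - x\<^sup>2) * exp (x\<^sup>2 * (3/4 - 0 - 0))"
      using x2 by (simp only:) (intro tendsto_mult tendsto_divide tendsto_exp tendsto_const; simp)
    then show ?thesis by (simp add: g_def mult.commute)
  qed
  have "P x n \<le> P y n" for n
    unfolding P_def
  proof (rule prod_mono)
    fix k assume k: "k \<in> {2..n + 1}"
    have "x\<^sup>2 \<le> y\<^sup>2" "y\<^sup>2 \<le> 1" "x\<^sup>2 \<le> 1" using assms by (auto intro: power_mono simp: power_le_one)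
    moreover have "4 \<le> (real k)\<^sup>2" using K k by auto
    ultimately show "0 \<le> (1 - x\<^sup>2 / (real k)\<^sup>2) * exp (x\<^sup>2 / ((real k)\<^sup>2 - 1)) \<and>
        (1 - x\<^sup>2 / (real k)\<^sup>2) * exp (x\<^sup>2 / ((real k)\<^sup>2 - 1))
        \<le> (1 - y\<^sup>2 / (real k)\<^sup>2) * exp (y\<^sup>2 / ((real k)\<^sup>2 - 1))"
      by (auto intro!: cotangent_factor_mono mult_nonneg_nonneg simp: divide_le_eq_1)
  qed
  moreover have "P x \<longlonglongrightarrow> g x" "P y \<longlonglongrightarrow> g y" using lim[of x] lim[of y] assms(1-3) by auto
  ultimately show ?thesis by (meson LIMSEQ_le)
qed

text \<open>
  The logarithmic derivative of a nondecreasing function is nonnegative; here the function is that of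
  \<open>sin_quotient_mono\<close>. This is the partial fraction expansion of the cotangent with all terms from
  \<open>k = 2\<close> on estimated by their values at \<open>d = \<pi>\<close>.
\<close>

lemma cot_lower_bound:
  fixes d :: real
  assumes d: "0 < d" "d < pi"
  shows "1 - 3 * d\<^sup>2 / (2 * pi\<^sup>2) - 2 * d\<^sup>2 / (pi\<^sup>2 - d\<^sup>2) \<le> d * cot d"
proof -
  define x where "x = d / pi"
  \<comment> \<open>the zeros of the sine product are the integers, whence \<open>d = pi * x\<close>\<close>
  define g where "g = (\<lambda>x::real. ln (sin (pi * x) / (pi * x) / (1 - x\<^sup>2) * exp (3/4 * x\<^sup>2)))"
  have x: "0 < x" "x < 1" and dx: "d = pi * x" using d by (auto simp: x_def field_simps)
  have s: "sin (pi * z) > 0" "z\<^sup>2 < 1" if "0 < z" "z < 1" for z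
    using that by (auto intro!: sin_gt_zero simp: abs_square_less_1)
  have mono: "mono_on {0<..<1} g"
    unfolding mono_on_def g_def
  proof (intro allI impI, goal_cases)
    case (1 r t)
    then have r: "0 < r" "r < 1" "0 < t" "t < 1" "r \<le> t" by auto
    then show ?case using sin_quotient_mono[of r t] s[of r] s[of t] by simp
  qed
  have eq: "g z = ln (sin (pi * z)) - ln (pi * z) - ln (1 - z\<^sup>2) + 3/4 * z\<^sup>2" if "z \<in> {0<..<1}" for z
    using s[of z] that by (simp add: g_def ln_mult ln_div)
  have "((\<lambda>z. ln (sin (pi * z)) - ln (pi * z) - ln (1 - z\<^sup>2) + 3/4 * z\<^sup>2) has_real_derivative
      pi * cot (pi * x) - 1 / x + 2 * x / (1 - x\<^sup>2) + 3/2 * x) (at x)"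
    using s[OF x] x by (auto intro!: derivative_eq_intros simp: cot_def field_simps)
  then have "(g has_real_derivative pi * cot (pi * x) - 1 / x + 2 * x / (1 - x\<^sup>2) + 3/2 * x) (at x)"
    by (rule has_field_derivative_transform_within_open[where S = "{0<..<1}"]) (use x eq in auto)
  from mono_on_imp_deriv_nonneg[OF mono this] x
  have "0 \<le> pi * cot (pi * x) - 1 / x + 2 * x / (1 - x\<^sup>2) + 3/2 * x"
    by simp
  then have "0 \<le> x * (pi * cot (pi * x) - 1 / x + 2 * x / (1 - x\<^sup>2) + 3/2 * x)"
    using x by simp
  also have "\<dots> = d * cot d - 1 + 2 * x\<^sup>2 / (1 - x\<^sup>2) + 3/2 * x\<^sup>2"
    using x by (simp add: dx field_simps power2_eq_square)
  finally have "1 - 3/2 * x\<^sup>2 - 2 * x\<^sup>2 / (1 - x\<^sup>2) \<le> d * cot d" by simp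
  moreover have "3/2 * x\<^sup>2 = 3 * d\<^sup>2 / (2 * pi\<^sup>2)" "2 * x\<^sup>2 / (1 - x\<^sup>2) = 2 * d\<^sup>2 / (pi\<^sup>2 - d\<^sup>2)"
    using s(2)[OF x] by (auto simp: dx field_simps power2_eq_square)
  ultimately show ?thesis by simp
qed

lemma cot_upper_bound:
  fixes d :: real
  assumes d: "0 < d" "d < pi"
  shows "d * cot d \<le> 1"
proof -
  have "sin 0 - 0 * cos 0 \<le> sin d - d * cos d"
  proof (rule DERIV_nonneg_imp_nondecreasing [where f = "\<lambda>t. sin t - t * cos t"])
    fix t assume t: "0 \<le> t" "t \<le> d"
    have "((\<lambda>t. sin t - t * cos t) has_real_derivative t * sin t) (at t)"
      by (auto intro!: derivative_eq_intros)
    moreover have "0 \<le> t * sin t" using t d by (auto intro!: mult_nonneg_nonneg sin_ge_zero)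
    ultimately show "\<exists>y. ((\<lambda>t. sin t - t * cos t) has_real_derivative y) (at t) \<and> 0 \<le> y" by blast
  qed (use d in auto)
  then show ?thesis using sin_gt_zero[OF d] by (simp add: cot_def field_simps)
qed

lemma c_const_eq:
  assumes "0 \<le> \<delta>" "\<delta> < pi / 2"
  shows "c_const \<delta> = - 3 / pi\<^sup>2 - 4 / (pi\<^sup>2 - (\<delta> + pi / 2)\<^sup>2)"
proof -
  have "(\<delta> + pi / 2)\<^sup>2 < pi\<^sup>2" using assms by (intro power_strict_mono) auto
  then have "pi\<^sup>2 - (\<delta> + pi/2)\<^sup>2 > 0" by simp
  then show ?thesis unfolding c_const_def
    by (simp add: divide_simps) (simp add: algebra_simps)
qed

lemma c_const_nonpos:
  assumes "0 \<le> \<delta>" "\<delta> < pi / 2"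
  shows "c_const \<delta> \<le> 0"
proof -
  have "(\<delta> + pi / 2)\<^sup>2 < pi\<^sup>2" using assms by (intro power_strict_mono) auto
  then have "0 \<le> 4 / (pi\<^sup>2 - (\<delta> + pi / 2)\<^sup>2)" "0 \<le> 3 / pi\<^sup>2" by simp_all
  then show ?thesis unfolding c_const_eq[OF assms] by linarith
qed

text \<open>
  The constant \<open>c(\<delta>)\<close> is twice the lower bound for \<open>(d cot d - 1) / d\<^sup>2\<close> of \<open>cot_lower_bound\<close> at the
  largest admissible distance \<open>d = \<delta> + \<pi>/2\<close>, where that bound is smallest.
\<close>

lemma cot_bound_c_const:
  assumes "0 \<le> \<delta>" "\<delta> < pi / 2" "0 < d" "d \<le> \<delta> + pi / 2"
  shows "c_const \<delta> / 2 * d\<^sup>2 \<le> d * cot d - 1"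
proof -
  have 1: "(\<delta> + pi / 2)\<^sup>2 < pi\<^sup>2" using assms by (intro power_strict_mono) auto
  have 2: "d\<^sup>2 \<le> (\<delta> + pi / 2)\<^sup>2" using assms by (intro power_mono) auto
  have "2 * d\<^sup>2 / (pi\<^sup>2 - d\<^sup>2) \<le> 2 * d\<^sup>2 / (pi\<^sup>2 - (\<delta> + pi / 2)\<^sup>2)"
    using 1 2 by (intro divide_left_mono) auto
  moreover have "c_const \<delta> / 2 * d\<^sup>2 = - (3 * d\<^sup>2 / (2 * pi\<^sup>2)) - 2 * d\<^sup>2 / (pi\<^sup>2 - (\<delta> + pi / 2)\<^sup>2)"
    unfolding c_const_eq[OF assms(1,2)] by (simp add: divide_simps) (simp add: algebra_simps)
  ultimately show ?thesis using cot_lower_bound[of d] assms by simp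
qed

section \<open>Geodesic distance on the hemisphere\<close>

lemma hemisphere_inner:
  assumes "x \<in> upper_hemisphere" "a \<in> upper_hemisphere"
  shows "norm x = 1" "x \<bullet> x = 1" "- 1 < x \<bullet> a" "x \<bullet> a \<le> 1" "x \<noteq> a \<Longrightarrow> x \<bullet> a < 1" 
proof -
  show n: "norm x = 1" using assms by (simp add: upper_hemisphere_def unit_sphere_def)
  then show "x \<bullet> x = 1" by (simp add: dot_square_norm)
  have na: "norm a = 1" using assms by (simp add: upper_hemisphere_def unit_sphere_def)
  have xx: "x \<bullet> x = 1" and aa: "a \<bullet> a = 1" using n na by (simp_all add: dot_square_norm)
  show le: "x \<bullet> a \<le> 1" using norm_cauchy_schwarz[of x a] n na by simp
  have "snd (x + a) > 0" using assms by (simp add: upper_hemisphere_def)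
  then have "x + a \<noteq> 0" by (metis less_irrefl snd_zero)
  then have "0 < (norm (x + a))\<^sup>2" by simp
  also have "(norm (x + a))\<^sup>2 = 2 + 2 * (x \<bullet> a)"
    using xx aa by (simp add: power2_norm_eq_inner inner_add_left inner_add_right inner_commute[of a x])
  finally show "- 1 < x \<bullet> a" by simp
  assume "x \<noteq> a"
  then have "0 < (norm (x - a))\<^sup>2" by simp
  also have "(norm (x - a))\<^sup>2 = 2 - 2 * (x \<bullet> a)"
    using xx aa by (simp add: power2_norm_eq_inner inner_diff_left inner_diff_right inner_commute[of a x])
  finally show "x \<bullet> a < 1" by simp
qed

lemma norm_tangent_component:
  fixes x a :: "'a::real_inner"
  assumes "norm x = 1" "norm a = 1"
  shows "norm (a - (x \<bullet> a) *\<^sub>R x) = sqrt (1 - (x \<bullet> a)\<^sup>2)"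
proof -
  have "(a - (x \<bullet> a) *\<^sub>R x) \<bullet> (a - (x \<bullet> a) *\<^sub>R x)
      = a \<bullet> a - 2 * ((x \<bullet> a) * (x \<bullet> a)) + (x \<bullet> a) * (x \<bullet> a) * (x \<bullet> x)"
    by (simp add: inner_diff_left inner_diff_right inner_commute[of a x] algebra_simps)
  then show ?thesis
    using assms by (simp add: norm_eq_sqrt_inner power2_eq_square)
qed

lemma tangent_inner_bound:
  fixes w h a :: "'a::real_inner"
  assumes "norm w = 1" "norm a = 1" "w \<bullet> h = 0"
  shows "\<bar>h \<bullet> a\<bar> \<le> norm h * sqrt (1 - (w \<bullet> a)\<^sup>2)"
proof -
  have "h \<bullet> a = h \<bullet> (a - (w \<bullet> a) *\<^sub>R w)"
    using assms by (simp add: inner_diff_right inner_commute)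
  also have "\<bar>\<dots>\<bar> \<le> norm h * norm (a - (w \<bullet> a) *\<^sub>R w)"
    by (rule Cauchy_Schwarz_ineq2)
  also have "norm (a - (w \<bullet> a) *\<^sub>R w) = sqrt (1 - (w \<bullet> a)\<^sup>2)"
    by (rule norm_tangent_component[OF assms(1,2)])
  finally show ?thesis .
qed

text \<open>
  The distance function \<open>arccos (z \<bullet> a)\<close> has a gradient of norm 1, so that it varies by no more than
  the length along a curve; but it is not differentiable at \<open>a\<close>, where the curve ends. For \<open>\<eta> < 1\<close>
  the function \<open>arccos (\<eta> (z \<bullet> a))\<close> is smooth on the whole sphere and still has a gradient of norm at
  most 1. The claim follows from \<open>\<eta> \<longrightarrow> 1\<close>.
\<close>

lemma curve_length_ge_arccos:
  fixes \<gamma> :: "real \<Rightarrow> 'n::finite amb"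
  assumes adm: "admissible_curve \<gamma>"
  shows "arccos (pathstart \<gamma> \<bullet> pathfinish \<gamma>) \<le> curve_length \<gamma>"
proof -
  define a where "a = pathfinish \<gamma>"
  have vp: "valid_path \<gamma>"
    using adm by (simp add: admissible_curve_def)
  have im: "\<gamma> t \<in> unit_sphere" if "t \<in> {0..1}" for t
    using adm that by (auto simp: admissible_curve_def path_image_def)
  have int: "(\<lambda>t. norm (vector_derivative \<gamma> (at t))) integrable_on {0..1}"
    using adm by (simp add: admissible_curve_def)
  have sph: "norm (\<gamma> t) = 1" if "t \<in> {0..1}" for t
    using im[OF that] by (simp add: unit_sphere_def)
  have na: "norm a = 1" using sph[of 1] by (simp add: a_def pathfinish_def)
  have ab: "\<bar>\<gamma> t \<bullet> a\<bar> \<le> 1" if "t \<in> {0..1}" for t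
    using Cauchy_Schwarz_ineq2[of "\<gamma> t" a] sph[OF that] na by simp
  obtain S where S: "finite S" "\<gamma> C1_differentiable_on ({0..1} - S)" and cont: "continuous_on {0..1} \<gamma>"
    using vp unfolding valid_path_def piecewise_C1_differentiable_on_def by auto
  have der: "(\<gamma> has_vector_derivative vector_derivative \<gamma> (at t)) (at t)" if "t \<in> {0<..<1} - S" for t
    using S that by (auto simp: C1_differentiable_on_eq vector_derivative_works)
  have tang: "\<gamma> t \<bullet> vector_derivative \<gamma> (at t) = 0" if t: "t \<in> {0<..<1} - S" for t
  proof -
    have 1: "((\<lambda>t. \<gamma> t \<bullet> \<gamma> t) has_vector_derivative
        \<gamma> t \<bullet> vector_derivative \<gamma> (at t) + vector_derivative \<gamma> (at t) \<bullet> \<gamma> t) (at t)"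
      by (rule bounded_bilinear.has_vector_derivative[OF bounded_bilinear_inner der[OF t] der[OF t]])
    have 2: "((\<lambda>t. \<gamma> t \<bullet> \<gamma> t) has_vector_derivative 0) (at t)"
      by (rule has_vector_derivative_transform_within_open[of "\<lambda>t. 1" _ _ "{0<..<1}"])
         (use t sph in \<open>auto simp: dot_square_norm\<close>)
    have "\<gamma> t \<bullet> vector_derivative \<gamma> (at t) + vector_derivative \<gamma> (at t) \<bullet> \<gamma> t = 0"
      by (rule vector_derivative_unique_at[OF 1 2])
    then show ?thesis by (simp add: inner_commute[of "vector_derivative \<gamma> (at t)"])
  qed
  have bound: "arccos (\<eta> * (pathstart \<gamma> \<bullet> a)) - arccos \<eta> \<le> curve_length \<gamma>"
    if eta: "0 < \<eta>" "\<eta> < 1" for \<eta>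
  proof -
    define g where "g = (\<lambda>t. - arccos (\<eta> * (\<gamma> t \<bullet> a)))"
    define g' where "g' = (\<lambda>t. \<eta> * (vector_derivative \<gamma> (at t) \<bullet> a) / sqrt (1 - (\<eta> * (\<gamma> t \<bullet> a))\<^sup>2))"
    have lt: "\<bar>\<eta> * (\<gamma> t \<bullet> a)\<bar> < 1" if "t \<in> {0..1}" for t
    proof -
      have "\<bar>\<eta> * (\<gamma> t \<bullet> a)\<bar> \<le> \<eta> * 1"
        using ab[OF that] eta by (simp add: abs_mult)
      then show ?thesis using eta by simp
    qed
    have gint: "(g' has_integral (g 1 - g 0)) {0..1}"
    proof (rule fundamental_theorem_of_calculus_interior_strong[OF S(1)])
      fix t assume t: "t \<in> {0<..<1} - S"
      then have "t \<in> {0..1}" by auto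
      from lt[OF this] have l: "- 1 < \<eta> * (\<gamma> t \<bullet> a)" "\<eta> * (\<gamma> t \<bullet> a) < 1" by auto
      have "((\<lambda>t. \<gamma> t \<bullet> a) has_real_derivative vector_derivative \<gamma> (at t) \<bullet> a) (at t)"
        using bounded_linear.has_vector_derivative[OF bounded_linear_inner_left der[OF t]]
        by (simp add: has_real_derivative_iff_has_vector_derivative)
      then have "(g has_real_derivative g' t) (at t)"
        unfolding g_def g'_def using l
        by (auto intro!: derivative_eq_intros simp: divide_inverse)
      then show "(g has_vector_derivative g' t) (at t)"
        by (simp add: has_real_derivative_iff_has_vector_derivative)
    next
      show "continuous_on {0..1} g"
        unfolding g_def
      proof (intro continuous_intros ballI cont)
        fix t :: real assume "t \<in> {0..1}"
        from lt[OF this] show "- 1 \<le> \<eta> * (\<gamma> t \<bullet> a) \<and> \<eta> * (\<gamma> t \<bullet> a) \<le> 1" by auto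
      qed
    qed simp
    have len: "((\<lambda>t. norm (vector_derivative \<gamma> (at t))) has_integral curve_length \<gamma>) {0..1}"
      unfolding curve_length_def using int by (rule integrable_integral)
    have le: "g' t \<le> norm (vector_derivative \<gamma> (at t))" if t: "t \<in> {0..1} - (S \<union> {0, 1})" for t
    proof -
      from t have t1: "t \<in> {0<..<1} - S" and t2: "t \<in> {0..1}" by auto
      let ?v = "vector_derivative \<gamma> (at t)"
      define s where "s = \<gamma> t \<bullet> a"
      have "\<bar>?v \<bullet> a\<bar> \<le> norm ?v * sqrt (1 - s\<^sup>2)"
        unfolding s_def by (rule tangent_inner_bound[OF sph[OF t2] na tang[OF t1]])
      moreover have s1: "s\<^sup>2 \<le> 1" using ab[OF t2] by (simp add: s_def abs_square_le_1)
      have e2: "\<eta>\<^sup>2 \<le> 1" using eta by (simp add: power_le_one)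
      have "\<eta>\<^sup>2 * s\<^sup>2 \<le> 1 * s\<^sup>2" using e2 by (rule mult_right_mono) simp
      then have "sqrt (1 - s\<^sup>2) \<le> sqrt (1 - (\<eta> * s)\<^sup>2)" by (simp add: power_mult_distrib)
      ultimately have "\<bar>?v \<bullet> a\<bar> \<le> norm ?v * sqrt (1 - (\<eta> * s)\<^sup>2)"
        by (meson mult_left_mono norm_ge_zero order_trans)
      moreover have pos: "sqrt (1 - (\<eta> * s)\<^sup>2) > 0"
        using lt[OF t2] by (simp add: s_def abs_square_less_1)
      moreover have "\<eta> * \<bar>?v \<bullet> a\<bar> \<le> 1 * \<bar>?v \<bullet> a\<bar>" using eta by (intro mult_right_mono) auto
      ultimately have "\<eta> * \<bar>?v \<bullet> a\<bar> / sqrt (1 - (\<eta> * s)\<^sup>2) \<le> norm ?v"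
        by (simp add: pos_divide_le_eq)
      moreover have "g' t \<le> \<eta> * \<bar>?v \<bullet> a\<bar> / sqrt (1 - (\<eta> * s)\<^sup>2)"
        unfolding g'_def s_def[symmetric] using pos eta by (intro divide_right_mono mult_left_mono) auto
      ultimately show "g' t \<le> norm ?v" by simp
    qed
    have "((\<lambda>t. if t \<in> S \<union> {0, 1} then norm (vector_derivative \<gamma> (at t)) else g' t)
        has_integral (g 1 - g 0)) {0..1}"
      by (rule has_integral_spike_finite[OF _ _ gint, where S = "S \<union> {0, 1}"]) (use S in auto)
    then have "g 1 - g 0 \<le> curve_length \<gamma>"
      by (rule has_integral_le[OF _ len]) (use le in auto)
    moreover have "g 1 = - arccos \<eta>" "g 0 = - arccos (\<eta> * (pathstart \<gamma> \<bullet> a))"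
      using na by (simp_all add: g_def a_def pathstart_def pathfinish_def dot_square_norm)
    ultimately show ?thesis by simp
  qed
  have cb: "\<bar>pathstart \<gamma> \<bullet> a\<bar> \<le> 1" using ab[of 0] by (simp add: pathstart_def)
  have "((\<lambda>\<eta>. arccos (\<eta> * (pathstart \<gamma> \<bullet> a)) - arccos \<eta>) \<longlongrightarrow>
      arccos (1 * (pathstart \<gamma> \<bullet> a)) - arccos 1) (at 1 within {0..1})"
  proof -
    have "continuous_on {0..1} (\<lambda>\<eta>. arccos (\<eta> * (pathstart \<gamma> \<bullet> a)) - arccos \<eta>)"
    proof (intro continuous_intros ballI)
      fix \<eta> :: real assume "\<eta> \<in> {0..1}"
      then have "\<bar>\<eta> * (pathstart \<gamma> \<bullet> a)\<bar> \<le> 1 * 1"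
        unfolding abs_mult using cb by (intro mult_mono) auto
      then show "- 1 \<le> \<eta> * (pathstart \<gamma> \<bullet> a) \<and> \<eta> * (pathstart \<gamma> \<bullet> a) \<le> 1" by linarith
    qed simp
    then have "\<forall>z\<in>{0..1}. ((\<lambda>\<eta>. arccos (\<eta> * (pathstart \<gamma> \<bullet> a)) - arccos \<eta>) \<longlongrightarrow>
        arccos (z * (pathstart \<gamma> \<bullet> a)) - arccos z) (at z within {0..1})"
      by (simp only: continuous_on_def)
    from bspec[OF this, of 1] show ?thesis by simp
  qed
  then have "arccos (1 * (pathstart \<gamma> \<bullet> a)) - arccos 1 \<le> curve_length \<gamma>"
  proof (rule tendsto_upperbound)
    show "\<forall>\<^sub>F \<eta> in at 1 within {0..1}. arccos (\<eta> * (pathstart \<gamma> \<bullet> a)) - arccos \<eta> \<le> curve_length \<gamma>"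
      unfolding eventually_at
    proof (intro exI[of _ 1] conjI ballI impI)
      fix \<eta> :: real assume "\<eta> \<in> {0..1}" "\<eta> \<noteq> 1 \<and> dist \<eta> 1 < 1"
      then show "arccos (\<eta> * (pathstart \<gamma> \<bullet> a)) - arccos \<eta> \<le> curve_length \<gamma>"
        by (intro bound) (auto simp: dist_real_def)
    qed simp
    show "at 1 within {0..1::real} \<noteq> bot"
      by (simp add: trivial_limit_within islimpt_Icc)
  qed
  then show ?thesis by (simp add: a_def)
qed

lemma great_circle_arc:
  fixes x y :: "'n::finite amb"
  assumes x: "norm x = 1" and y: "norm y = 1" and anti: "x \<bullet> y > - 1"
  obtains \<gamma> where "admissible_curve \<gamma>" "pathstart \<gamma> = x" "pathfinish \<gamma> = y"
    "curve_length \<gamma> = arccos (x \<bullet> y)"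
proof (cases "x \<bullet> y = 1")
  case True
  have "(norm (x - y))\<^sup>2 = 0"
    using x y True by (simp add: power2_norm_eq_inner inner_diff_left inner_diff_right inner_commute[of y x] norm_eq_1)
  then have xy: "x = y" by simp
  show ?thesis
  proof (rule that[of "\<lambda>t. x"])
    show "admissible_curve (\<lambda>t. x)"
      unfolding admissible_curve_def using x
      by (auto simp: unit_sphere_def path_image_def valid_path_def
          intro: C1_differentiable_imp_piecewise)
  qed (auto simp: xy pathstart_def pathfinish_def curve_length_def y norm_eq_1[THEN iffD1, OF y])
next
  case False
  have le: "x \<bullet> y \<le> 1" using norm_cauchy_schwarz[of x y] x y by simp
  define \<theta> where "\<theta> = arccos (x \<bullet> y)"
  have th: "0 < \<theta>" "\<theta> < pi" "cos \<theta> = x \<bullet> y"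
    using arccos_lt_bounded[of "x \<bullet> y"] False le anti by (auto simp: \<theta>_def)
  have sn: "sin \<theta> > 0" using th by (simp add: sin_gt_zero)
  define e where "e = (y - cos \<theta> *\<^sub>R x) /\<^sub>R sin \<theta>"
  have xe: "x \<bullet> e = 0" using x by (simp add: e_def inner_diff_right th dot_square_norm)
  have xx: "x \<bullet> x = 1" and yy: "y \<bullet> y = 1" using x y by (simp_all add: dot_square_norm)
  have ex: "e \<bullet> x = 0" using xe by (simp add: inner_commute)
  have "(y - cos \<theta> *\<^sub>R x) \<bullet> (y - cos \<theta> *\<^sub>R x) = (sin \<theta>)\<^sup>2"
    unfolding sin_squared_eq th(3) using xx yy
    by (simp add: inner_diff_left inner_diff_right inner_commute[of y x] power2_eq_square)
  then have "e \<bullet> e = inverse (sin \<theta>) * (inverse (sin \<theta>) * (sin \<theta>)\<^sup>2)"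
    by (simp add: e_def)
  also have "\<dots> = 1" using sn by (simp add: power2_eq_square field_simps)
  finally have ee: "e \<bullet> e = 1" .
  define \<gamma> where "\<gamma> = (\<lambda>t. cos (t * \<theta>) *\<^sub>R x + sin (t * \<theta>) *\<^sub>R e)"
  define \<gamma>' where "\<gamma>' = (\<lambda>t. \<theta> *\<^sub>R ((- sin (t * \<theta>)) *\<^sub>R x + cos (t * \<theta>) *\<^sub>R e))"
  have der: "(\<gamma> has_vector_derivative \<gamma>' t) (at t)" for t
    unfolding \<gamma>_def \<gamma>'_def
    by (auto intro!: derivative_eq_intros simp: algebra_simps)
  have vd: "vector_derivative \<gamma> (at t) = \<gamma>' t" for t
    using der by (rule vector_derivative_at)
  have sp: "norm (\<gamma>' t) = \<theta>" for t
  proof -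
    have "norm ((- sin (t * \<theta>)) *\<^sub>R x + cos (t * \<theta>) *\<^sub>R e) = 1"
      using xx xe ex ee by (simp add: norm_eq_sqrt_inner inner_add_left inner_add_right inner_diff_left inner_diff_right
          flip: power2_eq_square)
    then show ?thesis using th by (simp add: \<gamma>'_def)
  qed
  have nm: "norm (\<gamma> t) = 1" for t
    using xx xe ex ee by (simp add: \<gamma>_def norm_eq_sqrt_inner inner_add_left inner_add_right
        flip: power2_eq_square)
  show ?thesis
  proof (rule that[of \<gamma>])
    have "\<gamma> C1_differentiable_on {0..1}"
      unfolding C1_differentiable_on_def
    proof (intro exI[of _ \<gamma>'] conjI ballI der)
      show "continuous_on {0..1} \<gamma>'" unfolding \<gamma>'_def by (intro continuous_intros)
    qed
    then have "valid_path \<gamma>"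
      by (simp add: valid_path_def C1_differentiable_imp_piecewise)
    then show "admissible_curve \<gamma>"
      by (auto simp: admissible_curve_def unit_sphere_def path_image_def nm vd sp)
    show "pathstart \<gamma> = x" by (simp add: \<gamma>_def pathstart_def)
    show "pathfinish \<gamma> = y" using sn by (simp add: \<gamma>_def pathfinish_def e_def)
    show "curve_length \<gamma> = arccos (x \<bullet> y)" by (simp add: curve_length_def vd sp \<theta>_def)
  qed
qed

text \<open>
  The infimum is a minimum: the great circle arc is admissible, and two points of the open hemisphere
  are never antipodal.
\<close>

lemma geodesic_dist_eq_arccos:
  assumes "x \<in> upper_hemisphere" "a \<in> upper_hemisphere"
  shows "geodesic_dist x a = arccos (x \<bullet> a)"
proof -
  let ?L = "{curve_length \<gamma> |\<gamma>. admissible_curve \<gamma> \<and> pathstart \<gamma> = x \<and> pathfinish \<gamma> = a}"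
  obtain \<gamma> where "admissible_curve \<gamma>" "pathstart \<gamma> = x" "pathfinish \<gamma> = a"
      "curve_length \<gamma> = arccos (x \<bullet> a)"
    by (rule great_circle_arc[OF hemisphere_inner(1)[OF assms]
          hemisphere_inner(1)[OF assms(2,1)] hemisphere_inner(3)[OF assms]])
  then have "arccos (x \<bullet> a) \<in> ?L" by (metis (mono_tags, lifting) mem_Collect_eq)
  moreover have "arccos (x \<bullet> a) \<le> l" if l: "l \<in> ?L" for l
  proof -
    obtain \<gamma> where "l = curve_length \<gamma>" "admissible_curve \<gamma>" "pathstart \<gamma> = x" "pathfinish \<gamma> = a"
      using l by blast
    then show ?thesis using curve_length_ge_arccos[of \<gamma>] by simp
  qed
  ultimately show ?thesis
    unfolding geodesic_dist_def by (rule cInf_eq_minimum)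
qed

text \<open>
  The triangle inequality for the path from \<open>x\<close> to \<open>a\<close> through the north pole, where the first leg is
  at most \<open>\<pi>/2\<close>. With the heights \<open>t\<close> and \<open>s\<close> of the two points, the addition theorem of the cosine
  reduces it to the Cauchy-Schwarz inequality for the horizontal parts.
\<close>

lemma arccos_triangle_pole:
  fixes x a :: "'n::finite amb"
  assumes "x \<in> upper_hemisphere" "a \<in> upper_hemisphere"
  shows "arccos (x \<bullet> a) \<le> arccos (north_pole \<bullet> a) + pi / 2"
proof -
  define t where "t = snd x"
  define s where "s = snd a"
  have nx: "norm x = 1" and na: "norm a = 1"
    using hemisphere_inner(1)[OF assms] hemisphere_inner(1)[OF assms(2,1)] by simp_all
  have t: "0 < t" "t \<le> 1" and s: "0 < s" "s \<le> 1"
    using assms nx na norm_snd_le[of "snd x" "fst x"] norm_snd_le[of "snd a" "fst a"]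
    by (auto simp: t_def s_def upper_hemisphere_def)
  have f: "(norm (fst x))\<^sup>2 = 1 - t\<^sup>2" "(norm (fst a))\<^sup>2 = 1 - s\<^sup>2"
    using nx na by (simp_all add: norm_prod_def t_def s_def)
  have A: "0 \<le> arccos t" "arccos t \<le> pi / 2" "0 \<le> arccos s" "arccos s \<le> pi/2"
    using s t arccos_le_pi2[of s] arccos_le_pi2[of t] by (auto intro: arccos_lbound)
  have "cos (arccos t + arccos s) = t * s - norm (fst x) * norm (fst a)"
    using s t by (simp add: cos_add sin_arccos f[symmetric])
  also have "\<dots> \<le> x \<bullet> a"
    using Cauchy_Schwarz_ineq2[of "fst x" "fst a"] by (simp add: inner_prod_def t_def s_def)
  finally have "arccos (x \<bullet> a) \<le> arccos (cos (arccos t + arccos s))"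
    using hemisphere_inner(4)[OF assms] by (intro arccos_le_arccos) auto
  also have "\<dots> = arccos t + arccos s" using A by (intro arccos_cos) auto
  finally show ?thesis using A by (simp add: north_pole_def inner_prod_def s_def)
qed

section \<open>Tangential gradients\<close>

lemma unit_sphere_inner_self: "x \<in> unit_sphere \<Longrightarrow> x \<bullet> x = 1"
  by (simp add: unit_sphere_def norm_eq_1)

text \<open>
  On the sphere \<open>x \<bullet> z\<close> equals \<open>1 - |z - x|\<^sup>2 / 2\<close>. Hence derivatives within the sphere are determined
  only up to multiples of \<open>x\<close>, and any ambient gradient may be replaced by its tangential part.
\<close>

lemma has_derivative_radial_within_sphere:
  fixes x :: "'n::finite amb"
  assumes x: "x \<in> unit_sphere"
  shows "((\<lambda>z. x \<bullet> z) has_derivative (\<lambda>h. 0)) (at x within unit_sphere)"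
proof (rule has_derivative_transform[OF x])
  show "((\<lambda>z. 1 - ((z - x) \<bullet> (z - x)) / 2) has_derivative (\<lambda>h. 0)) (at x within unit_sphere)"
    by (auto intro!: derivative_eq_intros)
  show "x \<bullet> z = 1 - ((z - x) \<bullet> (z - x)) / 2" if "z \<in> unit_sphere" for z
    using unit_sphere_inner_self[OF that] unit_sphere_inner_self[OF x]
    by (simp add: inner_diff_left inner_diff_right inner_commute[of z x] field_simps)
qed

text \<open>
  Differentiate along the great circle through \<open>x\<close> in the direction of \<open>w - w'\<close>.
\<close>

lemma tangent_gradient_unique:
  fixes x :: "'n::finite amb"
  assumes x: "x \<in> unit_sphere" and w: "x \<bullet> w = 0" "x \<bullet> w' = 0"
    and d: "(f has_derivative (\<lambda>h. w \<bullet> h)) (at x within unit_sphere)"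
      "(f has_derivative (\<lambda>h. w' \<bullet> h)) (at x within unit_sphere)"
  shows "w = w'"
proof (rule ccontr)
  assume "w \<noteq> w'"
  define e where "e = (w - w') /\<^sub>R norm (w - w')"
  have xx: "x \<bullet> x = 1" using x by (rule unit_sphere_inner_self)
  have ee: "e \<bullet> e = 1" using \<open>w \<noteq> w'\<close> by (simp add: e_def dot_square_norm power2_eq_square)
  have xe: "x \<bullet> e = 0" using w by (simp add: e_def inner_diff_right)
  then have ex: "e \<bullet> x = 0" by (simp add: inner_commute)
  define c where "c = (\<lambda>t. cos t *\<^sub>R x + sin t *\<^sub>R e)"
  have im: "c ` UNIV \<subseteq> unit_sphere"
    using xx ee xe ex by (auto simp: c_def unit_sphere_def norm_eq_1 inner_add_left inner_add_right
        simp flip: power2_eq_square)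
  have c0: "c 0 = x" by (simp add: c_def)
  have dc: "(c has_derivative (\<lambda>t. t *\<^sub>R e)) (at 0)"
    unfolding c_def by (auto intro!: derivative_eq_intros)
  have "((\<lambda>z. f z - f z) has_derivative (\<lambda>h. w \<bullet> h - w' \<bullet> h)) (at x within unit_sphere)"
    by (rule has_derivative_diff[OF d])
  then have "((\<lambda>z. 0::real) has_derivative (\<lambda>h. (w - w') \<bullet> h)) (at x within unit_sphere)"
    by (simp add: inner_diff_left)
  then have "((\<lambda>z. 0::real) has_derivative (\<lambda>h. (w - w') \<bullet> h)) (at (c 0) within c ` UNIV)"
    unfolding c0 using im by (rule has_derivative_subset)
  from diff_chain_within[OF dc this]
  have "((\<lambda>t. 0::real) has_derivative (\<lambda>t. t * ((w - w') \<bullet> e))) (at 0)"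
    by (simp add: o_def)
  then have "(\<lambda>t. t * ((w - w') \<bullet> e)) = (\<lambda>t. 0)"
    by (rule has_derivative_unique) simp
  from fun_cong[OF this, of 1] have "(w - w') \<bullet> e = 0" by simp
  then show False using \<open>w \<noteq> w'\<close> by (simp add: e_def)
qed

text \<open>
  Reads off the intrinsic gradient from any ambient representation \<open>W\<close> of the derivative; it also
  discharges the definite description in the definition of the gradient.
\<close>

lemma sphere_grad_eqI:
  fixes x :: "'n::finite amb"
  assumes x: "x \<in> unit_sphere"
    and d: "(f has_derivative (\<lambda>h. W \<bullet> h)) (at x within unit_sphere)"
  shows "sphere_grad f x = W - (x \<bullet> W) *\<^sub>R x"
  unfolding sphere_grad_def
proof (rule the_equality)
  have z: "((\<lambda>z. (x \<bullet> W) * (x \<bullet> z)) has_derivative (\<lambda>h. (x \<bullet> W) * 0)) (at x within unit_sphere)"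
    by (intro has_derivative_mult_right has_derivative_radial_within_sphere x)
  have "((\<lambda>z. f z + (x \<bullet> W) * (x \<bullet> z) - (x \<bullet> W) * (x \<bullet> z)) has_derivative
      (\<lambda>h. W \<bullet> h + (x \<bullet> W) * 0 - (x \<bullet> W) * (x \<bullet> h))) (at x within unit_sphere)"
    by (intro has_derivative_diff has_derivative_add d z) (auto intro!: derivative_eq_intros)
  then have "(f has_derivative (\<lambda>h. (W - (x \<bullet> W) *\<^sub>R x) \<bullet> h)) (at x within unit_sphere)"
    by (simp add: inner_diff_left)
  moreover have "x \<bullet> (W - (x \<bullet> W) *\<^sub>R x) = 0"
    using unit_sphere_inner_self[OF x] by (simp add: inner_diff_right)
  ultimately show *: "x \<bullet> (W - (x \<bullet> W) *\<^sub>R x) = 0 \<and>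
      (f has_derivative (\<lambda>h. (W - (x \<bullet> W) *\<^sub>R x) \<bullet> h)) (at x within unit_sphere)" by blast
  show "w = W - (x \<bullet> W) *\<^sub>R x"
    if "x \<bullet> w = 0 \<and> (f has_derivative (\<lambda>h. w \<bullet> h)) (at x within unit_sphere)" for w
    using that * tangent_gradient_unique[OF x] by blast
qed

text \<open>
  The hemisphere is open in the sphere, so derivatives at its points depend only on the values there.
  This matters because closed formulas, for instance for the distance, are at hand on the
  hemisphere only.
\<close>

lemma has_derivative_hemisphere_transform:
  fixes x :: "'n::finite amb"
  assumes f: "(f has_derivative f') (at x within unit_sphere)" and x: "x \<in> upper_hemisphere"
    and eq: "\<And>z. z \<in> upper_hemisphere \<Longrightarrow> f z = g z"
  shows "(g has_derivative f') (at x within unit_sphere)"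
proof -
  have "open {z::'n amb. snd z > 0}"
    by (intro open_Collect_less continuous_intros)
  moreover have "x \<in> {z. snd z > 0}" using x by (simp add: upper_hemisphere_def)
  ultimately obtain d where d: "d > 0" "ball x d \<subseteq> {z. snd z > 0}"
    unfolding open_contains_ball by blast
  show ?thesis
  proof (rule has_derivative_transform_within[OF f d(1)])
    show "x \<in> unit_sphere" using x by (simp add: upper_hemisphere_def)
    fix z assume z: "z \<in> unit_sphere" "dist z x < d"
    then have "z \<in> ball x d" by (simp add: dist_commute)
    with d z show "f z = g z" by (intro eq) (auto simp: upper_hemisphere_def)
  qed
qed

lemma sphere_grad_geodesic_dist:
  assumes x: "x \<in> upper_hemisphere" and a: "a \<in> upper_hemisphere" and ne: "x \<noteq> a"
  shows "sphere_grad (\<lambda>z. geodesic_dist z a) x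
    = - (1 / sqrt (1 - (x \<bullet> a)\<^sup>2)) *\<^sub>R (a - (x \<bullet> a) *\<^sub>R x)"
proof -
  let ?r = "1 / sqrt (1 - (x \<bullet> a)\<^sup>2)"
  have xs: "x \<in> unit_sphere" using x by (simp add: upper_hemisphere_def)
  have s: "- 1 < x \<bullet> a" "x \<bullet> a < 1" using hemisphere_inner[OF x a] ne by auto
  have "((\<lambda>z. arccos (z \<bullet> a)) has_derivative (\<lambda>h. (h \<bullet> a) * inverse (- sqrt (1 - (x \<bullet> a)\<^sup>2)))) (at x within unit_sphere)"
    by (rule DERIV_compose_FDERIV[where f = arccos and g = "\<lambda>z. z \<bullet> a", OF DERIV_arccos[OF s]])
      (auto intro!: derivative_eq_intros)
  then have "((\<lambda>z. arccos (z \<bullet> a)) has_derivative (\<lambda>h. ((- ?r) *\<^sub>R a) \<bullet> h)) (at x within unit_sphere)"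
    by (simp add: divide_inverse inner_commute mult.commute)
  then have "((\<lambda>z. geodesic_dist z a) has_derivative (\<lambda>h. ((- ?r) *\<^sub>R a) \<bullet> h)) (at x within unit_sphere)"
    by (rule has_derivative_hemisphere_transform[OF _ x]) (simp add: geodesic_dist_eq_arccos a)
  from sphere_grad_eqI[OF xs this] show ?thesis
    by (simp add: algebra_simps)
qed

lemma graph_chart_hemisphere:
  "y \<in> ball 0 1 \<Longrightarrow> graph_chart y \<in> upper_hemisphere"
  "fst (graph_chart y) = y"
  by (simp_all add: graph_chart_def upper_hemisphere_def unit_sphere_def norm_prod_def abs_square_less_1
      power_le_one_iff)

lemma hemisphere_graph_chart:
  assumes "x \<in> upper_hemisphere"
  shows "fst x \<in> ball 0 1" "graph_chart (fst x) = x"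
proof -
  have n: "(norm (fst x))\<^sup>2 + (snd x)\<^sup>2 = 1" and p: "snd x > 0"
    using assms by (auto simp: upper_hemisphere_def unit_sphere_def norm_prod_def)
  have "(norm (fst x))\<^sup>2 < 1" using n p by (smt (verit) zero_less_power)
  then show "fst x \<in> ball 0 1" by (simp add: abs_square_less_1)
  have "1 - (norm (fst x))\<^sup>2 = (snd x)\<^sup>2" using n by simp
  then show "graph_chart (fst x) = x" using p by (simp add: graph_chart_def prod_eq_iff)
qed

lemma sphere_grad_chart:
  assumes y: "y \<in> ball 0 1" and U: "(U has_derivative (\<lambda>h. g \<bullet> h)) (at y)"
    and eq: "\<And>y. y \<in> ball 0 1 \<Longrightarrow> u (graph_chart y) = U y"
  shows "sphere_grad u (graph_chart y) = (g, 0) - (g \<bullet> y) *\<^sub>R graph_chart y"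
proof -
  note hemi = graph_chart_hemisphere(1)[OF y]
  then have sph: "graph_chart y \<in> unit_sphere" by (simp add: upper_hemisphere_def)
  have "((\<lambda>z. U (fst z)) has_derivative (\<lambda>h. g \<bullet> fst h)) (at (graph_chart y) within unit_sphere)"
    by (rule has_derivative_compose[of fst fst])
      (auto intro!: derivative_eq_intros U simp: graph_chart_hemisphere(2))
  then have "((\<lambda>z. U (fst z)) has_derivative (\<lambda>h. (g, 0) \<bullet> h)) (at (graph_chart y) within unit_sphere)"
    by (simp add: inner_prod_def)
  then have "(u has_derivative (\<lambda>h. (g, 0) \<bullet> h)) (at (graph_chart y) within unit_sphere)"
    by (rule has_derivative_hemisphere_transform[OF _ hemi])
      (metis eq hemisphere_graph_chart)
  from sphere_grad_eqI[OF sph this] show ?thesis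
    by (simp add: inner_prod_def graph_chart_hemisphere(2) inner_commute)
qed

section \<open>Volume in the graph chart\<close>

text \<open>
  The matrix is \<open>1 + v v\<^sup>T\<close>. Conjugation with an orthogonal matrix that maps \<open>v\<close> to a multiple of a
  basis vector makes it diagonal.
\<close>

lemma det_rank_one_update:
  fixes v :: "real ^ 'n"
  shows "det (\<chi> i j. (if i = j then 1 else 0) + v $ i * v $ j) = 1 + v \<bullet> v"
proof -
  define M :: "real ^ 'n \<Rightarrow> real ^ 'n ^ 'n" where "M = (\<lambda>v. \<chi> i j. (if i = j then 1 else 0) + v $ i * v $ j)"
  have M: "M v *v x = x + (v \<bullet> x) *\<^sub>R v" for v x
    by (simp add: vec_eq_iff M_def matrix_vector_mult_def inner_vec_def distrib_right sum.distrib
        sum_distrib_left if_distrib[of "\<lambda>z. z * _"] cong: if_cong) (simp add: sum_distrib_left ac_simps)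
  obtain k :: 'n where True by simp
  define w where "w = norm v *\<^sub>R axis k (1::real)"
  have "norm v = norm w" by (simp add: w_def)
  then obtain f where f: "orthogonal_transformation f" "f v = w"
    by (rule orthogonal_transformation_exists)
  define Q where "Q = matrix f"
  have lin: "linear f" using f by (simp add: orthogonal_transformation_def)
  have Q: "orthogonal_matrix Q" using f by (simp add: Q_def orthogonal_transformation_matrix)
  have Qx: "Q *v x = f x" for x using lin by (simp add: Q_def matrix_works)
  have QT: "Q *v (transpose Q *v x) = x" for x
    using Q by (metis matrix_vector_mul_assoc matrix_vector_mul_lid orthogonal_matrix_def)
  have "Q ** M v ** transpose Q = M w"
  proof (subst matrix_eq, intro allI)
    fix x
    have "(Q ** M v ** transpose Q) *v x = Q *v (M v *v (transpose Q *v x))"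
      by (simp only: matrix_vector_mul_assoc [symmetric])
    also have "\<dots> = x + (v \<bullet> (transpose Q *v x)) *\<^sub>R w"
      by (simp only: M matrix_vector_right_distrib QT matrix_vector_mult_scaleR Qx[of v] f(2))
    also have "v \<bullet> (transpose Q *v x) = w \<bullet> x"
      by (metis Qx dot_lmul_matrix f(2) vector_transpose_matrix inner_commute)
    finally show "(Q ** M v ** transpose Q) *v x = M w *v x" by (simp add: M)
  qed
  then have "det Q * det (M v) * det Q = det (M w)"
    by (metis det_mul det_transpose)
  moreover have "det Q * det Q = 1" using det_orthogonal_matrix[OF Q] by auto
  moreover have "det (M w) = 1 + v \<bullet> v"
  proof -
    have "det (M w) = (\<Prod>i\<in>UNIV. M w $ i $ i)"
      by (rule det_diagonal) (auto simp: M_def w_def axis_def)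
    also have "\<dots> = (\<Prod>i\<in>UNIV. if i = k then 1 + v \<bullet> v else 1)"
      by (rule prod.cong) (auto simp: M_def w_def axis_def dot_square_norm power2_eq_square)
    finally show ?thesis by simp
  qed
  ultimately have "det (M v) = 1 + v \<bullet> v" by (metis mult.assoc mult.commute mult.left_neutral)
  then show ?thesis unfolding M_def .
qed

lemma has_derivative_graph_chart:
  assumes y: "y \<in> ball 0 1"
  shows "(graph_chart has_derivative (\<lambda>h. (h, - (y \<bullet> h) / sqrt (1 - (norm y)\<^sup>2)))) (at y)"
proof -
  have p: "1 - y \<bullet> y > 0" using y by (simp add: dot_square_norm abs_square_less_1)
  have "((\<lambda>y. (y, sqrt (1 - y \<bullet> y))) has_derivative (\<lambda>h. (h, - (y \<bullet> h) / sqrt (1 - y \<bullet> y)))) (at y)"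
    using p by (auto intro!: derivative_eq_intros simp: inner_commute field_simps)
  then show ?thesis
    by (simp add: dot_square_norm graph_chart_def[abs_def])
qed

lemma det_metric_matrix:
  assumes y: "y \<in> ball 0 1"
  shows "det (metric_matrix y) = 1 / (1 - (norm y)\<^sup>2)"
proof -
  have p: "1 - (norm y)\<^sup>2 > 0" using y by (simp add: abs_square_less_1)
  let ?z = "sqrt (1 - (norm y)\<^sup>2)"
  have fd: "frechet_derivative graph_chart (at y) = (\<lambda>h. (h, - (y \<bullet> h) / ?z))"
    using frechet_derivative_at[OF has_derivative_graph_chart[OF y]] by simp
  have "metric_matrix y = (\<chi> i j. (if i = j then 1 else 0) + ((1 / ?z) *\<^sub>R y) $ i * ((1 / ?z) *\<^sub>R y) $ j)"
    by (simp add: metric_matrix_def fd vec_eq_iff inner_prod_def inner_axis) (simp add: axis_def)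
  then have "det (metric_matrix y) = 1 + ((1 / ?z) *\<^sub>R y) \<bullet> ((1 / ?z) *\<^sub>R y)"
    by (simp only: det_rank_one_update)
  also have "\<dots> = 1 / (1 - (norm y)\<^sup>2)"
    using p by (simp add: dot_square_norm divide_simps power2_eq_square[symmetric])
  finally show ?thesis .
qed

lemma continuous_on_graph_chart [continuous_intros]: "continuous_on A graph_chart"
  unfolding graph_chart_def by (intro continuous_intros)

lemma measurable_graph_chart [measurable]: "graph_chart \<in> borel_measurable borel"
  by (intro borel_measurable_continuous_onI continuous_intros)

lemma borel_upper_hemisphere: "(upper_hemisphere :: 'n::finite amb set) \<in> sets borel"
proof -
  have "(upper_hemisphere :: 'n amb set) = sphere 0 1 \<inter> {z. snd z > 0}"
    by (auto simp: upper_hemisphere_def unit_sphere_def)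
  moreover have "open {z::'n amb. snd z > 0}"
    by (intro open_Collect_less continuous_intros)
  ultimately show ?thesis by (metis borel_closed borel_open closed_sphere sets.Int)
qed

text \<open>
  The volume density of a graph of height \<open>z\<close> over the unit ball is \<open>1/z\<close>. Measurability is required
  of the function in the chart only, as its values off the hemisphere are arbitrary.
\<close>

lemma hemisphere_integral_chart:
  fixes f :: "'n::finite amb \<Rightarrow> real"
  assumes meas: "(\<lambda>y. indicator (ball 0 1) y * f (graph_chart y)) \<in> borel_measurable borel"
  shows "(LINT x:upper_hemisphere|hemisphere_vol. f x)
    = (\<integral>y. indicator (ball 0 1) y * (f (graph_chart y) / sqrt (1 - (norm y)\<^sup>2)) \<partial>lborel)"
proof -
  define F where "F = (\<lambda>y. indicator (ball 0 1) y * f (graph_chart y))"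
  define \<rho> where "\<rho> = (\<lambda>y::real^'n. indicator (ball 0 1) y * (1 / sqrt (1 - (norm y)\<^sup>2)) :: real)"
  have [measurable]: "F \<in> borel_measurable borel" using meas by (simp add: F_def)
  note [measurable] = borel_upper_hemisphere
  have fst_meas: "(fst :: 'n amb \<Rightarrow> _) \<in> borel_measurable borel"
    by (intro borel_measurable_continuous_onI continuous_intros)
  have [measurable]: "ball 0 1 \<in> sets (borel :: (real^'n) measure)" by simp
  have \<rho>: "\<rho> \<in> borel_measurable lborel" unfolding \<rho>_def by measurable
  have dens: "hemisphere_vol = distr (density lborel (\<lambda>y. ennreal (\<rho> y))) borel graph_chart"
    unfolding hemisphere_vol_def
  proof (intro arg_cong[where f = "\<lambda>M. distr M borel graph_chart"] arg_cong[where f = "density lborel"] ext)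
    fix y :: "real^'n"
    show "ennreal (indicator (ball 0 1) y * sqrt (det (metric_matrix y))) = ennreal (\<rho> y)"
      by (cases "y \<in> ball 0 1") (simp_all add: \<rho>_def det_metric_matrix real_sqrt_divide)
  qed
  have pos: "0 \<le> \<rho> y" for y
    by (auto simp: \<rho>_def indicator_def power_le_one_iff)
  have "(LINT x:upper_hemisphere|hemisphere_vol. f x)
      = (\<integral>x. indicator upper_hemisphere x *\<^sub>R F (fst x) \<partial>hemisphere_vol)"
    unfolding set_lebesgue_integral_def
  proof (intro Bochner_Integration.integral_cong refl)
    fix x :: "'n amb"
    show "indicat_real upper_hemisphere x *\<^sub>R f x = indicat_real upper_hemisphere x *\<^sub>R F (fst x)"
      using hemisphere_graph_chart[of x] by (cases "x \<in> upper_hemisphere") (simp_all add: F_def)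
  qed
  also have "\<dots> = (\<integral>y. indicator upper_hemisphere (graph_chart y) *\<^sub>R F (fst (graph_chart y))
      \<partial>density lborel (\<lambda>y. ennreal (\<rho> y)))"
    unfolding dens
  proof (rule integral_distr)
    show "(\<lambda>x. indicator upper_hemisphere x *\<^sub>R F (fst x)) \<in> borel_measurable (borel :: 'n amb measure)"
      using measurable_compose[OF fst_meas \<open>F \<in> borel_measurable borel\<close>] by measurable
  qed simp
  also have "\<dots> = (\<integral>y. \<rho> y *\<^sub>R (indicator upper_hemisphere (graph_chart y) *\<^sub>R F (fst (graph_chart y))) \<partial>lborel)"
  proof (rule integral_density[OF _ \<rho>])
    show "(\<lambda>y. indicator upper_hemisphere (graph_chart y) *\<^sub>R F (fst (graph_chart y))) \<in> borel_measurable lborel"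
      unfolding graph_chart_hemisphere(2) by measurable
  qed (simp add: pos)
  also have "\<dots> = (\<integral>y. indicator (ball 0 1) y * (f (graph_chart y) / sqrt (1 - (norm y)\<^sup>2)) \<partial>lborel)"
    using graph_chart_hemisphere(1)
    by (intro Bochner_Integration.integral_cong refl)
      (auto simp: \<rho>_def indicator_def F_def graph_chart_hemisphere(2))
  finally show ?thesis .
qed

section \<open>Integrals of derivatives with point singularities\<close>

lemma dyadic_shell:
  fixes r R :: real
  assumes "0 < r" "r < R"
  obtains k where "R / 2 ^ Suc k \<le> r" "r < R / 2 ^ k"
proof -
  have "\<exists>k. R / 2 ^ Suc k \<le> r"
  proof -
    obtain n where "R / r < 2 ^ n" using real_arch_pow[of 2 "R / r"] by auto
    then have "R / 2 ^ n \<le> r" using assms by (simp add: field_simps)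
    moreover have "R / 2 ^ Suc n \<le> R / 2 ^ n" using assms by (simp add: field_simps)
    ultimately show ?thesis by (meson order_trans)
  qed
  then obtain k where k: "R / 2 ^ Suc k \<le> r" "\<And>j. j < k \<Longrightarrow> \<not> R / 2 ^ Suc j \<le> r"
    using exists_least_iff[of "\<lambda>k. R / 2 ^ Suc k \<le> r"] by blast
  have "r < R / 2 ^ k"
  proof (cases k)
    case (Suc j)
    then show ?thesis using k(2)[of j] by simp
  qed (use assms in simp)
  with k that show ?thesis by blast
qed

text \<open>
  On the shell between the radii \<open>R / 2^(k+1)\<close> and \<open>R / 2^k\<close> the integrand is at most its value on the
  inner sphere. Its integral there is bounded by the \<open>k\<close>-th term of a geometric series with ratio
  \<open>2^(p - n)\<close>, where \<open>n\<close> is the dimension.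
\<close>

lemma integrable_norm_powr_ball:
  fixes b :: "'a::euclidean_space"
  assumes p: "0 \<le> p" "p < real DIM('a)" and R: "0 < R"
  shows "integrable lborel (\<lambda>y. indicator (ball b R) y * norm (y - b) powr (- p))"
proof (rule integrableI_bounded)
  let ?n = "DIM('a)"
  \<comment> \<open>the maximum of the integrand on the \<open>k\<close>-th shell\<close>
  define c where "c = (\<lambda>k::nat. (R / 2 ^ Suc k) powr (- p))"
  have ptw: "ennreal (norm (indicator (ball b R) y * norm (y - b) powr (- p)))
      \<le> (\<Sum>k. ennreal (c k) * indicator (ball b (R / 2 ^ k)) y)" for y
  proof (cases "y \<in> ball b R - {b}")
    case True
    then have "0 < norm (y - b)" "norm (y - b) < R"
      by (auto simp: dist_norm norm_minus_commute)
    then obtain k where k: "R / 2 ^ Suc k \<le> norm (y - b)" "norm (y - b) < R / 2 ^ k"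
      by (rule dyadic_shell)
    have "norm (y - b) powr (- p) \<le> c k"
      unfolding c_def using k(1) p R by (intro powr_mono2') auto
    then have "ennreal (norm (indicator (ball b R) y * norm (y - b) powr (- p))) \<le> ennreal (c k) * indicator (ball b (R / 2 ^ k)) y"
      using k(2) True by (simp add: dist_norm norm_minus_commute ennreal_leI)
    also have "\<dots> = (\<Sum>j\<in>{k}. ennreal (c j) * indicator (ball b (R / 2 ^ j)) y)"
      by (simp only: sum.insert_remove finite.emptyI sum.empty Diff_empty empty_Diff add_0_right)
    also have "\<dots> \<le> (\<Sum>k. ennreal (c k) * indicator (ball b (R / 2 ^ k)) y)"
      by (intro sum_le_suminf) auto
    finally show ?thesis .
  qed auto
  define A where "A = (R / 2) powr (- p) * unit_ball_vol ?n * R ^ ?n"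
  define q where "q = 2 powr (p - ?n)"
  have q: "0 < q" "q < 1" using p by (auto simp: q_def powr_less_one)
  have A: "0 \<le> A" using R by (simp add: A_def)
  have "(\<integral>\<^sup>+y. ennreal (norm (indicator (ball b R) y * norm (y - b) powr (- p))) \<partial>lborel)
      \<le> (\<integral>\<^sup>+y. (\<Sum>k. ennreal (c k) * indicator (ball b (R / 2 ^ k)) y) \<partial>lborel)"
    by (intro nn_integral_mono ptw)
  also have "\<dots> = (\<Sum>k. \<integral>\<^sup>+y. ennreal (c k) * indicator (ball b (R / 2 ^ k)) y \<partial>lborel)"
    by (intro nn_integral_suminf borel_measurable_times_ennreal borel_measurable_indicator
        borel_measurable_const) simp
  also have "\<dots> = (\<Sum>k. ennreal (A * q ^ k))"
  proof (rule suminf_cong)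
    fix k
    have "(\<integral>\<^sup>+y. ennreal (c k) * indicator (ball b (R / 2 ^ k)) y \<partial>lborel)
        = ennreal (c k) * emeasure lborel (ball b (R / 2 ^ k))"
      by (simp add: nn_integral_cmult_indicator)
    also have "\<dots> = ennreal (c k * (unit_ball_vol ?n * (R / 2 ^ k) ^ ?n))"
      using R by (subst emeasure_ball) (auto simp: ennreal_mult' c_def)
    also have "c k * (unit_ball_vol ?n * (R / 2 ^ k) ^ ?n) = A * q ^ k"
    proof -
      have "R / 2 ^ Suc k = (R / 2) * 2 powr (- real k)"
        by (simp add: powr_minus powr_realpow field_simps)
      then have "c k = (R / 2) powr (- p) * 2 powr (real k * p)"
        unfolding c_def using R by (simp only: powr_mult powr_powr) simp
      moreover have "(R / 2 ^ k) ^ ?n = R ^ ?n * 2 powr (- (real k * ?n))"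
      proof -
        have "2 powr (- (real k * ?n)) = inverse (2 ^ (k * ?n))"
          by (metis of_nat_mult powr_minus powr_realpow zero_less_numeral)
        then show ?thesis by (simp only: power_divide power_mult power_mult_distrib power_inverse divide_inverse)
      qed
      moreover have "q ^ k = 2 powr (real k * p) * 2 powr (- (real k * ?n))"
      proof -
        have "q ^ k = q powr real k" using q by (simp only: powr_realpow)
        also have "\<dots> = 2 powr (real k * p + - (real k * ?n))"
          unfolding q_def powr_powr by (simp add: algebra_simps)
        finally show ?thesis by (simp only: powr_add)
      qed
      ultimately show ?thesis by (simp add: A_def)
    qed
    finally show "(\<integral>\<^sup>+y. ennreal (c k) * indicator (ball b (R / 2 ^ k)) y \<partial>lborel) = ennreal (A * q ^ k)" .
  qed
  also have "\<dots> < \<infinity>"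
  proof -
    have "summable (\<lambda>k. A * q ^ k)" using q by (intro summable_mult summable_geometric) auto
    then show ?thesis using A q by (subst suminf_ennreal2) auto
  qed
  finally show "(\<integral>\<^sup>+y. ennreal (norm (indicator (ball b R) y * norm (y - b) powr (- p))) \<partial>lborel) < \<infinity>" .
  have "(\<lambda>y. norm (y - b) powr (- p)) \<in> borel_measurable borel"
    by (intro powr_real_measurable borel_measurable_norm borel_measurable_diff) simp_all
  then show "(\<lambda>y. indicator (ball b R) y * norm (y - b) powr (- p)) \<in> borel_measurable lborel"
    by (intro borel_measurable_times borel_measurable_indicator) simp_all
qed

lemma integral_translate_lborel:
  fixes f :: "'a::euclidean_space \<Rightarrow> real"
  assumes [measurable]: "f \<in> borel_measurable borel"
  shows "(\<integral>y. f (y + c) \<partial>lborel) = (\<integral>y. f y \<partial>lborel)"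
    "integrable lborel f \<Longrightarrow> integrable lborel (\<lambda>y. f (y + c))"
proof -
  have "(\<integral>y. f y \<partial>distr lborel borel ((+) c)) = (\<integral>y. f (c + y) \<partial>lborel)"
    by (rule integral_distr) measurable
  then show "(\<integral>y. f (y + c) \<partial>lborel) = (\<integral>y. f y \<partial>lborel)"
    by (simp add: lborel_distr_plus add.commute)
  assume "integrable lborel f"
  then have "integrable (distr lborel borel ((+) c)) f" by (simp add: lborel_distr_plus)
  then show "integrable lborel (\<lambda>y. f (y + c))"
    by (subst (asm) integrable_distr_eq) (simp_all add: add.commute)
qed

text \<open>
  The exceptional starting points lie on finitely many lines, which are null sets in dimension at
  least 2.
\<close>

lemma AE_line_avoids_finite:
  fixes e :: "'a::euclidean_space"
  assumes dim: "2 \<le> DIM('a)" and S: "finite S"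
  shows "AE y in lborel. \<forall>s. y + s *\<^sub>R e \<notin> S"
proof -
  have "negligible (span {e})"
    using dim dim_le_card'[of "{e}"] by (intro negligible_lowdim) (simp add: dim_span)
  then have "negligible (\<Union>a\<in>S. (+) a ` span {e})"
    using S by (intro negligible_Union) (auto intro: negligible_translation)
  then have "AE y in lebesgue. y \<notin> (\<Union>a\<in>S. (+) a ` span {e})"
    by (intro AE_not_in) (simp add: negligible_iff_null_sets)
  then have "AE y in lborel. y \<notin> (\<Union>a\<in>S. (+) a ` span {e})"
    by (simp only: AE_completion_iff)
  then show ?thesis
  proof eventually_elim
    case (elim y)
    show ?case
    proof (intro allI notI)
      fix s assume "y + s *\<^sub>R e \<in> S"
      moreover have "y = (y + s *\<^sub>R e) + (- s) *\<^sub>R e" by simp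
      moreover have "(- s) *\<^sub>R e \<in> span {e}" by (intro span_scale span_base) simp
      ultimately show False using elim by blast
    qed
  qed
qed

text \<open>
  A one-component divergence theorem that tolerates point singularities. Integrating \<open>D\<close> along the
  segment from \<open>y\<close> to \<open>y + e\<close> gives \<open>F (y + e) - F y\<close> for almost all \<open>y\<close>, namely for those whose line
  misses the exceptional set. The integral of this difference over \<open>y\<close> vanishes by translation
  invariance, whereas by Fubini's theorem and translation invariance again it equals the integral of
  \<open>D\<close>.
\<close>

lemma directional_derivative_integral_zero:
  fixes F D B :: "'a::euclidean_space \<Rightarrow> real" and e :: 'a
  assumes dim: "2 \<le> DIM('a)" and S: "finite S"
    and F: "integrable lborel F" and B: "integrable lborel B"
    and deriv: "\<And>x. x \<notin> S \<Longrightarrow> ((\<lambda>t. F (x + t *\<^sub>R e)) has_real_derivative D x) (at 0)"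
    and bound: "\<And>x. x \<notin> S \<Longrightarrow> \<bar>D x\<bar> \<le> B x"
  shows "integrable lborel D" "(\<integral>x. D x \<partial>lborel) = 0"
proof -
  have Fm [measurable]: "F \<in> borel_measurable borel" using F by auto
  have Sm [measurable]: "S \<in> sets borel" using S by (simp add: finite_imp_closed borel_closed)
  \<comment> \<open>a derivative is a limit of difference quotients, hence measurable\<close>
  have D [measurable]: "D \<in> borel_measurable borel"
  proof (rule measurable_discrete_difference[where X = S])
    show "(\<lambda>x. if x \<in> S then 0 else D x) \<in> borel_measurable borel"
    proof (rule borel_measurable_LIMSEQ_real)
      fix x
      show "(\<lambda>n. if x \<in> S then 0 else real (Suc n) * (F (x + inverse (real (Suc n)) *\<^sub>R e) - F x))
          \<longlonglongrightarrow> (if x \<in> S then 0 else D x)"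
      proof (cases "x \<in> S")
        case False
        have "((\<lambda>h. (F (x + h *\<^sub>R e) - F x) / h) \<longlongrightarrow> D x) (at 0)"
          using deriv[OF False] by (simp add: DERIV_def)
        moreover have "filterlim (\<lambda>n. inverse (real (Suc n))) (at 0) sequentially"
          unfolding filterlim_at using LIMSEQ_inverse_real_of_nat by auto
        ultimately have "(\<lambda>n. (F (x + inverse (real (Suc n)) *\<^sub>R e) - F x) / inverse (real (Suc n))) \<longlonglongrightarrow> D x"
          by (rule filterlim_compose)
        then show ?thesis using False by (simp add: divide_inverse mult.commute)
      qed simp
    qed measurable
  qed (use S in \<open>auto intro: countable_finite\<close>)
  show Di: "integrable lborel D"
  proof (rule Bochner_Integration.integrable_bound[OF B])
    have "AE x in lborel. x \<notin> S"
      using S by (intro AE_not_in finite_imp_null_set_lborel)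
    then show "AE x in lborel. norm (D x) \<le> norm (B x)"
      by eventually_elim (use bound in force)
  qed simp
  define G where "G = (\<lambda>s y. indicator {0..1::real} s * D (y + s *\<^sub>R e))"
  have G [measurable]: "case_prod G \<in> borel_measurable (lborel \<Otimes>\<^sub>M lborel)"
    unfolding G_def by measurable
  have Gi: "integrable (lborel \<Otimes>\<^sub>M lborel) (case_prod G)"
  proof (rule lborel_pair.Fubini_integrable[OF G])
    have "(\<lambda>s. \<integral>y. norm (case_prod G (s, y)) \<partial>lborel) = (\<lambda>s. indicator {0..1} s * (\<integral>y. \<bar>D y\<bar> \<partial>lborel))"
    proof
      fix s :: real
      have "(\<integral>y. norm (case_prod G (s, y)) \<partial>lborel) = indicator {0..1} s * (\<integral>y. \<bar>D (y + s *\<^sub>R e)\<bar> \<partial>lborel)"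
        by (simp add: G_def abs_mult)
      also have "(\<integral>y. \<bar>D (y + s *\<^sub>R e)\<bar> \<partial>lborel) = (\<integral>y. \<bar>D y\<bar> \<partial>lborel)"
        by (rule integral_translate_lborel(1)[of "\<lambda>y. \<bar>D y\<bar>"]) measurable
      finally show "(\<integral>y. norm (case_prod G (s, y)) \<partial>lborel) = indicator {0..1} s * (\<integral>y. \<bar>D y\<bar> \<partial>lborel)" .
    qed
    then show "integrable lborel (\<lambda>s. \<integral>y. norm (case_prod G (s, y)) \<partial>lborel)"
      by simp
    show "AE s in lborel. integrable lborel (\<lambda>y. case_prod G (s, y))"
      using integral_translate_lborel(2)[OF D Di] by (simp add: G_def)
  qed
  have "(\<integral>y. (\<integral>s. G s y \<partial>lborel) \<partial>lborel) = (\<integral>s. (\<integral>y. G s y \<partial>lborel) \<partial>lborel)"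
    by (rule lborel_pair.Fubini_integral[OF Gi])
  also have "(\<lambda>s. \<integral>y. G s y \<partial>lborel) = (\<lambda>s. indicator {0..1} s * (\<integral>y. D y \<partial>lborel))"
    unfolding G_def by (simp add: integral_translate_lborel(1)[OF D])
  also have "(\<integral>s. indicator {0..1::real} s * (\<integral>y. D y \<partial>lborel) \<partial>lborel) = (\<integral>y. D y \<partial>lborel)"
    by simp
  also have "(\<integral>y. (\<integral>s. G s y \<partial>lborel) \<partial>lborel) = (\<integral>y. F (y + e) - F y \<partial>lborel)"
  proof (rule integral_cong_AE)
    show "(\<lambda>y. \<integral>s. G s y \<partial>lborel) \<in> borel_measurable lborel"
      using lborel_pair.integrable_snd[OF Gi] by auto
    show "AE y in lborel. (\<integral>s. G s y \<partial>lborel) = F (y + e) - F y"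
      using AE_line_avoids_finite[OF dim S, of e] lborel_pair.AE_integrable_snd[OF Gi]
    proof eventually_elim
      case (elim y)
      have "((\<lambda>s. D (y + s *\<^sub>R e)) has_integral F (y + 1 *\<^sub>R e) - F (y + 0 *\<^sub>R e)) {0..1}"
      proof (rule fundamental_theorem_of_calculus)
        fix s :: real
        have "((\<lambda>t. F (y + s *\<^sub>R e + t *\<^sub>R e)) has_real_derivative D (y + s *\<^sub>R e)) (at 0)"
          using elim(1) by (intro deriv) simp
        then have "((\<lambda>t. F (y + (t + s) *\<^sub>R e)) has_real_derivative D (y + s *\<^sub>R e)) (at 0)"
          by (simp add: scaleR_add_left ac_simps)
        then have "((\<lambda>t. F (y + t *\<^sub>R e)) has_real_derivative D (y + s *\<^sub>R e)) (at (0 + s))"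
          by (subst DERIV_shift)
        then have "((\<lambda>t. F (y + t *\<^sub>R e)) has_real_derivative D (y + s *\<^sub>R e)) (at s)"
          by simp
        then show "((\<lambda>t. F (y + t *\<^sub>R e)) has_vector_derivative D (y + s *\<^sub>R e)) (at s within {0..1})"
          by (simp add: has_real_derivative_iff_has_vector_derivative has_vector_derivative_at_within)
      qed simp
      then have "((\<lambda>s. if s \<in> {0..1} then D (y + s *\<^sub>R e) else 0) has_integral F (y + e) - F y) UNIV"
        by (simp only: has_integral_restrict_UNIV) simp
      moreover have "(\<lambda>s. if s \<in> {0..1} then D (y + s *\<^sub>R e) else 0) = (\<lambda>s. G s y)"
        by (auto simp: G_def indicator_def)
      ultimately have "((\<lambda>s. G s y) has_integral F (y + e) - F y) UNIV" by simp
      then show ?case by (rule has_integral_unique[OF has_integral_integral_lborel[OF elim(2)]])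
    qed
  qed simp
  also have "\<dots> = 0"
    using integral_translate_lborel[OF Fm, of e] F
    by (subst Bochner_Integration.integral_diff) auto
  finally show "(\<integral>x. D x \<partial>lborel) = 0" by simp
qed

section \<open>Real powers and Young's inequality\<close>

lemma Young_powr:
  fixes a b :: real
  assumes "0 \<le> a" "0 \<le> b" "1 < p"
  shows "p * (a * b powr (p - 1)) \<le> a powr p + (p - 1) * b powr p"
proof -
  have "a * b powr (p - 1) \<le> a powr p / p + (b powr (p - 1)) powr (p / (p - 1)) / (p / (p - 1))"
  proof (rule Youngs_inequality)
    show "1 / p + 1 / (p / (p - 1)) = 1" using assms by (simp add: divide_simps)
  qed (use assms in auto)
  also have "(b powr (p - 1)) powr (p / (p - 1)) = b powr p"
    using assms by (simp add: powr_powr)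
  finally have "p * (a * b powr (p - 1)) \<le> p * (a powr p / p + b powr p / (p / (p - 1)))"
    using assms by (intro mult_left_mono) auto
  also have "\<dots> = a powr p + (p - 1) * b powr p" using assms by (simp add: field_simps)
  finally show ?thesis .
qed

text \<open>
  At the origin the difference quotient is bounded by \<open>|h|^(p-1)\<close>, which tends to zero as \<open>p > 1\<close>.
\<close>

lemma has_real_derivative_abs_powr:
  fixes x :: real
  assumes p: "1 < p"
  shows "((\<lambda>x. \<bar>x\<bar> powr p) has_real_derivative p * \<bar>x\<bar> powr (p - 1) * sgn x) (at x)"
proof (cases "x = 0")
  case True
  have lim: "((\<lambda>h. \<bar>h\<bar> powr (p - 1)) \<longlongrightarrow> 0) (at (0::real))"
    using p by (intro tendsto_zero_powrI) (auto intro!: tendsto_eq_intros)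
  have "norm ((\<bar>0 + h\<bar> powr p - \<bar>0\<bar> powr p) / h) \<le> \<bar>h\<bar> powr (p - 1)" for h :: real
    by (cases "h = 0") (simp_all add: powr_diff)
  then have "\<forall>\<^sub>F h in at 0. norm ((\<bar>0 + h\<bar> powr p - \<bar>0\<bar> powr p) / h) \<le> \<bar>h::real\<bar> powr (p - 1)"
    by (intro always_eventually allI)
  from Lim_null_comparison[OF this lim]
  have "((\<lambda>h. (\<bar>0 + h\<bar> powr p - \<bar>0::real\<bar> powr p) / h) \<longlongrightarrow> 0) (at 0)" .
  then show ?thesis unfolding True DERIV_def by simp
next
  case False
  show ?thesis
  proof (cases "x > 0")
    case True
    have "((\<lambda>x. x powr p) has_real_derivative p * \<bar>x\<bar> powr (p - 1) * sgn x) (at x)"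
      using has_real_derivative_powr[OF True, of p] True by simp
    then show ?thesis
      by (rule has_field_derivative_transform_within_open[where S = "{0<..}"]) (use True in auto)
  next
    case neg: False
    with False have "x < 0" by simp
    then have "((\<lambda>x. (- x) powr p) has_real_derivative p * \<bar>x\<bar> powr (p - 1) * sgn x) (at x)"
      using DERIV_fun_powr[of uminus "- 1" x p] DERIV_minus[OF DERIV_ident, of x] by simp
    then show ?thesis
      by (rule has_field_derivative_transform_within_open[where S = "{..<0}"]) (use \<open>x < 0\<close> in auto)
  qed
qed

lemma powr_split_two:
  fixes x p :: real
  shows "0 < x \<Longrightarrow> x powr (p - 4) * x\<^sup>2 = x powr (p - 2)"
  using powr_add[of x "p - 4" 2] by (simp add: powr_numeral)

section \<open>The gradient of the logarithm of the distance\<close>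

text \<open>
  The gradient of \<open>d = arccos (x \<bullet> a)\<close> on the unit sphere is \<open>- (a - (x \<bullet> a) x) / sin d\<close>. With
  \<open>s = x \<bullet> a\<close>, the coefficient below therefore turns the tangential part of \<open>a\<close> into \<open>\<nabla>d / d\<close>,
  the gradient of \<open>log d\<close>; this field is \<open>log_grad\<close>, and \<open>log_grad'\<close> is its derivative in the
  ambient space.
\<close>

definition log_coeff :: "real \<Rightarrow> real" where
  "log_coeff s = - 1 / (arccos s * sqrt (1 - s\<^sup>2))"

definition log_coeff' :: "real \<Rightarrow> real" where
  "log_coeff' s = - (1 + arccos s * cot (arccos s)) / (arccos s * sqrt (1 - s\<^sup>2))\<^sup>2"

definition log_grad :: "'a::real_inner \<Rightarrow> 'a \<Rightarrow> 'a" where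
  "log_grad a x = log_coeff (x \<bullet> a) *\<^sub>R (a - (x \<bullet> a) *\<^sub>R x)"

definition log_grad' :: "'a::real_inner \<Rightarrow> 'a \<Rightarrow> 'a \<Rightarrow> 'a" where
  "log_grad' a x h = (log_coeff' (x \<bullet> a) * (h \<bullet> a)) *\<^sub>R (a - (x \<bullet> a) *\<^sub>R x)
    - log_coeff (x \<bullet> a) *\<^sub>R ((h \<bullet> a) *\<^sub>R x + (x \<bullet> a) *\<^sub>R h)"

lemma arccos_facts:
  fixes s :: real
  assumes s: "- 1 < s" "s < 1"
  shows "0 < arccos s" "arccos s < pi" "0 < sqrt (1 - s\<^sup>2)" "(sqrt (1 - s\<^sup>2))\<^sup>2 = 1 - s\<^sup>2"
    "sin (arccos s) = sqrt (1 - s\<^sup>2)" "cos (arccos s) = s" "cot (arccos s) = s / sqrt (1 - s\<^sup>2)"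
proof -
  have "s\<^sup>2 < 1" using s by (simp add: abs_square_less_1)
  then show "0 < sqrt (1 - s\<^sup>2)" "(sqrt (1 - s\<^sup>2))\<^sup>2 = 1 - s\<^sup>2" by simp_all
  show "0 < arccos s" "arccos s < pi" using arccos_lt_bounded[OF s] by auto
  show "sin (arccos s) = sqrt (1 - s\<^sup>2)" "cos (arccos s) = s" using s by (simp_all add: sin_arccos)
  then show "cot (arccos s) = s / sqrt (1 - s\<^sup>2)" by (simp add: cot_def)
qed

text \<open>
  All combinations of the coefficient and its derivative that occur later depend on \<open>d\<close> and
  \<open>d cot d\<close> alone. In this form the curvature enters only through \<open>d cot d\<close>.
\<close>

lemma log_coeff_facts:
  fixes s :: real
  assumes s: "- 1 < s" "s < 1"
  defines "d \<equiv> arccos s"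
  shows "log_coeff s * sqrt (1 - s\<^sup>2) = - 1 / d"
    "log_coeff s * s = - (d * cot d) / d\<^sup>2"
    "log_coeff' s * (1 - s\<^sup>2) = - (1 + d * cot d) / d\<^sup>2"
    "(log_coeff has_real_derivative log_coeff' s) (at s)"
proof -
  note f = arccos_facts[OF s]
  show "log_coeff s * sqrt (1 - s\<^sup>2) = - 1 / d" using f by (simp add: log_coeff_def d_def)
  show "log_coeff s * s = - (d * cot d) / d\<^sup>2"
    unfolding d_def f(7) using f(1,3) by (simp add: log_coeff_def power2_eq_square)
  have "- K / (d * S)\<^sup>2 * S\<^sup>2 = - K / d\<^sup>2" if "S > 0" for K S :: real
    using that by (simp add: power_mult_distrib)
  from this[OF f(3)] have "log_coeff' s * (sqrt (1 - s\<^sup>2))\<^sup>2 = - (1 + d * cot d) / d\<^sup>2"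
    by (simp only: log_coeff'_def d_def)
  then show "log_coeff' s * (1 - s\<^sup>2) = - (1 + d * cot d) / d\<^sup>2" by (simp only: f(4))
  have sq: "((\<lambda>s. sqrt (1 - s\<^sup>2)) has_real_derivative - s / sqrt (1 - s\<^sup>2)) (at s)"
    using f(3) by (auto intro!: derivative_eq_intros simp: field_simps)
  have "((\<lambda>s. arccos s * sqrt (1 - s\<^sup>2)) has_real_derivative
      inverse (- sqrt (1 - s\<^sup>2)) * sqrt (1 - s\<^sup>2) + (- s / sqrt (1 - s\<^sup>2)) * arccos s) (at s)"
    by (rule DERIV_mult[OF DERIV_arccos[OF s] sq])
  also have "inverse (- sqrt (1 - s\<^sup>2)) * sqrt (1 - s\<^sup>2) + (- s / sqrt (1 - s\<^sup>2)) * arccos s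
      = - (1 + d * cot d)"
    using f(3) by (simp add: d_def f(7))
  finally have D: "((\<lambda>s. arccos s * sqrt (1 - s\<^sup>2)) has_real_derivative - (1 + d * cot d)) (at s)" .
  have nz: "arccos s * sqrt (1 - s\<^sup>2) \<noteq> 0" using f(1,3) by simp
  have "((\<lambda>s. - inverse (arccos s * sqrt (1 - s\<^sup>2))) has_real_derivative
      - (- (- (1 + d * cot d) * inverse ((arccos s * sqrt (1 - s\<^sup>2)) ^ Suc (Suc 0))))) (at s)"
    by (intro DERIV_minus DERIV_inverse_fun D nz)
  then show "(log_coeff has_real_derivative log_coeff' s) (at s)"
    by (simp add: log_coeff_def[abs_def] log_coeff'_def d_def divide_inverse numeral_2_eq_2)
qed

lemma has_derivative_log_grad:
  fixes x a :: "'a::real_inner"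
  assumes s: "- 1 < x \<bullet> a" "x \<bullet> a < 1"
  shows "(log_grad a has_derivative log_grad' a x) (at x)"
proof -
  have 1: "((\<lambda>x. log_coeff (x \<bullet> a)) has_derivative (\<lambda>h. (h \<bullet> a) * log_coeff' (x \<bullet> a))) (at x)"
    by (rule DERIV_compose_FDERIV[where f = log_coeff and g = "\<lambda>x. x \<bullet> a", OF log_coeff_facts(4)[OF s]])
      (auto intro!: derivative_eq_intros)
  have 2: "((\<lambda>x. a - (x \<bullet> a) *\<^sub>R x) has_derivative (\<lambda>h. - ((h \<bullet> a) *\<^sub>R x + (x \<bullet> a) *\<^sub>R h))) (at x)"
    by (auto intro!: derivative_eq_intros)
  have "((\<lambda>x. log_coeff (x \<bullet> a) *\<^sub>R (a - (x \<bullet> a) *\<^sub>R x)) has_derivative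
     (\<lambda>h. log_coeff (x \<bullet> a) *\<^sub>R (- ((h \<bullet> a) *\<^sub>R x + (x \<bullet> a) *\<^sub>R h))
       + ((h \<bullet> a) * log_coeff' (x \<bullet> a)) *\<^sub>R (a - (x \<bullet> a) *\<^sub>R x))) (at x)"
    by (rule has_derivative_scaleR[OF 1 2])
  then show ?thesis
    by (simp add: log_grad_def[abs_def] log_grad'_def[abs_def] algebra_simps)
qed

lemma log_grad_tangent:
  assumes "norm x = 1"
  shows "x \<bullet> log_grad a x = 0"
  using assms by (simp add: log_grad_def inner_diff_right norm_eq_1)

lemma norm_log_grad:
  fixes x a :: "'a::real_inner"
  assumes n: "norm x = 1" "norm a = 1" and s: "- 1 < x \<bullet> a" "x \<bullet> a < 1"
  shows "norm (log_grad a x) = 1 / arccos (x \<bullet> a)"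
proof -
  have "norm (log_grad a x) = \<bar>log_coeff (x \<bullet> a) * sqrt (1 - (x \<bullet> a)\<^sup>2)\<bar>"
    using arccos_facts(3)[OF s] by (simp add: log_grad_def norm_tangent_component[OF n] abs_mult)
  also have "\<dots> = 1 / arccos (x \<bullet> a)"
    unfolding log_coeff_facts(1)[OF s] using arccos_facts(1)[OF s] by simp
  finally show ?thesis .
qed

text \<open>
  The Hessian of \<open>log d\<close> on a tangent vector \<open>v\<close>, where \<open>d \<nabla>(log d)\<close> is the unit vector \<open>\<nabla>d\<close>. It is
  \<open>cot d / d\<close> orthogonally to \<open>\<nabla>d\<close> and \<open>- 1 / d\<^sup>2\<close> in the direction of \<open>\<nabla>d\<close>.
\<close>

lemma log_grad'_quadratic_form:
  fixes x a v :: "'a::real_inner"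
  assumes n: "norm x = 1" and s: "- 1 < x \<bullet> a" "x \<bullet> a < 1" and v: "x \<bullet> v = 0"
  defines "d \<equiv> arccos (x \<bullet> a)"
  shows "v \<bullet> log_grad' a x v
    = d * cot d / d\<^sup>2 * (v \<bullet> v) - (1 + d * cot d) / d\<^sup>2 * (v \<bullet> (d *\<^sub>R log_grad a x))\<^sup>2"
proof -
  let ?s = "x \<bullet> a"
  let ?S = "sqrt (1 - ?s\<^sup>2)"
  note f = arccos_facts[OF s] and g = log_coeff_facts[OF s, folded d_def]
  have vx: "v \<bullet> x = 0" using v by (simp add: inner_commute)
  have d: "d > 0" using f(1) by (simp add: d_def)
  have "v \<bullet> (d *\<^sub>R log_grad a x) = d * log_coeff ?s * (v \<bullet> a)"
    by (simp add: log_grad_def inner_diff_right vx)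
  then have "?S * (v \<bullet> (d *\<^sub>R log_grad a x)) = d * (log_coeff ?s * ?S) * (v \<bullet> a)" by simp
  also have "\<dots> = - (v \<bullet> a)" unfolding g(1) using d by simp
  finally have "(v \<bullet> a)\<^sup>2 = (?S * (v \<bullet> (d *\<^sub>R log_grad a x)))\<^sup>2" by simp
  also have "\<dots> = (1 - ?s\<^sup>2) * (v \<bullet> (d *\<^sub>R log_grad a x))\<^sup>2"
    by (simp only: power_mult_distrib f(4))
  finally have va: "(v \<bullet> a)\<^sup>2 = (1 - ?s\<^sup>2) * (v \<bullet> (d *\<^sub>R log_grad a x))\<^sup>2" .
  have "v \<bullet> log_grad' a x v = log_coeff' ?s * (v \<bullet> a)\<^sup>2 - log_coeff ?s * ?s * (v \<bullet> v)"
    by (simp add: log_grad'_def inner_diff_right inner_add_right vx power2_eq_square algebra_simps)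
  also have "\<dots> = log_coeff' ?s * (1 - ?s\<^sup>2) * (v \<bullet> (d *\<^sub>R log_grad a x))\<^sup>2 - log_coeff ?s * ?s * (v \<bullet> v)"
    by (simp only: va mult.assoc)
  also have "\<dots> = - (1 + d * cot d) / d\<^sup>2 * (v \<bullet> (d *\<^sub>R log_grad a x))\<^sup>2 - (- (d * cot d) / d\<^sup>2) * (v \<bullet> v)"
    by (simp only: g(2,3))
  also have "- A / D * B - (- P / D) * E = P / D * E - A / D * B" for A B D E P :: real by simp
  finally show ?thesis .
qed

text \<open>
  This is a bound for the ambient derivative, which has a normal part besides the Hessian. The tangent
  vector \<open>h\<close> satisfies \<open>|h \<bullet> a| \<le> |h| sin d\<close>, and the factor \<open>sin d\<close> makes up for the
  singularities of the coefficients.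
\<close>

lemma norm_log_grad'_le:
  fixes x a h :: "'a::real_inner"
  assumes n: "norm x = 1" "norm a = 1" and s: "- 1 < x \<bullet> a" "x \<bullet> a < 1" and h: "x \<bullet> h = 0"
    and q: "\<bar>arccos (x \<bullet> a) * cot (arccos (x \<bullet> a))\<bar> \<le> C"
  shows "norm (log_grad' a x h) \<le> (1 + 2 * C + pi) / (arccos (x \<bullet> a))\<^sup>2 * norm h"
proof -
  define d where "d = arccos (x \<bullet> a)"
  let ?s = "x \<bullet> a"
  let ?S = "sqrt (1 - ?s\<^sup>2)"
  note f = arccos_facts[OF s, folded d_def] and g = log_coeff_facts[OF s, folded d_def]
  have ha: "\<bar>h \<bullet> a\<bar> \<le> norm h * ?S" by (rule tangent_inner_bound[OF n h])
  have q': "\<bar>d * cot d\<bar> \<le> C" using q by (simp add: d_def)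
  have "norm ((log_coeff' ?s * (h \<bullet> a)) *\<^sub>R (a - ?s *\<^sub>R x)) = \<bar>log_coeff' ?s\<bar> * \<bar>h \<bullet> a\<bar> * ?S"
    by (simp add: norm_tangent_component[OF n] abs_mult)
  also have "\<dots> \<le> \<bar>log_coeff' ?s\<bar> * (norm h * ?S) * ?S"
    using f(3) ha by (intro mult_right_mono mult_left_mono) auto
  also have "\<dots> = \<bar>log_coeff' ?s * ?S\<^sup>2\<bar> * norm h" by (simp add: abs_mult power2_eq_square)
  also have "\<dots> = \<bar>1 + d * cot d\<bar> / d\<^sup>2 * norm h" unfolding f(4) g(3)
    by (simp only: minus_divide_left [symmetric] abs_minus_cancel abs_divide abs_power2)
  also have "\<dots> \<le> (1 + C) / d\<^sup>2 * norm h"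
    using q' by (intro mult_right_mono divide_right_mono) auto
  finally have 1: "norm ((log_coeff' ?s * (h \<bullet> a)) *\<^sub>R (a - ?s *\<^sub>R x)) \<le> (1 + C) / d\<^sup>2 * norm h" .
  have "norm (log_coeff ?s *\<^sub>R ((h \<bullet> a) *\<^sub>R x + ?s *\<^sub>R h)) \<le> \<bar>log_coeff ?s\<bar> * (\<bar>h \<bullet> a\<bar> + \<bar>?s\<bar> * norm h)"
    using norm_triangle_ineq[of "(h \<bullet> a) *\<^sub>R x" "?s *\<^sub>R h"] n by (simp add: mult_left_mono)
  also have "\<dots> \<le> \<bar>log_coeff ?s\<bar> * (norm h * ?S + \<bar>?s\<bar> * norm h)"
    using ha by (intro mult_left_mono add_right_mono) auto
  also have "\<dots> = (\<bar>log_coeff ?s * ?S\<bar> + \<bar>log_coeff ?s * ?s\<bar>) * norm h"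
    using f(3) by (simp add: abs_mult algebra_simps)
  also have "\<dots> = (1 / d + \<bar>d * cot d\<bar> / d\<^sup>2) * norm h"
    unfolding g(1,2) using f(1) by (simp add: abs_divide abs_mult)
  also have "\<dots> \<le> (pi / d\<^sup>2 + C / d\<^sup>2) * norm h"
  proof (intro mult_right_mono add_mono)
    show "1 / d \<le> pi / d\<^sup>2" using f(1,2) by (simp add: power2_eq_square divide_simps)
    show "\<bar>d * cot d\<bar> / d\<^sup>2 \<le> C / d\<^sup>2" using q' by (intro divide_right_mono) auto
  qed auto
  finally have 2: "norm (log_coeff ?s *\<^sub>R ((h \<bullet> a) *\<^sub>R x + ?s *\<^sub>R h)) \<le> (pi / d\<^sup>2 + C / d\<^sup>2) * norm h" .
  have "norm (log_grad' a x h) \<le> (1 + C) / d\<^sup>2 * norm h + (pi / d\<^sup>2 + C / d\<^sup>2) * norm h"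
    unfolding log_grad'_def using norm_triangle_ineq4 1 2 by (meson add_mono order_trans)
  also have "\<dots> = (1 + 2 * C + pi) / d\<^sup>2 * norm h" by (simp add: add_divide_distrib distrib_right)
  finally show ?thesis by (simp add: d_def)
qed

text \<open>
  The chord has length \<open>2 sin (d / 2)\<close>.
\<close>

lemma chord_le_arccos:
  fixes x a :: "'a::real_inner"
  assumes n: "norm x = 1" "norm a = 1"
  shows "norm (x - a) \<le> arccos (x \<bullet> a)"
proof -
  have s: "- 1 \<le> x \<bullet> a" "x \<bullet> a \<le> 1" using Cauchy_Schwarz_ineq2[of x a] n by auto
  define d where "d = arccos (x \<bullet> a)"
  have d: "0 \<le> d" "cos d = x \<bullet> a" using s by (simp_all add: d_def arccos_lbound)
  have xx: "x \<bullet> x = 1" "a \<bullet> a = 1" using n by (simp_all add: norm_eq_1)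
  have "(norm (x - a))\<^sup>2 = 2 - 2 * cos d"
    using xx by (simp add: power2_norm_eq_inner inner_diff_left inner_diff_right inner_commute[of a x] d(2))
  also have "\<dots> = (2 * sin (d / 2))\<^sup>2"
    using cos_double_sin[of "d / 2"] by (simp add: power_mult_distrib)
  also have "\<dots> \<le> d\<^sup>2"
  proof (rule abs_le_square_iff[THEN iffD1])
    show "\<bar>2 * sin (d / 2)\<bar> \<le> \<bar>d\<bar>"
      using abs_sin_x_le_abs_x[of "d / 2"] d(1) by (simp add: abs_mult)
  qed
  finally show ?thesis unfolding d_def[symmetric] by (rule power2_le_imp_le) (rule d(1))
qed

text \<open>
  The derivative of the graph chart at \<open>y\<close>.
\<close>

definition chart_push :: "real ^ 'n \<Rightarrow> real ^ 'n \<Rightarrow> 'n::finite amb" where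
  "chart_push y h = (h, - (y \<bullet> h) / sqrt (1 - (norm y)\<^sup>2))"

lemma ball_height:
  fixes y :: "'a::real_normed_vector"
  assumes "y \<in> ball 0 1"
  shows "0 < sqrt (1 - (norm y)\<^sup>2)" "sqrt (1 - (norm y)\<^sup>2) \<le> 1" "(sqrt (1 - (norm y)\<^sup>2))\<^sup>2 = 1 - (norm y)\<^sup>2"
proof -
  have "(norm y)\<^sup>2 < 1" using assms by (simp add: abs_square_less_1)
  then show "0 < sqrt (1 - (norm y)\<^sup>2)" "sqrt (1 - (norm y)\<^sup>2) \<le> 1" "(sqrt (1 - (norm y)\<^sup>2))\<^sup>2 = 1 - (norm y)\<^sup>2"
    by simp_all
qed

lemma chart_push_tangent:
  assumes y: "y \<in> ball 0 1"
  shows "graph_chart y \<bullet> chart_push y h = 0"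
  using ball_height[OF y] by (simp add: graph_chart_def chart_push_def inner_prod_def)

lemma chart_push_fst:
  assumes y: "y \<in> ball 0 1" and v: "graph_chart y \<bullet> v = 0"
  shows "chart_push y (fst v) = v"
proof -
  have "y \<bullet> fst v + sqrt (1 - (norm y)\<^sup>2) * snd v = 0"
    using v by (simp add: graph_chart_def inner_prod_def)
  then have "- (y \<bullet> fst v) = sqrt (1 - (norm y)\<^sup>2) * snd v" by simp
  then show ?thesis using ball_height(1)[OF y] by (simp add: chart_push_def prod_eq_iff)
qed

lemma norm_chart_push_le:
  assumes y: "y \<in> ball 0 1"
  shows "norm (chart_push y h) \<le> 2 / sqrt (1 - (norm y)\<^sup>2) * norm h"
proof -
  let ?z = "sqrt (1 - (norm y)\<^sup>2)"
  note z = ball_height[OF y]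
  have "norm (chart_push y h) \<le> norm h + \<bar>y \<bullet> h\<bar> / ?z"
    using norm_Pair_le[of h "- (y \<bullet> h) / ?z"] z(1) by (simp add: chart_push_def abs_divide)
  also have "\<bar>y \<bullet> h\<bar> \<le> norm y * norm h" by (rule Cauchy_Schwarz_ineq2)
  also have "\<dots> \<le> 1 * norm h" using y by (intro mult_right_mono) auto
  finally have "norm (chart_push y h) \<le> norm h + norm h / ?z" using z(1) by (simp add: divide_right_mono)
  moreover have "norm h \<le> norm h / ?z" using z(1,2) by (simp add: pos_le_divide_eq mult_left_le)
  ultimately have "norm (chart_push y h) \<le> norm h / ?z + norm h / ?z" by linarith
  then show ?thesis by simp
qed

text \<open>
  The Riemannian divergence of \<open>\<nabla>d / d\<close>, that is \<open>\<Delta>d / d - 1 / d\<^sup>2\<close> with \<open>\<Delta>d = (n - 1) cot d\<close>. The second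
  summand on the left stems from the volume density \<open>1/z\<close> of the chart, whose logarithmic derivative
  is \<open>y / z\<^sup>2\<close>.
\<close>

lemma log_grad'_chart_trace:
  fixes y :: "real ^ 'n" and a :: "'n::finite amb"
  assumes y: "y \<in> ball 0 1" and a: "norm a = 1"
    and s: "- 1 < graph_chart y \<bullet> a" "graph_chart y \<bullet> a < 1"
  defines "x \<equiv> graph_chart y" and "d \<equiv> arccos (graph_chart y \<bullet> a)"
  shows "(\<Sum>i\<in>UNIV. fst (log_grad' a x (chart_push y (axis i 1))) $ i)
      + (y \<bullet> fst (log_grad a x)) / (1 - (norm y)\<^sup>2)
    = ((real CARD('n) - 1) * (d * cot d) - 1) / d\<^sup>2"
proof -
  let ?s = "x \<bullet> a"
  define z where "z = sqrt (1 - (norm y)\<^sup>2)"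
  define b where "b = fst a"
  define t where "t = snd a"
  have z: "z > 0" "z\<^sup>2 = 1 - (norm y)\<^sup>2" using ball_height[OF y] by (simp_all add: z_def)
  have xd: "x = (y, z)" by (simp add: x_def graph_chart_def z_def)
  have ad: "a = (b, t)" by (simp add: b_def t_def)
  have yy: "y \<bullet> y = 1 - z\<^sup>2" by (simp add: z(2) dot_square_norm)
  have bb: "b \<bullet> b = 1 - t\<^sup>2" using a by (simp add: ad norm_eq_1 inner_prod_def power2_eq_square)
  have by': "b \<bullet> y = ?s - z * t" by (simp add: xd ad inner_prod_def inner_commute)
  let ?c1 = "log_coeff' ?s" and ?c0 = "log_coeff ?s"
  have "(\<Sum>i\<in>UNIV. fst (log_grad' a x (chart_push y (axis i 1))) $ i)
      = (\<Sum>i\<in>UNIV. ?c1 * (b $ i * b $ i) + (- ?c1 * ?s - ?c1 * t / z - ?c0) * (b $ i * y $ i)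
          + (?c1 * ?s * t / z + ?c0 * t / z) * (y $ i * y $ i) + (- ?c0 * ?s))"
  proof (rule sum.cong)
    fix i :: 'n
    have "chart_push y (axis i 1) = (axis i 1, - y $ i / z)"
      by (simp add: chart_push_def z_def inner_axis)
    then have "fst (log_grad' a x (chart_push y (axis i 1))) $ i
       = ?c1 * (b $ i - y $ i / z * t) * (b $ i - ?s * y $ i) - ?c0 * ((b $ i - y $ i / z * t) * y $ i + ?s)"
      by (simp add: log_grad'_def ad xd inner_prod_def inner_axis')
    then show "fst (log_grad' a x (chart_push y (axis i 1))) $ i
       = ?c1 * (b $ i * b $ i) + (- ?c1 * ?s - ?c1 * t / z - ?c0) * (b $ i * y $ i)
          + (?c1 * ?s * t / z + ?c0 * t / z) * (y $ i * y $ i) + (- ?c0 * ?s)"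
      using z(1) by (simp add: field_simps)
  qed simp
  also have "\<dots> = ?c1 * (b \<bullet> b) + (- ?c1 * ?s - ?c1 * t / z - ?c0) * (b \<bullet> y)
          + (?c1 * ?s * t / z + ?c0 * t / z) * (y \<bullet> y) + (- ?c0 * ?s) * real CARD('n)"
    by (simp only: sum.distrib sum_distrib_left[symmetric] inner_vec_def inner_real_def) simp
  also have "\<dots> = ?c1 * (1 - ?s\<^sup>2) - ?c0 * (?s - t / z) - real CARD('n) * (?c0 * ?s)"
    unfolding bb yy by' using z(1) by (simp add: field_simps power2_eq_square)
  finally have 1: "(\<Sum>i\<in>UNIV. fst (log_grad' a x (chart_push y (axis i 1))) $ i)
      = ?c1 * (1 - ?s\<^sup>2) - ?c0 * (?s - t / z) - real CARD('n) * (?c0 * ?s)" .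
  have "y \<bullet> fst (log_grad a x) = ?c0 * (b \<bullet> y - ?s * (y \<bullet> y))"
    by (simp add: log_grad_def inner_diff_right inner_commute[of y b] xd ad)
  also have "\<dots> = ?c0 * (?s - t / z) * z\<^sup>2"
    unfolding yy by' using z(1) by (simp add: field_simps power2_eq_square)
  finally have 2: "(y \<bullet> fst (log_grad a x)) / (1 - (norm y)\<^sup>2) = ?c0 * (?s - t / z)"
    unfolding z(2)[symmetric] using z(1) by simp
  have "?c1 * (1 - ?s\<^sup>2) - real CARD('n) * (?c0 * ?s) = - (1 + d * cot d) / d\<^sup>2 - real CARD('n) * (- (d * cot d) / d\<^sup>2)"
    unfolding d_def x_def log_coeff_facts(2,3)[OF s] ..
  also have "\<dots> = ((real CARD('n) - 1) * (d * cot d) - 1) / d\<^sup>2"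
    by (simp add: diff_divide_distrib[symmetric] add_divide_distrib[symmetric] algebra_simps)
  finally show ?thesis unfolding 1 2 by simp
qed

text \<open>
  The two gradients can cancel only at the midpoint of the geodesic between the poles: equal norms give
  equal distances, hence equal coefficients, and then \<open>x\<close> is a multiple of \<open>a1 + a2\<close>; the sign follows
  from the heights.
\<close>

lemma log_grad_sum_zero:
  assumes x: "x \<in> upper_hemisphere" and a: "a1 \<in> upper_hemisphere" "a2 \<in> upper_hemisphere"
    and ne: "x \<noteq> a1" "x \<noteq> a2" and zero: "log_grad a1 x + log_grad a2 x = 0"
  shows "x = (a1 + a2) /\<^sub>R norm (a1 + a2)"
proof -
  have n: "norm x = 1" "norm a1 = 1" "norm a2 = 1"
    using hemisphere_inner(1) x a by blast+
  have s1: "- 1 < x \<bullet> a1" "x \<bullet> a1 < 1" and s2: "- 1 < x \<bullet> a2" "x \<bullet> a2 < 1"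
    using hemisphere_inner(3,5)[OF x a(1)] hemisphere_inner(3,5)[OF x a(2)] ne by auto
  have "log_grad a1 x = - log_grad a2 x" using zero by (simp add: eq_neg_iff_add_eq_0)
  then have "norm (log_grad a1 x) = norm (log_grad a2 x)" by simp
  then have "arccos (x \<bullet> a1) = arccos (x \<bullet> a2)"
    using norm_log_grad[OF n(1,2) s1] norm_log_grad[OF n(1,3) s2] by simp
  then have s: "x \<bullet> a1 = x \<bullet> a2"
    using s1 s2 by (metis cos_arccos less_imp_le)
  have "log_coeff (x \<bullet> a1) *\<^sub>R ((a1 + a2) - (2 * (x \<bullet> a1)) *\<^sub>R x) = 0"
    using zero unfolding log_grad_def s[symmetric] scaleR_add_right[symmetric]
    by (simp add: algebra_simps flip: scaleR_2)
  moreover have "log_coeff (x \<bullet> a1) \<noteq> 0"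
    using arccos_facts(1,3)[OF s1] by (simp add: log_coeff_def)
  ultimately have e: "a1 + a2 = (2 * (x \<bullet> a1)) *\<^sub>R x" by simp
  have "0 < snd (a1 + a2)" using a by (simp add: upper_hemisphere_def)
  also have "snd (a1 + a2) = 2 * (x \<bullet> a1) * snd x" by (simp add: e)
  finally have "0 < x \<bullet> a1" using x by (simp add: upper_hemisphere_def zero_less_mult_iff)
  then show ?thesis unfolding e using n(1) by simp
qed

section \<open>The field of two poles\<close>

lemma has_derivative_norm_powr_scaleR:
  fixes v :: "'a::real_normed_vector \<Rightarrow> 'b::real_inner"
  assumes v: "(v has_derivative v') (at y)" and nz: "v y \<noteq> 0"
  shows "((\<lambda>y. norm (v y) powr (p - 2) *\<^sub>R v y) has_derivative
    (\<lambda>h. norm (v y) powr (p - 2) *\<^sub>R v' h + ((p - 2) * norm (v y) powr (p - 4) * (v y \<bullet> v' h)) *\<^sub>R v y)) (at y)"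
proof -
  have pos: "norm (v y) > 0" using nz by simp
  have "((\<lambda>y. norm (v y)) has_derivative (\<lambda>h. v' h \<bullet> sgn (v y))) (at y)"
    by (rule has_derivative_compose[OF v has_derivative_norm[OF nz], unfolded o_def])
  from DERIV_compose_FDERIV[where f = "\<lambda>r. r powr (p - 2)" and g = "\<lambda>y. norm (v y)", OF has_real_derivative_powr[OF pos] this]
  have 1: "((\<lambda>y. norm (v y) powr (p - 2)) has_derivative
      (\<lambda>h. (v' h \<bullet> sgn (v y)) * ((p - 2) * norm (v y) powr (p - 2 - 1)))) (at y)" .
  have eq: "(v' h \<bullet> sgn (v y)) * ((p - 2) * norm (v y) powr (p - 2 - 1))
      = (p - 2) * norm (v y) powr (p - 4) * (v y \<bullet> v' h)" for h
  proof -
    have "norm (v y) powr (p - 2 - 1) = norm (v y) powr (p - 4) * norm (v y)"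
      using powr_add[of "norm (v y)" "p - 4" 1] pos by simp
    then show ?thesis using pos by (simp add: sgn_div_norm inner_commute)
  qed
  from 1 have "((\<lambda>y. norm (v y) powr (p - 2)) has_derivative
      (\<lambda>h. (p - 2) * norm (v y) powr (p - 4) * (v y \<bullet> v' h))) (at y)" by (simp only: eq)
  from has_derivative_scaleR[OF this v] show ?thesis by simp
qed

text \<open>
  With \<open>C = (N - p) / (2 (p - 1))\<close>, the constants are \<open>C^(p-1)\<close> and \<open>(p - 1) C^p\<close>: the two coefficients
  that Young's inequality produces.
\<close>

lemma hardy_constants_eq:
  assumes "1 < p" "p < real N"
  shows "C2_2 N p = ((real N - p) / (2 * (p - 1))) powr (p - 1)"
    "C1_2 N p = (real N - p) / 2 * C2_2 N p" "0 \<le> C2_2 N p"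
proof -
  show "C2_2 N p = ((real N - p) / (2 * (p - 1))) powr (p - 1)"
  proof -
    have "(x / (2 * m)) powr s = x powr s / (2 powr s * m powr s)" if "0 < x" "0 < m" for x m s :: real
      using that by (simp add: powr_divide powr_mult)
    from this[of "real N - p" "p - 1"] assms show ?thesis by (simp only: C2_2_def)
  qed
  have "x powr p = x powr (p - 1) * x" if "0 < x" for x :: real
    using powr_add[of x "p - 1" 1] that by simp
  from this[of 2] this[of "real N - p"] assms
  show "C1_2 N p = (real N - p) / 2 * C2_2 N p"
    by (simp add: C1_2_def C2_2_def ac_simps)
  show "0 \<le> C2_2 N p" by (simp add: C2_2_def)
qed

text \<open>
  The bound \<open>div V - (N - p)/2 |v|^p \<ge> \<dots>\<close> as a statement about two unit vectors, which stand for
  \<open>\<nabla>d\<^sub>1\<close> and \<open>\<nabla>d\<^sub>2\<close>, with \<open>q\<^sub>i\<close> standing for \<open>d\<^sub>i cot d\<^sub>i\<close>. The identities behind it are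
  \<open>|v|\<^sup>2 - (v \<bullet> n\<^sub>1)\<^sup>2 = (1 - G\<^sup>2) / d\<^sub>2\<^sup>2\<close>, its mirror image, and
  \<open>|w\<^sub>1 - w\<^sub>2|\<^sup>2 + |v|\<^sup>2 = 2 (1/d\<^sub>1\<^sup>2 + 1/d\<^sub>2\<^sup>2)\<close>. The sum of the two terms \<open>(q\<^sub>i - 1) / d\<^sub>i\<^sup>2\<close> is at least \<open>c\<close>, while
  the sum of the \<open>q\<^sub>i - 1\<close> is at least \<open>c/2 (d\<^sub>1\<^sup>2 + d\<^sub>2\<^sup>2)\<close>, and hence
  at least \<open>c (d\<^sub>1\<^sup>2 + d\<^sub>2\<^sup>2)\<close> since \<open>c \<le> 0\<close>.
\<close>

lemma two_pole_algebra:
  fixes n1 n2 :: "'a::real_inner" and d1 d2 q1 q2 c N p :: real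
  assumes n: "norm n1 = 1" "norm n2 = 1" and d: "0 < d1" "0 < d2" and c: "c \<le> 0"
    and q: "c / 2 * d1\<^sup>2 \<le> q1 - 1" "c / 2 * d2\<^sup>2 \<le> q2 - 1" and p: "2 \<le> p" and N: "1 \<le> N"
  defines "w1 \<equiv> n1 /\<^sub>R d1" and "w2 \<equiv> n2 /\<^sub>R d2"
  defines "v \<equiv> w1 + w2" and "G \<equiv> n1 \<bullet> n2"
  assumes v: "v \<noteq> 0"
  shows "(N - p) / 2 * ((norm (w1 - w2))\<^sup>2 * norm v powr (p - 2)) + (N - 1) * c * norm v powr (p - 2)
      + (p - 2) * ((4 + c * (d1\<^sup>2 + d2\<^sup>2)) * ((1 - G\<^sup>2) / (d1\<^sup>2 * d2\<^sup>2)) * norm v powr (p - 4))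
    \<le> norm v powr (p - 2) * (((N - 1) * q1 - 1) / d1\<^sup>2 + ((N - 1) * q2 - 1) / d2\<^sup>2)
      + (p - 2) * norm v powr (p - 4)
        * ((q1 / d1\<^sup>2 * (v \<bullet> v) - (1 + q1) / d1\<^sup>2 * (v \<bullet> n1)\<^sup>2)
          + (q2 / d2\<^sup>2 * (v \<bullet> v) - (1 + q2) / d2\<^sup>2 * (v \<bullet> n2)\<^sup>2))
      - (N - p) / 2 * norm v powr p"
proof -
  define A where "A = 1 / d1"
  define B where "B = 1 / d2"
  define M where "M = v \<bullet> v"
  define P where "P = norm v powr (p - 4)"
  define t1 where "t1 = q1 - 1"
  define t2 where "t2 = q2 - 1"
  have nn: "n1 \<bullet> n1 = 1" "n2 \<bullet> n2 = 1" "n2 \<bullet> n1 = G"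
    using n by (simp_all add: norm_eq_1 G_def inner_commute)
  have w: "w1 = A *\<^sub>R n1" "w2 = B *\<^sub>R n2" by (simp_all add: w1_def w2_def A_def B_def divide_inverse)
  have v1: "v \<bullet> n1 = A + G * B" and v2: "v \<bullet> n2 = B + G * A"
    by (simp_all add: v_def w inner_add_left nn G_def[symmetric])
  have M: "M = A\<^sup>2 + B\<^sup>2 + 2 * G * A * B"
    by (simp add: M_def v_def w inner_add_left inner_add_right nn G_def[symmetric] power2_eq_square algebra_simps)
  have W: "(norm (w1 - w2))\<^sup>2 = 2 * (A\<^sup>2 + B\<^sup>2) - M"
    unfolding power2_norm_eq_inner
    by (simp add: M w inner_diff_left inner_diff_right nn G_def[symmetric] power2_eq_square algebra_simps)
  have nv: "norm v > 0" using v by simp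
  have Pp: "norm v powr (p - 2) = P * M" "norm v powr p = P * M\<^sup>2"
  proof -
    have "norm v powr (p - 2) = P * norm v powr 2" "norm v powr p = P * norm v powr 4"
      unfolding P_def powr_add[symmetric] by simp_all
    moreover have "norm v powr 2 = M" using nv by (simp add: powr_numeral M_def dot_square_norm)
    moreover have "norm v powr 4 = (norm v powr 2)\<^sup>2" using nv by (simp add: powr_numeral)
    ultimately show "norm v powr (p - 2) = P * M" "norm v powr p = P * M\<^sup>2" by simp_all
  qed
  have dv: "X / d1\<^sup>2 = X * A\<^sup>2" "X / d2\<^sup>2 = X * B\<^sup>2" "X / (d1\<^sup>2 * d2\<^sup>2) = X * (A\<^sup>2 * B\<^sup>2)" for X
    by (simp_all add: A_def B_def power_divide)
  have AB: "A\<^sup>2 * d1\<^sup>2 = 1" "B\<^sup>2 * d2\<^sup>2 = 1" using d by (simp_all add: A_def B_def power_divide)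
  have qq: "q1 = 1 + t1" "q2 = 1 + t2" by (simp_all add: t1_def t2_def)
  have G2: "0 \<le> 1 - G\<^sup>2"
    using Cauchy_Schwarz_ineq2[of n1 n2] n by (simp add: G_def abs_square_le_1)
  have M0: "0 \<le> M" and P0: "0 \<le> P" by (simp_all add: M_def P_def)
  \<comment> \<open>the exact value of the right-hand side, before the bounds on the \<open>q\<close>s enter\<close>
  have eq: "P * M * (((N - 1) * q1 - 1) * A\<^sup>2 + ((N - 1) * q2 - 1) * B\<^sup>2)
      + (p - 2) * P * ((q1 * A\<^sup>2 * M - (1 + q1) * A\<^sup>2 * (A + G * B)\<^sup>2)
          + (q2 * B\<^sup>2 * M - (1 + q2) * B\<^sup>2 * (B + G * A)\<^sup>2)) - (N - p) / 2 * (P * M\<^sup>2)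
    = P * (M * ((N - p) / 2 * (2 * (A\<^sup>2 + B\<^sup>2) - M) + (N - 1) * (t1 * A\<^sup>2 + t2 * B\<^sup>2))
        + (p - 2) * ((4 + (t1 + t2)) * ((1 - G\<^sup>2) * (A\<^sup>2 * B\<^sup>2))))"
    unfolding qq M by (simp add: field_simps power2_eq_square)
  have t: "c / 2 \<le> t1 * A\<^sup>2" "c / 2 \<le> t2 * B\<^sup>2"
  proof -
    have "c / 2 * d1\<^sup>2 * A\<^sup>2 \<le> t1 * A\<^sup>2" "c / 2 * d2\<^sup>2 * B\<^sup>2 \<le> t2 * B\<^sup>2"
      using q by (intro mult_right_mono; simp add: t1_def t2_def)+
    then show "c / 2 \<le> t1 * A\<^sup>2" "c / 2 \<le> t2 * B\<^sup>2"
      using AB by (metis mult.assoc mult.commute mult.right_neutral)+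
  qed
  have t12: "c * (d1\<^sup>2 + d2\<^sup>2) \<le> t1 + t2"
  proof -
    have "c * d1\<^sup>2 \<le> 0" "c * d2\<^sup>2 \<le> 0" using c by (simp_all add: mult_nonpos_nonneg)
    then show ?thesis using q by (simp add: t1_def t2_def distrib_left)
  qed
  have "P * (M * ((N - p) / 2 * (2 * (A\<^sup>2 + B\<^sup>2) - M) + (N - 1) * c)
        + (p - 2) * ((4 + c * (d1\<^sup>2 + d2\<^sup>2)) * ((1 - G\<^sup>2) * (A\<^sup>2 * B\<^sup>2))))
    \<le> P * (M * ((N - p) / 2 * (2 * (A\<^sup>2 + B\<^sup>2) - M) + (N - 1) * (t1 * A\<^sup>2 + t2 * B\<^sup>2))
        + (p - 2) * ((4 + (t1 + t2)) * ((1 - G\<^sup>2) * (A\<^sup>2 * B\<^sup>2))))"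
    using t t12 M0 P0 G2 p N
    by (intro mult_left_mono add_mono mult_right_mono order_refl mult_nonneg_nonneg) auto
  then show ?thesis
    unfolding dv v1 v2 W Pp M_def[symmetric] P_def[symmetric] eq
    by (simp add: algebra_simps)
qed

text \<open>
  A test function is represented by its expression \<open>U\<close> in the chart, extended by zero to the whole
  space and thus continuously differentiable everywhere; \<open>K\<close> is a compact set that contains its support.
\<close>

locale two_poles =
  fixes a1 a2 :: "'n::finite amb" and p :: real
    and U :: "real ^ 'n \<Rightarrow> real" and gU :: "real ^ 'n \<Rightarrow> real ^ 'n" and K :: "(real ^ 'n) set"
  assumes a1: "a1 \<in> upper_hemisphere" and a2: "a2 \<in> upper_hemisphere"
    and p: "2 \<le> p" "p < real CARD('n)" and dim: "2 \<le> CARD('n)"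
    and K: "compact K" "K \<subseteq> ball 0 1"
    and U: "\<And>y. (U has_derivative (\<lambda>h. gU y \<bullet> h)) (at y)"
    and gU: "continuous_on UNIV gU"
    and off_K: "\<And>y. y \<notin> K \<Longrightarrow> U y = 0" "\<And>y. y \<notin> K \<Longrightarrow> gU y = 0"
begin

definition "\<delta> = max (arccos (north_pole \<bullet> a1)) (arccos (north_pole \<bullet> a2))"
definition "height y = sqrt (1 - (norm (y :: real ^ 'n))\<^sup>2)"
definition "d a y = arccos (graph_chart y \<bullet> (a :: 'n amb))"
definition "w a y = log_grad (a :: 'n amb) (graph_chart y)"
definition "v y = w a1 y + w a2 y"
definition "w' a y h = log_grad' (a :: 'n amb) (graph_chart y) (chart_push y h)"
definition "v' y h = w' a1 y h + w' a2 y h"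
text \<open>
  The points where the divergence need not exist classically: the poles, and the zero of \<open>v\<close>, where
  \<open>|v|^(p-2)\<close> need not be differentiable.
\<close>

definition "S = {fst a1, fst a2} \<union> {y \<in> ball 0 1 - {fst a1, fst a2}. v y = 0}"
text \<open>
  The integrable function by which all integrands are dominated up to constants. The balls of radius 2 around the
  poles contain the unit ball.
\<close>

definition "sing y = indicator (ball (fst a1) 2) y * norm (y - fst a1) powr (- p)
    + indicator (ball (fst a2) 2) y * norm (y - fst a2) powr (- p)"
text \<open>
  A common bound for \<open>|v|\<close>, \<open>|w\<^sub>1 - w\<^sub>2|\<close> and \<open>1/d\<^sub>i\<close> which is at least 1. Thereby all estimates reduce to
  powers of \<open>Q\<close> with an exponent of at most \<open>p\<close>.
\<close>

definition "Q y = 1 / norm (y - fst a1) + 1 / norm (y - fst a2)"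

lemma delta_bounds: "0 \<le> \<delta>" "\<delta> < pi / 2"
proof -
  have "0 \<le> arccos (north_pole \<bullet> a) \<and> arccos (north_pole \<bullet> a) < pi / 2"
    if "a \<in> upper_hemisphere" for a :: "'n amb"
  proof -
    have "north_pole \<bullet> a = snd a" by (simp add: north_pole_def inner_prod_def)
    moreover have "0 < snd a" using that by (simp add: upper_hemisphere_def)
    moreover have "snd a \<le> 1"
      using norm_snd_le[of "snd a" "fst a"] hemisphere_inner(1)[OF that that] by simp
    ultimately show ?thesis
      using arccos_less_arccos[of 0 "snd a"] arccos_lbound[of "snd a"] by simp
  qed
  from this[OF a1] this[OF a2] show "0 \<le> \<delta>" "\<delta> < pi / 2" unfolding \<delta>_def by auto
qed

lemma pole_facts:
  assumes a: "a \<in> {a1, a2}" and y: "y \<in> ball 0 1" "y \<noteq> fst a"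
  shows "norm a = 1" "norm (graph_chart y) = 1" "- 1 < graph_chart y \<bullet> a" "graph_chart y \<bullet> a < 1"
    "0 < d a y" "d a y < pi" "1 / d a y \<le> 1 / norm (y - fst a)"
    "c_const \<delta> / 2 * (d a y)\<^sup>2 \<le> d a y * cot (d a y) - 1"
    "\<bar>d a y * cot (d a y)\<bar> \<le> 1 + \<bar>c_const \<delta>\<bar> * pi\<^sup>2"
proof -
  have ah: "a \<in> upper_hemisphere" using a a1 a2 by auto
  note xh = graph_chart_hemisphere(1)[OF y(1)]
  have ne: "graph_chart y \<noteq> a" using y(2) graph_chart_hemisphere(2)[of y] by auto
  show na: "norm a = 1" and nx: "norm (graph_chart y) = 1"
    using hemisphere_inner(1) ah xh by blast+
  show s: "- 1 < graph_chart y \<bullet> a" "graph_chart y \<bullet> a < 1"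
    using hemisphere_inner(3,5)[OF xh ah] ne by auto
  show d: "0 < d a y" "d a y < pi" using arccos_facts(1,2)[OF s] by (simp_all add: d_def)
  have "norm (y - fst a) \<le> norm (graph_chart y - a)"
    by (metis fst_diff graph_chart_hemisphere(2) norm_fst_le prod.collapse)
  also have "\<dots> \<le> d a y" unfolding d_def by (rule chord_le_arccos[OF nx na])
  finally show "1 / d a y \<le> 1 / norm (y - fst a)" using y(2) d(1) by (intro divide_left_mono mult_pos_pos) auto
  have "d a y \<le> arccos (north_pole \<bullet> a) + pi / 2"
    unfolding d_def by (rule arccos_triangle_pole[OF xh ah])
  also have "\<dots> \<le> \<delta> + pi / 2" using a by (auto simp: \<delta>_def)
  finally show c: "c_const \<delta> / 2 * (d a y)\<^sup>2 \<le> d a y * cot (d a y) - 1"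
    by (intro cot_bound_c_const delta_bounds d)
  have "(d a y)\<^sup>2 \<le> pi\<^sup>2" using d by (intro power_mono) auto
  then have "- (\<bar>c_const \<delta>\<bar> * pi\<^sup>2) \<le> - (\<bar>c_const \<delta>\<bar> * (d a y)\<^sup>2)"
    by (simp add: mult_left_mono)
  also have "\<dots> \<le> c_const \<delta> / 2 * (d a y)\<^sup>2"
  proof -
    have "- \<bar>c_const \<delta>\<bar> \<le> c_const \<delta> / 2" by (simp add: abs_if)
    from mult_right_mono[OF this, of "(d a y)\<^sup>2"] show ?thesis by simp
  qed
  finally show "\<bar>d a y * cot (d a y)\<bar> \<le> 1 + \<bar>c_const \<delta>\<bar> * pi\<^sup>2"
    using c cot_upper_bound[OF d] by (simp add: abs_le_iff)
qed

lemma graph_chart_w: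
  assumes "y \<in> ball 0 1"
  shows "graph_chart y \<bullet> w a y = 0" "graph_chart y \<bullet> v y = 0"
  using log_grad_tangent[OF hemisphere_inner(1)[OF graph_chart_hemisphere(1)[OF assms] a1]]
  by (simp_all add: w_def v_def inner_add_right)

lemma height_facts:
  assumes "y \<in> ball 0 1"
  shows "0 < height y" "height y \<le> 1" "(height y)\<^sup>2 = 1 - (norm y)\<^sup>2"
  using ball_height[OF assms] by (simp_all add: height_def)

lemma finite_S: "finite S"
proof -
  have "{y \<in> ball 0 1 - {fst a1, fst a2}. v y = 0} \<subseteq> {fst ((a1 + a2) /\<^sub>R norm (a1 + a2))}"
  proof (rule subsetI)
    fix y assume "y \<in> {y \<in> ball 0 1 - {fst a1, fst a2}. v y = 0}"
    then have y: "y \<in> ball 0 1" "y \<noteq> fst a1" "y \<noteq> fst a2" "v y = 0" by auto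
    have "graph_chart y = (a1 + a2) /\<^sub>R norm (a1 + a2)"
    proof (rule log_grad_sum_zero[OF graph_chart_hemisphere(1)[OF y(1)] a1 a2])
      show "graph_chart y \<noteq> a1" "graph_chart y \<noteq> a2"
        using y graph_chart_hemisphere(2)[of y] by auto
    qed (use y in \<open>simp add: v_def w_def\<close>)
    then have "y = fst ((a1 + a2) /\<^sub>R norm (a1 + a2))" by (metis graph_chart_hemisphere(2))
    then show "y \<in> {fst ((a1 + a2) /\<^sub>R norm (a1 + a2))}" by blast
  qed
  then show ?thesis unfolding S_def using finite_subset by auto
qed

lemma regular_point:
  assumes "y \<in> ball 0 1 - S"
  shows "y \<in> ball 0 1" "y \<noteq> fst a1" "y \<noteq> fst a2" "v y \<noteq> 0"
  using assms by (auto simp: S_def)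

lemma open_regular: "open (ball 0 1 - S)"
  using finite_S by (intro open_Diff open_ball finite_imp_closed)

lemma integrable_sing: "integrable lborel sing"
  unfolding sing_def
  using p by (intro Bochner_Integration.integrable_add integrable_norm_powr_ball) auto

lemma sing_nonneg: "0 \<le> sing y" by (simp add: sing_def)

lemma Q_bounds:
  assumes y: "y \<in> ball 0 1" "y \<noteq> fst a1" "y \<noteq> fst a2"
  shows "1 \<le> Q y" "s \<le> p \<Longrightarrow> Q y powr s \<le> 2 powr p * sing y"
proof -
  define r1 where "r1 = norm (y - fst a1)"
  define r2 where "r2 = norm (y - fst a2)"
  have b: "fst a \<in> ball 0 1" if "a \<in> upper_hemisphere" for a :: "'n amb"
    using hemisphere_graph_chart(1)[OF that] .
  have r: "0 < r1" "r1 < 2" "0 < r2" "r2 < 2"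
    using norm_triangle_ineq4[of y "fst a1"] norm_triangle_ineq4[of y "fst a2"] b[OF a1] b[OF a2] y
    by (auto simp: r1_def r2_def)
  have Qr: "Q y = 1 / r1 + 1 / r2" by (simp add: Q_def r1_def r2_def)
  have "1 / 2 \<le> 1 / r1" "1 / 2 \<le> 1 / r2" using r by (auto intro: divide_left_mono)
  then show Q1: "1 \<le> Q y" unfolding Qr by linarith
  have sing: "sing y = (1 / r1) powr p + (1 / r2) powr p"
    using r by (simp add: sing_def r1_def r2_def dist_norm norm_minus_commute powr_minus inverse_powr divide_inverse)
  assume s: "s \<le> p"
  have "Q y powr s \<le> Q y powr p" using s Q1 by (rule powr_mono)
  also have "\<dots> \<le> (2 * max (1 / r1) (1 / r2)) powr p"
    unfolding Qr using r p by (intro powr_mono2) auto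
  also have "\<dots> = 2 powr p * max (1 / r1) (1 / r2) powr p" using r by (simp add: powr_mult)
  also have "max (1 / r1) (1 / r2) powr p \<le> (1 / r1) powr p + (1 / r2) powr p"
    by (simp add: max_def)
  finally show "Q y powr s \<le> 2 powr p * sing y" unfolding sing by simp
qed

lemma norm_w_le:
  assumes a: "a \<in> {a1, a2}" and y: "y \<in> ball 0 1" "y \<noteq> fst a"
  shows "norm (w a y) = 1 / d a y" "norm (w a y) \<le> 1 / norm (y - fst a)"
proof -
  note f = pole_facts[OF a y]
  show "norm (w a y) = 1 / d a y" unfolding w_def d_def by (rule norm_log_grad[OF f(2,1,3,4)])
  with f(7) show "norm (w a y) \<le> 1 / norm (y - fst a)" by simp
qed

lemma norm_v_le:
  assumes y: "y \<in> ball 0 1" "y \<noteq> fst a1" "y \<noteq> fst a2"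
  shows "norm (v y) \<le> Q y" "norm (w a1 y - w a2 y) \<le> Q y"
  using norm_triangle_ineq[of "w a1 y" "w a2 y"] norm_triangle_ineq4[of "w a1 y" "w a2 y"]
    norm_w_le(2)[of a1 y] norm_w_le(2)[of a2 y] y
  by (auto simp: v_def Q_def)

lemma norm_v'_le: "\<exists>C\<ge>0. \<forall>y h. y \<in> ball 0 1 \<longrightarrow> y \<noteq> fst a1 \<longrightarrow> y \<noteq> fst a2 \<longrightarrow>
   norm (v' y h) \<le> C * (Q y)\<^sup>2 * norm h / height y"
proof (intro exI conjI allI impI)
  define C where "C = 1 + 2 * (1 + \<bar>c_const \<delta>\<bar> * pi\<^sup>2) + pi"
  have C: "0 \<le> C" using pi_ge_zero by (simp add: C_def)
  show "0 \<le> 4 * C" using C by simp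
  fix y h assume y: "y \<in> ball 0 1" "y \<noteq> fst a1" "y \<noteq> fst a2"
  have 1: "norm (w' a y h) \<le> C * (Q y)\<^sup>2 * (2 * norm h / height y)" if a: "a \<in> {a1, a2}" for a
  proof -
    have ya: "y \<noteq> fst a" using a y by auto
    note f = pole_facts[OF a y(1) ya]
    have "norm (w' a y h) \<le> C / (d a y)\<^sup>2 * norm (chart_push y h)"
      unfolding w'_def C_def d_def
      by (rule norm_log_grad'_le[OF f(2,1,3,4) chart_push_tangent[OF y(1)] f(9)[unfolded d_def]])
    also have "\<dots> \<le> (C * (Q y)\<^sup>2) * (2 * norm h / height y)"
    proof (rule mult_mono)
      have "1 / d a y \<le> Q y"
        using f(7) a by (auto simp: Q_def intro: order_trans)
      then have "(1 / d a y)\<^sup>2 \<le> (Q y)\<^sup>2" using f(5) by (intro power_mono) auto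
      then have "C * (1 / d a y)\<^sup>2 \<le> C * (Q y)\<^sup>2" using C by (rule mult_left_mono)
      then show "C / (d a y)\<^sup>2 \<le> C * (Q y)\<^sup>2" by (simp add: power_divide)
      show "norm (chart_push y h) \<le> 2 * norm h / height y"
        using norm_chart_push_le[OF y(1), of h] by (simp add: height_def)
    qed (use C in auto)
    finally show ?thesis .
  qed
  have "norm (v' y h) \<le> C * (Q y)\<^sup>2 * (2 * norm h / height y) + C * (Q y)\<^sup>2 * (2 * norm h / height y)"
    unfolding v'_def using 1[of a1] 1[of a2] by (intro norm_triangle_mono) auto
  then show "norm (v' y h) \<le> 4 * C * (Q y)\<^sup>2 * norm h / height y" by (simp add: algebra_simps)
qed

lemma has_derivative_v:
  assumes y: "y \<in> ball 0 1" "y \<noteq> fst a1" "y \<noteq> fst a2"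
  shows "(w a1 has_derivative w' a1 y) (at y)" "(w a2 has_derivative w' a2 y) (at y)"
    "(v has_derivative v' y) (at y)"
proof -
  have w: "(w a has_derivative w' a y) (at y)" if a: "a \<in> {a1, a2}" for a
  proof -
    have ya: "y \<noteq> fst a" using a y by auto
    note f = pole_facts[OF a y(1) ya]
    have "(graph_chart has_derivative chart_push y) (at y)"
      using has_derivative_graph_chart[OF y(1)] by (simp add: chart_push_def[abs_def])
    from has_derivative_compose[OF this has_derivative_log_grad[OF f(3,4)]]
    show ?thesis by (simp add: w_def[abs_def] w'_def[abs_def])
  qed
  then show "(w a1 has_derivative w' a1 y) (at y)" "(w a2 has_derivative w' a2 y) (at y)" by auto
  then show "(v has_derivative v' y) (at y)"
    unfolding v_def[abs_def] v'_def[abs_def] by (rule has_derivative_add)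
qed

section \<open>Divergence of the weighted field\<close>

text \<open>
  The field \<open>|v|^(p-2) v\<close> and the density \<open>|u|^p / z\<close>, with their derivatives. The chart components of
  \<open>|u|^p V\<close> times the volume density are \<open>F\<^sub>i\<close>, and \<open>D\<^sub>i\<close> is the \<open>i\<close>-th partial derivative of \<open>F\<^sub>i\<close>.
\<close>

definition "V y = norm (v y) powr (p - 2) *\<^sub>R v y"
definition "V' y h = norm (v y) powr (p - 2) *\<^sub>R v' y h
    + ((p - 2) * norm (v y) powr (p - 4) * (v y \<bullet> v' y h)) *\<^sub>R v y"
definition "psi y = \<bar>U y\<bar> powr p / height y"
definition "psi' y h = p * \<bar>U y\<bar> powr (p - 1) * sgn (U y) * (gU y \<bullet> h) / height y
    + \<bar>U y\<bar> powr p * (y \<bullet> h) / height y ^ 3"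
definition "F i y = fst (V y) $ i * psi y"
definition "D i y = fst (V' y (axis i 1)) $ i * psi y + fst (V y) $ i * psi' y (axis i 1)"

lemma off_K_zero:
  assumes "y \<notin> K"
  shows "psi y = 0" "psi' y h = 0" "F i y = 0" "D i y = 0"
  using off_K[OF assms] by (simp_all add: psi_def psi'_def F_def D_def)

lemma has_derivative_psi:
  assumes y: "y \<in> ball 0 1"
  shows "(psi has_derivative psi' y) (at y)"
proof -
  note z = height_facts[OF y]
  have 1: "((\<lambda>y. \<bar>U y\<bar> powr p) has_derivative (\<lambda>h. (gU y \<bullet> h) * (p * \<bar>U y\<bar> powr (p - 1) * sgn (U y)))) (at y)"
    using p by (intro DERIV_compose_FDERIV[where f = "\<lambda>r. \<bar>r\<bar> powr p" and g = U]
        has_real_derivative_abs_powr U) auto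
  have h: "(height has_derivative (\<lambda>h. - (y \<bullet> h) / height y)) (at y)"
    using has_derivative_snd[OF has_derivative_graph_chart[OF y]]
    by (simp add: graph_chart_def height_def[abs_def])
  have "((\<lambda>y. \<bar>U y\<bar> powr p / height y) has_derivative
      (\<lambda>h. - (\<bar>U y\<bar> powr p) * (inverse (height y) * (- (y \<bullet> h) / height y) * inverse (height y))
        + (gU y \<bullet> h) * (p * \<bar>U y\<bar> powr (p - 1) * sgn (U y)) / height y)) (at y)"
    using z(1) by (intro has_derivative_divide 1 h) auto
  moreover have "- (\<bar>U y\<bar> powr p) * (inverse (height y) * (- (y \<bullet> h) / height y) * inverse (height y))
        + (gU y \<bullet> h) * (p * \<bar>U y\<bar> powr (p - 1) * sgn (U y)) / height y = psi' y h" for h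
    using z(1) by (simp add: psi'_def field_simps power3_eq_cube)
  ultimately show ?thesis by (simp only: psi_def[abs_def])
qed

lemma has_derivative_V:
  assumes y: "y \<in> ball 0 1 - S"
  shows "(V has_derivative V' y) (at y)"
  unfolding V_def[abs_def] V'_def[abs_def]
  by (intro has_derivative_norm_powr_scaleR has_derivative_v(3) regular_point[OF y])

text \<open>
  On \<open>K\<close> this is the product rule. Off \<open>K\<close>, and in particular near the boundary of the ball, where the
  chart degenerates, \<open>F\<close> vanishes on an open set.
\<close>

lemma F_derivative:
  assumes y: "y \<notin> S"
  shows "((\<lambda>t. F i (y + t *\<^sub>R axis i 1)) has_real_derivative D i y) (at 0)"
proof -
  have deriv: "(F i has_derivative (\<lambda>h. fst (V y) $ i * psi' y h + fst (V' y h) $ i * psi y)) (at y)"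
  proof (cases "y \<in> K")
    case True
    then have yb: "y \<in> ball 0 1 - S" using K y by auto
    have "((\<lambda>y. fst (V y) $ i) has_derivative (\<lambda>h. fst (V' y h) $ i)) (at y)"
      by (intro bounded_linear.has_derivative[OF bounded_linear_vec_nth] has_derivative_fst has_derivative_V yb)
    from has_derivative_mult[OF this has_derivative_psi[OF regular_point(1)[OF yb]]]
    show ?thesis by (simp add: F_def[abs_def])
  next
    case False
    have "((\<lambda>y. 0) has_derivative (\<lambda>h. 0)) (at y)" by simp
    then have "(F i has_derivative (\<lambda>h. 0)) (at y)"
      by (rule has_derivative_transform_within_open[where s = "- K"])
        (use False K off_K_zero in \<open>auto simp: compact_imp_closed open_Compl\<close>)
    then show ?thesis using off_K_zero[OF False] by simp
  qed
  from deriv have 1: "(F i has_derivative (\<lambda>h. fst (V y) $ i * psi' y h + fst (V' y h) $ i * psi y)) (at (y + 0 *\<^sub>R axis i 1))"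
    by simp
  have 2: "((\<lambda>t. y + t *\<^sub>R axis i 1) has_derivative (\<lambda>t. t *\<^sub>R axis i 1)) (at 0)"
    by (auto intro!: derivative_eq_intros)
  have "((\<lambda>t. F i (y + t *\<^sub>R axis i 1)) has_derivative
      (\<lambda>t. fst (V y) $ i * psi' y (t *\<^sub>R axis i 1) + fst (V' y (t *\<^sub>R axis i 1)) $ i * psi y)) (at 0)"
    by (rule has_derivative_compose[OF 2 1])
  then show ?thesis
  proof (rule has_derivative_imp_has_field_derivative)
    fix t :: real
    have "linear (\<lambda>h. fst (V y) $ i * psi' y h + fst (V' y h) $ i * psi y)"
      by (rule has_derivative_linear[OF deriv])
    from linear_cmul[OF this, of t "axis i 1"]
    show "t * D i y = fst (V y) $ i * psi' y (t *\<^sub>R axis i 1) + fst (V' y (t *\<^sub>R axis i 1)) $ i * psi y"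
      by (simp add: D_def algebra_simps)
  qed
qed

lemma continuous_on_regular:
  "continuous_on (ball 0 1 - S) (w a1)" "continuous_on (ball 0 1 - S) (w a2)"
  "continuous_on (ball 0 1 - S) v" "continuous_on (ball 0 1 - S) V" "continuous_on (ball 0 1) psi"
  "continuous_on (ball 0 1 - S) height" "continuous_on UNIV U"
proof -
  have S: "y \<in> ball 0 1" "y \<noteq> fst a1" "y \<noteq> fst a2" if "y \<in> ball 0 1 - S" for y
    using regular_point[OF that] by auto
  show "continuous_on (ball 0 1 - S) (w a1)" "continuous_on (ball 0 1 - S) (w a2)"
    "continuous_on (ball 0 1 - S) v"
    using has_derivative_v S
    by (meson continuous_at_imp_continuous_on has_derivative_continuous)+
  show "continuous_on (ball 0 1 - S) V" "continuous_on (ball 0 1) psi" "continuous_on UNIV U"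
    using has_derivative_V has_derivative_psi U
    by (meson continuous_at_imp_continuous_on has_derivative_continuous)+
  show "continuous_on (ball 0 1 - S) height"
    unfolding height_def[abs_def] by (intro continuous_intros)
qed

lemma bound_on_K: "\<exists>M\<ge>1. \<forall>y\<in>K. \<bar>U y\<bar> \<le> M \<and> norm (gU y) \<le> M \<and> 1 / height y \<le> M"
proof -
  have "continuous_on K U" using continuous_on_regular(7) continuous_on_subset by blast
  then have "compact (U ` K)" by (rule compact_continuous_image[OF _ K(1)])
  moreover have "continuous_on K gU" using gU continuous_on_subset by blast
  then have "compact (gU ` K)" by (rule compact_continuous_image[OF _ K(1)])
  moreover have "continuous_on K (\<lambda>y. 1 / height y)"
  proof (intro continuous_intros ballI)
    show "continuous_on K height" unfolding height_def[abs_def] by (intro continuous_intros)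
    show "height y \<noteq> 0" if "y \<in> K" for y using height_facts(1)[of y] K(2) that by force
  qed
  then have "compact ((\<lambda>y. 1 / height y) ` K)" by (rule compact_continuous_image[OF _ K(1)])
  ultimately obtain A B C where "\<And>y. y \<in> K \<Longrightarrow> norm (U y) \<le> A" "\<And>y. y \<in> K \<Longrightarrow> norm (gU y) \<le> B"
      "\<And>y. y \<in> K \<Longrightarrow> norm (1 / height y) \<le> C"
    by (metis (no_types, lifting) bounded_iff compact_imp_bounded imageI)
  then show ?thesis
    by (intro exI[of _ "max 1 (max A (max B C))"]) (force simp: le_max_iff_disj)
qed

lemma psi_bound: "\<exists>C\<ge>0. \<forall>y\<in>K. \<bar>psi y\<bar> \<le> C \<and> (\<forall>h. \<bar>psi' y h\<bar> \<le> C * norm h)"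
proof -
  obtain M where M: "M \<ge> 1" "\<And>y. y \<in> K \<Longrightarrow> \<bar>U y\<bar> \<le> M" "\<And>y. y \<in> K \<Longrightarrow> norm (gU y) \<le> M"
      "\<And>y. y \<in> K \<Longrightarrow> 1 / height y \<le> M"
    using bound_on_K by auto
  have z: "0 < height y" if "y \<in> K" for y using height_facts(1)[of y] K(2) that by force
  define C where "C = p * M powr (p - 1) * M * M + M powr p * M ^ 3 + M powr p * M"
  have C: "0 \<le> C" using M(1) p by (simp add: C_def)
  show ?thesis
  proof (intro exI[of _ C] conjI ballI allI C)
    fix y h assume y: "y \<in> K"
    have Up: "\<bar>U y\<bar> powr p \<le> M powr p" "\<bar>U y\<bar> powr (p - 1) \<le> M powr (p - 1)"
      using M(2)[OF y] p by (auto intro: powr_mono2)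
    have "\<bar>psi y\<bar> = \<bar>U y\<bar> powr p * (1 / height y)" using z[OF y] by (simp add: psi_def)
    also have "\<dots> \<le> M powr p * M"
      using Up M(1,4) y z[OF y] by (intro mult_mono) auto
    also have "\<dots> \<le> C" using M(1) p by (simp add: C_def)
    finally show "\<bar>psi y\<bar> \<le> C" .
    have "\<bar>p * \<bar>U y\<bar> powr (p - 1) * sgn (U y) * (gU y \<bullet> h) / height y\<bar>
        = p * \<bar>U y\<bar> powr (p - 1) * \<bar>sgn (U y)\<bar> * \<bar>gU y \<bullet> h\<bar> * (1 / height y)"
      using z[OF y] p by (simp add: abs_mult)
    also have "\<dots> \<le> p * M powr (p - 1) * 1 * (M * norm h) * M"
    proof (intro mult_mono)
      have "\<bar>gU y \<bullet> h\<bar> \<le> norm (gU y) * norm h" by (rule Cauchy_Schwarz_ineq2)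
      also have "\<dots> \<le> M * norm h" using M(3)[OF y] by (intro mult_right_mono) auto
      finally show "\<bar>gU y \<bullet> h\<bar> \<le> M * norm h" .
      show "\<bar>sgn (U y)\<bar> \<le> 1" by (simp add: sgn_if)
    qed (use Up M(1) M(4)[OF y] p z[OF y] in auto)
    finally have 1: "\<bar>p * \<bar>U y\<bar> powr (p - 1) * sgn (U y) * (gU y \<bullet> h) / height y\<bar>
        \<le> p * M powr (p - 1) * M * M * norm h" by (simp add: ac_simps)
    have "\<bar>\<bar>U y\<bar> powr p * (y \<bullet> h) / height y ^ 3\<bar> = \<bar>U y\<bar> powr p * \<bar>y \<bullet> h\<bar> * (1 / height y) ^ 3"
      using z[OF y] by (simp add: abs_mult power_divide)
    also have "\<dots> \<le> M powr p * (1 * norm h) * M ^ 3"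
    proof (intro mult_mono power_mono)
      have "norm y \<le> 1" using K(2) y by force
      then have "norm y * norm h \<le> 1 * norm h" by (intro mult_right_mono) auto
      then show "\<bar>y \<bullet> h\<bar> \<le> 1 * norm h" using Cauchy_Schwarz_ineq2[of y h] by linarith
    qed (use Up M(1) M(4)[OF y] z[OF y] in auto)
    finally have 2: "\<bar>\<bar>U y\<bar> powr p * (y \<bullet> h) / height y ^ 3\<bar> \<le> M powr p * M ^ 3 * norm h"
      by (simp add: ac_simps)
    have "\<bar>psi' y h\<bar> \<le> p * M powr (p - 1) * M * M * norm h + M powr p * M ^ 3 * norm h"
      unfolding psi'_def using 1 2 by (meson abs_triangle_ineq add_mono order_trans)
    also have "\<dots> = (p * M powr (p - 1) * M * M + M powr p * M ^ 3) * norm h" by (simp add: distrib_right)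
    also have "\<dots> \<le> C * norm h" using M(1) by (intro mult_right_mono) (auto simp: C_def)
    finally show "\<bar>psi' y h\<bar> \<le> C * norm h" .
  qed
qed

lemma norm_V_le:
  assumes y: "y \<in> ball 0 1 - S"
  shows "norm (V y) \<le> Q y powr (p - 1)"
proof -
  note r = regular_point[OF y]
  have "norm (V y) = norm (v y) powr (p - 2) * norm (v y)" by (simp add: V_def)
  also have "\<dots> = norm (v y) powr (p - 1)"
    using powr_add[of "norm (v y)" "p - 2" 1] r(4) by simp
  also have "\<dots> \<le> Q y powr (p - 1)" using norm_v_le(1)[OF r(1-3)] p by (intro powr_mono2) auto
  finally show ?thesis .
qed

text \<open>
  The second summand of \<open>V'\<close> has the singular factor \<open>|v|^(p-4)\<close>, but \<open>v\<close> occurs in it twice more;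
  so it has the order \<open>|v|^(p-2)\<close> of the first one.
\<close>

lemma norm_V'_le: "\<exists>C\<ge>0. \<forall>y h. y \<in> ball 0 1 - S \<longrightarrow> norm (V' y h) \<le> C * Q y powr p * norm h / height y"
proof -
  obtain C where C: "C \<ge> 0" "\<And>y h. y \<in> ball 0 1 \<Longrightarrow> y \<noteq> fst a1 \<Longrightarrow> y \<noteq> fst a2 \<Longrightarrow>
     norm (v' y h) \<le> C * (Q y)\<^sup>2 * norm h / height y"
    using norm_v'_le by blast
  show ?thesis
  proof (intro exI[of _ "(p - 1) * C"] conjI allI impI)
    show "0 \<le> (p - 1) * C" using C(1) p by simp
    fix y h assume y: "y \<in> ball 0 1 - S"
    note r = regular_point[OF y]
    let ?n = "norm (v y)"
    have Q: "1 \<le> Q y" using Q_bounds(1)[OF r(1-3)] .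
    have e: "?n powr (p - 4) * (?n * ?n) = ?n powr (p - 2)"
      using powr_add[of ?n "p - 4" 2] r(4) by (simp add: powr_numeral power2_eq_square)
    have "norm (V' y h) \<le> norm (?n powr (p - 2) *\<^sub>R v' y h) + norm (((p - 2) * ?n powr (p - 4) * (v y \<bullet> v' y h)) *\<^sub>R v y)"
      unfolding V'_def by (rule norm_triangle_ineq)
    also have "\<dots> = ?n powr (p - 2) * norm (v' y h) + (p - 2) * ?n powr (p - 4) * \<bar>v y \<bullet> v' y h\<bar> * ?n"
      using p by (simp add: abs_mult)
    also have "\<dots> \<le> ?n powr (p - 2) * norm (v' y h) + (p - 2) * ?n powr (p - 4) * (?n * norm (v' y h)) * ?n"
      using p Cauchy_Schwarz_ineq2[of "v y" "v' y h"]
      by (intro add_left_mono mult_right_mono mult_left_mono) auto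
    also have "\<dots> = ?n powr (p - 2) * norm (v' y h) + (p - 2) * norm (v' y h) * (?n powr (p - 4) * (?n * ?n))"
      by (simp only: ac_simps)
    also have "\<dots> = (p - 1) * (?n powr (p - 2) * norm (v' y h))" unfolding e by (simp add: algebra_simps)
    also have "\<dots> \<le> (p - 1) * (Q y powr (p - 2) * (C * (Q y)\<^sup>2 * norm h / height y))"
      using p norm_v_le(1)[OF r(1-3)] C(2)[OF r(1-3)]
      by (intro mult_left_mono mult_mono powr_mono2) auto
    also have "\<dots> = (p - 1) * C * (Q y powr (p - 2) * Q y powr 2) * norm h / height y"
      using Q by (simp add: powr_numeral ac_simps)
    also have "Q y powr (p - 2) * Q y powr 2 = Q y powr p" by (simp flip: powr_add)
    finally show "norm (V' y h) \<le> (p - 1) * C * Q y powr p * norm h / height y" .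
  qed
qed

lemma F_D_bound: "\<exists>C. \<forall>i y. y \<notin> S \<longrightarrow> \<bar>F i y\<bar> \<le> C * sing y \<and> \<bar>D i y\<bar> \<le> C * sing y"
proof -
  obtain M where M: "M \<ge> 1" "\<And>y. y \<in> K \<Longrightarrow> 1 / height y \<le> M" using bound_on_K by auto
  obtain A where A: "A \<ge> 0" "\<And>y. y \<in> K \<Longrightarrow> \<bar>psi y\<bar> \<le> A" "\<And>y h. y \<in> K \<Longrightarrow> \<bar>psi' y h\<bar> \<le> A * norm h"
    using psi_bound by blast
  obtain B where B: "B \<ge> 0" "\<And>y h. y \<in> ball 0 1 - S \<Longrightarrow> norm (V' y h) \<le> B * Q y powr p * norm h / height y"
    using norm_V'_le by blast
  have comp: "\<bar>fst X $ i\<bar> \<le> norm X" for X :: "'n amb" and i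
    using component_le_norm_cart[of "fst X" i] norm_fst_le[of "fst X" "snd X"] by simp
  define C where "C = (B * M * A + A) * 2 powr p"
  show ?thesis
  proof (intro exI[of _ C] allI impI)
    fix i y assume yS: "y \<notin> S"
    show "\<bar>F i y\<bar> \<le> C * sing y \<and> \<bar>D i y\<bar> \<le> C * sing y"
    proof (cases "y \<in> K")
      case False
      have "0 \<le> C * sing y" using A(1) B(1) M(1) by (simp add: C_def sing_nonneg)
      then show ?thesis using off_K_zero[OF False] by simp
    next
      case True
      then have y: "y \<in> ball 0 1 - S" using K(2) yS by auto
      note r = regular_point[OF y]
      have z: "0 < height y" using height_facts(1)[OF r(1)] .
      have Vs: "\<bar>fst (V y) $ i\<bar> \<le> 2 powr p * sing y"
        using comp[where X = "V y" and i = i] norm_V_le[OF y] Q_bounds(2)[OF r(1-3), of "p - 1"] by linarith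
      have "\<bar>fst (V' y (axis i 1)) $ i\<bar> \<le> B * Q y powr p * (1 / height y)"
        using comp[where X = "V' y (axis i 1)" and i = i] B(2)[OF y, of "axis i 1"] by simp
      also have "\<dots> \<le> B * (2 powr p * sing y) * M"
        using B(1) M(2)[OF True] Q_bounds(2)[OF r(1-3), of p] z
        by (intro mult_mono mult_left_mono mult_nonneg_nonneg sing_nonneg) auto
      finally have V's: "\<bar>fst (V' y (axis i 1)) $ i\<bar> \<le> B * (2 powr p * sing y) * M" .
      have F: "\<bar>F i y\<bar> \<le> 2 powr p * sing y * A"
        unfolding F_def abs_mult using Vs A(2)[OF True] by (intro mult_mono) (auto simp: sing_nonneg)
      have "\<bar>D i y\<bar> \<le> \<bar>fst (V' y (axis i 1)) $ i\<bar> * \<bar>psi y\<bar> + \<bar>fst (V y) $ i\<bar> * \<bar>psi' y (axis i 1)\<bar>"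
        unfolding D_def abs_mult[symmetric] by (rule abs_triangle_ineq)
      also have "\<dots> \<le> B * (2 powr p * sing y) * M * A + 2 powr p * sing y * A"
        using V's Vs A(2)[OF True] A(3)[OF True, of "axis i 1"] B(1) M(1)
        by (intro add_mono mult_mono) (auto simp: sing_nonneg)
      also have "\<dots> = C * sing y" by (simp add: C_def algebra_simps)
      finally have D: "\<bar>D i y\<bar> \<le> C * sing y" .
      have "0 \<le> B * M * A * (2 powr p) * sing y" using A(1) B(1) M(1) by (simp add: sing_nonneg)
      then have "2 powr p * sing y * A \<le> C * sing y" by (simp add: C_def algebra_simps)
      with F D show ?thesis by linarith
    qed
  qed
qed

text \<open>
  Continuity off the finite exceptional set suffices, whatever the values on that set are. This takes
  care of the unspecified gradients of the distances at their poles.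
\<close>

lemma regular_measurable:
  fixes g :: "real ^ 'n \<Rightarrow> real"
  assumes "continuous_on (ball 0 1 - S) g"
  shows "(\<lambda>y. indicator (ball 0 1) y * g y) \<in> borel_measurable borel"
proof (rule measurable_discrete_difference[where X = S])
  show "(\<lambda>y. if y \<in> ball 0 1 - S then g y else 0) \<in> borel_measurable borel"
    using open_regular by (intro borel_measurable_continuous_on_if assms) auto
  show "countable S" using finite_S by (rule countable_finite)
qed (auto simp: indicator_def)

lemma F_integrable: "integrable lborel (F i)"
proof -
  obtain C where C: "\<And>i y. y \<notin> S \<Longrightarrow> \<bar>F i y\<bar> \<le> C * sing y" using F_D_bound by blast
  have "continuous_on (ball 0 1 - S) (F i)"
    unfolding F_def[abs_def]
    using continuous_on_regular(4) continuous_on_subset[OF continuous_on_regular(5), of "ball 0 1 - S"]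
    by (intro continuous_intros) auto
  from regular_measurable[OF this] have "(\<lambda>y. indicator (ball 0 1) y * F i y) \<in> borel_measurable borel" .
  moreover have "(\<lambda>y. indicator (ball 0 1) y * F i y) = F i"
  proof
    fix y show "indicator (ball 0 1) y * F i y = F i y"
    proof (cases "y \<in> ball 0 1")
      case False
      then have "y \<notin> K" using K(2) by blast
      then show ?thesis by (simp add: off_K_zero)
    qed simp
  qed
  ultimately have meas: "F i \<in> borel_measurable lborel" by simp
  show ?thesis
  proof (rule Bochner_Integration.integrable_bound[OF integrable_mult_right[OF integrable_sing, of C] meas])
    have "AE y in lborel. y \<notin> S" using finite_S by (intro AE_not_in finite_imp_null_set_lborel)
    then show "AE y in lborel. norm (F i y) \<le> norm (C * sing y)"
    proof eventually_elim
      case (elim y)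
      then show ?case using C[OF elim, of i] unfolding real_norm_def by linarith
    qed
  qed
qed

lemma D_integral: "integrable lborel (D i)" "(\<integral>y. D i y \<partial>lborel) = 0"
proof -
  obtain C where C: "\<And>i y. y \<notin> S \<Longrightarrow> \<bar>D i y\<bar> \<le> C * sing y" using F_D_bound by blast
  have dim2: "2 \<le> DIM(real ^ 'n)" using dim by simp
  show "integrable lborel (D i)" "(\<integral>y. D i y \<partial>lborel) = 0"
    using directional_derivative_integral_zero[OF dim2 finite_S F_integrable
      integrable_mult_right[OF integrable_sing, of C] F_derivative C] by auto
qed

text \<open>
  The left-hand side is the Riemannian divergence of \<open>|u|^p V\<close>. Both sums over partial derivatives are
  traces: one collapses because a tangent vector is the image of its horizontal part under the
  derivative of the chart, and the other one is \<open>log_grad'_chart_trace\<close>. The derivative of the volume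
  density in \<open>psi'\<close> supplies the second summand needed there.
\<close>

lemma divergence_identity:
  assumes y: "y \<in> ball 0 1 - S"
  shows "height y * (\<Sum>i\<in>UNIV. D i y)
    = \<bar>U y\<bar> powr p * (norm (v y) powr (p - 2)
          * (((real CARD('n) - 1) * (d a1 y * cot (d a1 y)) - 1) / (d a1 y)\<^sup>2
           + ((real CARD('n) - 1) * (d a2 y * cot (d a2 y)) - 1) / (d a2 y)\<^sup>2)
        + (p - 2) * norm (v y) powr (p - 4) * (v y \<bullet> (log_grad' a1 (graph_chart y) (v y) + log_grad' a2 (graph_chart y) (v y))))
      + p * \<bar>U y\<bar> powr (p - 1) * sgn (U y) * (gU y \<bullet> fst (V y))"
proof -
  note r = regular_point[OF y]
  have z: "0 < height y" "(height y)\<^sup>2 = 1 - (norm y)\<^sup>2" using height_facts[OF r(1)] by auto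
  let ?n = "norm (v y)"
  have lin: "linear (v' y)" using has_derivative_linear[OF has_derivative_v(3)[OF r(1-3)]] .
  have linpsi: "linear (psi' y)" using has_derivative_linear[OF has_derivative_psi[OF r(1)]] .
  have exp: "(\<Sum>i\<in>UNIV. (c $ i) *\<^sub>R f (axis i 1)) = f c" if "linear f" for f :: "real ^ 'n \<Rightarrow> 'b::real_vector" and c
    using basis_expansion[of c] linear_sum[OF that, of "\<lambda>i. c $ i *\<^sub>R axis i 1" UNIV]
    by (simp add: linear_cmul[OF that] scalar_mult_eq_scaleR)
  have s1: "(\<Sum>i\<in>UNIV. fst (V y) $ i * psi' y (axis i 1)) = psi' y (fst (V y))"
    using exp[OF linpsi, of "fst (V y)"] by simp
  have s2: "(\<Sum>i\<in>UNIV. (v y \<bullet> v' y (axis i 1)) * fst (v y) $ i) = v y \<bullet> v' y (fst (v y))"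
    unfolding exp[OF lin, of "fst (v y)", symmetric] by (simp add: inner_sum_right mult.commute)
  have "v' y (fst (v y)) = log_grad' a1 (graph_chart y) (v y) + log_grad' a2 (graph_chart y) (v y)"
    unfolding v'_def w'_def using chart_push_fst[OF r(1) graph_chart_w(2)[OF r(1)]] by simp
  note s2 = s2[unfolded this]
  have tr: "(\<Sum>i\<in>UNIV. fst (w' a y (axis i 1)) $ i) + (y \<bullet> fst (w a y)) / (height y)\<^sup>2
      = ((real CARD('n) - 1) * (d a y * cot (d a y)) - 1) / (d a y)\<^sup>2" if a: "a \<in> {a1, a2}" for a
  proof -
    have ya: "y \<noteq> fst a" using a r by auto
    note f = pole_facts[OF a r(1) ya]
    show ?thesis unfolding w'_def w_def d_def z(2) by (rule log_grad'_chart_trace[OF r(1) f(1,3,4)])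
  qed
  let ?T = "\<lambda>a. ((real CARD('n) - 1) * (d a y * cot (d a y)) - 1) / (d a y)\<^sup>2"
  have s3: "(\<Sum>i\<in>UNIV. fst (v' y (axis i 1)) $ i) + (y \<bullet> fst (v y)) / (height y)\<^sup>2 = ?T a1 + ?T a2"
    using tr[of a1] tr[of a2]
    by (simp add: v'_def v_def sum.distrib inner_add_right add_divide_distrib)
  have "(\<Sum>i\<in>UNIV. fst (V' y (axis i 1)) $ i)
      = ?n powr (p - 2) * (\<Sum>i\<in>UNIV. fst (v' y (axis i 1)) $ i)
        + (p - 2) * ?n powr (p - 4) * (\<Sum>i\<in>UNIV. (v y \<bullet> v' y (axis i 1)) * fst (v y) $ i)"
    by (simp add: V'_def sum.distrib sum_distrib_left mult.assoc)
  then have s4: "(\<Sum>i\<in>UNIV. fst (V' y (axis i 1)) $ i)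
      = ?n powr (p - 2) * (?T a1 + ?T a2 - (y \<bullet> fst (v y)) / (height y)\<^sup>2)
        + (p - 2) * ?n powr (p - 4) * (v y \<bullet> (log_grad' a1 (graph_chart y) (v y) + log_grad' a2 (graph_chart y) (v y)))"
    unfolding s2 s3[symmetric] by simp
  have "(\<Sum>i\<in>UNIV. D i y) = (\<Sum>i\<in>UNIV. fst (V' y (axis i 1)) $ i) * psi y + psi' y (fst (V y))"
    by (simp add: D_def sum.distrib sum_distrib_right s1)
  then have "height y * (\<Sum>i\<in>UNIV. D i y)
      = (\<Sum>i\<in>UNIV. fst (V' y (axis i 1)) $ i) * (height y * psi y) + height y * psi' y (fst (V y))"
    by (simp add: algebra_simps)
  also have "height y * psi y = \<bar>U y\<bar> powr p" using z(1) by (simp add: psi_def)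
  also have "height y * psi' y (fst (V y)) = p * \<bar>U y\<bar> powr (p - 1) * sgn (U y) * (gU y \<bullet> fst (V y))
      + \<bar>U y\<bar> powr p * (?n powr (p - 2) * ((y \<bullet> fst (v y)) / (height y)\<^sup>2))"
    using z(1) by (simp add: psi'_def V_def field_simps power3_eq_cube power2_eq_square)
  finally show ?thesis unfolding s4 by (simp add: algebra_simps)
qed

section \<open>The pointwise inequality and its integration\<close>

text \<open>
  The tangential gradient of the test function. The functions \<open>T1\<close>, \<open>T2\<close>, \<open>T3\<close> below are the three
  integrands of the weighted terms in the chart.
\<close>

definition "grad y = (gU y, 0) - (gU y \<bullet> y) *\<^sub>R graph_chart y"
definition "G y = (d a1 y *\<^sub>R w a1 y) \<bullet> (d a2 y *\<^sub>R w a2 y)"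
definition "T1 y = (norm (w a1 y - w a2 y))\<^sup>2 * norm (v y) powr (p - 2) * \<bar>U y\<bar> powr p"
definition "T2 y = norm (v y) powr (p - 2) * \<bar>U y\<bar> powr p"
definition "T3 y = (4 + c_const \<delta> * ((d a1 y)\<^sup>2 + (d a2 y)\<^sup>2))
    * ((1 - (G y)\<^sup>2) / ((d a1 y)\<^sup>2 * (d a2 y)\<^sup>2)) * norm (v y) powr (p - 4) * \<bar>U y\<bar> powr p"

lemma norm_unit:
  assumes a: "a \<in> {a1, a2}" and y: "y \<in> ball 0 1" "y \<noteq> fst a"
  shows "norm (d a y *\<^sub>R w a y) = 1"
  using norm_w_le(1)[OF a y] pole_facts(5)[OF a y] by simp

text \<open>
  Young's inequality absorbs the term with \<open>\<nabla>u\<close> from the divergence; in exchange it leaves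
  \<open>(N - p)/2 |v|^p |u|^p\<close>, which \<open>two_pole_algebra\<close> accounts for.
\<close>

lemma pointwise_inequality:
  assumes y: "y \<in> ball 0 1 - S"
  defines "N \<equiv> CARD('n)"
  shows "C1_2 N p * T1 y + (real N - 1) * C2_2 N p * c_const \<delta> * T2 y + (p - 2) * C2_2 N p * T3 y
      - norm (grad y) powr p \<le> C2_2 N p * (height y * (\<Sum>i\<in>UNIV. D i y))"
proof -
  note r = regular_point[OF y]
  have y1: "y \<noteq> fst a1" and y2: "y \<noteq> fst a2" using r by auto
  note f1 = pole_facts[OF insertI1 r(1) y1]
  have a2in: "a2 \<in> {a1, a2}" by simp
  note f2 = pole_facts[OF a2in r(1) y2]
  have p1: "1 < p" "p < real N" using p by (simp_all add: N_def)
  define \<kappa> where "\<kappa> = C2_2 N p"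
  define C where "C = (real N - p) / (2 * (p - 1))"
  have C: "0 < C" using p1 by (simp add: C_def)
  have \<kappa>: "\<kappa> = C powr (p - 1)" "C1_2 N p = (real N - p) / 2 * \<kappa>" "0 \<le> \<kappa>"
    using hardy_constants_eq[OF p1] by (simp_all add: \<kappa>_def C_def)
  let ?d1 = "d a1 y" and ?d2 = "d a2 y" and ?x = "graph_chart y" and ?n = "norm (v y)"
  let ?q1 = "?d1 * cot ?d1" and ?q2 = "?d2 * cot ?d2"
  let ?n1 = "?d1 *\<^sub>R w a1 y" and ?n2 = "?d2 *\<^sub>R w a2 y"
  have wn: "?n1 /\<^sub>R ?d1 = w a1 y" "?n2 /\<^sub>R ?d2 = w a2 y" using f1(5) f2(5) by simp_all
  have vw: "w a1 y + w a2 y = v y" by (simp add: v_def)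
  define L where "L = ?n powr (p - 2) * (((real N - 1) * ?q1 - 1) / ?d1\<^sup>2 + ((real N - 1) * ?q2 - 1) / ?d2\<^sup>2)
      + (p - 2) * ?n powr (p - 4)
        * ((?q1 / ?d1\<^sup>2 * (v y \<bullet> v y) - (1 + ?q1) / ?d1\<^sup>2 * (v y \<bullet> ?n1)\<^sup>2)
          + (?q2 / ?d2\<^sup>2 * (v y \<bullet> v y) - (1 + ?q2) / ?d2\<^sup>2 * (v y \<bullet> ?n2)\<^sup>2))"
  have alg: "(real N - p) / 2 * ((norm (w a1 y - w a2 y))\<^sup>2 * ?n powr (p - 2)) + (real N - 1) * c_const \<delta> * ?n powr (p - 2)
      + (p - 2) * ((4 + c_const \<delta> * (?d1\<^sup>2 + ?d2\<^sup>2)) * ((1 - (G y)\<^sup>2) / (?d1\<^sup>2 * ?d2\<^sup>2)) * ?n powr (p - 4))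
    \<le> L - (real N - p) / 2 * ?n powr p"
    using two_pole_algebra[of ?n1 ?n2 ?d1 ?d2 "c_const \<delta>" ?q1 ?q2 p "real N", unfolded wn vw]
      norm_unit[OF insertI1 r(1) y1] norm_unit[OF a2in r(1) y2] f1(5,8) f2(5,8) c_const_nonpos[OF delta_bounds]
      p dim r(4)
    unfolding L_def G_def N_def by simp
  have quad: "v y \<bullet> log_grad' a1 ?x (v y) = ?q1 / ?d1\<^sup>2 * (v y \<bullet> v y) - (1 + ?q1) / ?d1\<^sup>2 * (v y \<bullet> ?n1)\<^sup>2"
    "v y \<bullet> log_grad' a2 ?x (v y) = ?q2 / ?d2\<^sup>2 * (v y \<bullet> v y) - (1 + ?q2) / ?d2\<^sup>2 * (v y \<bullet> ?n2)\<^sup>2"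
    unfolding d_def w_def
    by (rule log_grad'_quadratic_form[OF f1(2,3,4) graph_chart_w(2)[OF r(1)]]
        log_grad'_quadratic_form[OF f2(2,3,4) graph_chart_w(2)[OF r(1)]])+
  define X where "X = p * \<bar>U y\<bar> powr (p - 1) * sgn (U y) * (gU y \<bullet> fst (V y))"
  have div: "height y * (\<Sum>i\<in>UNIV. D i y) = \<bar>U y\<bar> powr p * L + X"
    unfolding divergence_identity[OF y] L_def X_def inner_add_right quad N_def ..
  have "graph_chart y \<bullet> V y = 0" using graph_chart_w(2)[OF r(1)] by (simp add: V_def)
  then have "grad y \<bullet> V y = (gU y, 0) \<bullet> V y" by (simp add: grad_def inner_diff_left)
  then have "gU y \<bullet> fst (V y) = grad y \<bullet> V y" by (simp add: inner_prod_def)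
  then have "\<bar>gU y \<bullet> fst (V y)\<bar> \<le> norm (grad y) * norm (V y)" by (simp add: Cauchy_Schwarz_ineq2)
  also have "norm (V y) = ?n powr (p - 1)"
    using powr_add[of ?n "p - 2" 1] r(4) by (simp add: V_def)
  finally have gV: "\<bar>gU y \<bullet> fst (V y)\<bar> \<le> norm (grad y) * ?n powr (p - 1)" .
  have "\<bar>X\<bar> = p * \<bar>U y\<bar> powr (p - 1) * \<bar>sgn (U y)\<bar> * \<bar>gU y \<bullet> fst (V y)\<bar>"
    using p by (simp add: X_def abs_mult)
  also have "\<dots> \<le> p * \<bar>U y\<bar> powr (p - 1) * 1 * (norm (grad y) * ?n powr (p - 1))"
    using p gV by (intro mult_mono) (auto simp: sgn_if)
  finally have "\<kappa> * \<bar>X\<bar> \<le> \<kappa> * (p * \<bar>U y\<bar> powr (p - 1) * 1 * (norm (grad y) * ?n powr (p - 1)))"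
    using \<kappa>(3) by (intro mult_left_mono)
  also have "\<dots> = p * (norm (grad y) * (C * ?n * \<bar>U y\<bar>) powr (p - 1))"
    using C by (simp add: \<kappa>(1) powr_mult)
  also have "\<dots> \<le> norm (grad y) powr p + (p - 1) * (C * ?n * \<bar>U y\<bar>) powr p"
    using C p1 by (intro Young_powr) auto
  also have "(p - 1) * (C * ?n * \<bar>U y\<bar>) powr p = \<kappa> * ((real N - p) / 2 * ?n powr p * \<bar>U y\<bar> powr p)"
  proof -
    have "(p - 1) * C powr p = (p - 1) * C * C powr (p - 1)"
      using powr_add[of C "p - 1" 1] C by simp
    moreover have "(p - 1) * C = (real N - p) / 2"
    proof -
      have "m * (x / (2 * m)) = x / 2" if "m \<noteq> 0" for m x :: real using that by simp
      from this[of "p - 1" "real N - p"] p1 show ?thesis by (simp only: C_def)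
    qed
    ultimately have "(p - 1) * C powr p = (real N - p) / 2 * \<kappa>" by (simp add: \<kappa>(1))
    then show ?thesis using C by (simp add: powr_mult flip: mult.assoc)
  qed
  finally have "\<kappa> * \<bar>X\<bar> \<le> norm (grad y) powr p + \<kappa> * ((real N - p) / 2 * ?n powr p * \<bar>U y\<bar> powr p)" .
  moreover have "\<kappa> * (- X) \<le> \<kappa> * \<bar>X\<bar>" using \<kappa>(3) by (intro mult_left_mono) auto
  ultimately have young: "- \<kappa> * X \<le> norm (grad y) powr p + \<kappa> * ((real N - p) / 2 * ?n powr p * \<bar>U y\<bar> powr p)"
    by simp
  have "\<kappa> * \<bar>U y\<bar> powr p * ((real N - p) / 2 * ((norm (w a1 y - w a2 y))\<^sup>2 * ?n powr (p - 2)) + (real N - 1) * c_const \<delta> * ?n powr (p - 2)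
      + (p - 2) * ((4 + c_const \<delta> * (?d1\<^sup>2 + ?d2\<^sup>2)) * ((1 - (G y)\<^sup>2) / (?d1\<^sup>2 * ?d2\<^sup>2)) * ?n powr (p - 4)))
    \<le> \<kappa> * \<bar>U y\<bar> powr p * (L - (real N - p) / 2 * ?n powr p)"
    using \<kappa>(3) by (intro mult_left_mono alg) simp
  moreover have "\<kappa> * \<bar>U y\<bar> powr p * ((real N - p) / 2 * ((norm (w a1 y - w a2 y))\<^sup>2 * ?n powr (p - 2)) + (real N - 1) * c_const \<delta> * ?n powr (p - 2)
      + (p - 2) * ((4 + c_const \<delta> * (?d1\<^sup>2 + ?d2\<^sup>2)) * ((1 - (G y)\<^sup>2) / (?d1\<^sup>2 * ?d2\<^sup>2)) * ?n powr (p - 4)))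
    = C1_2 N p * T1 y + (real N - 1) * \<kappa> * c_const \<delta> * T2 y + (p - 2) * \<kappa> * T3 y"
    unfolding \<kappa>(2) T1_def T2_def T3_def by (simp only: distrib_left ac_simps)
  ultimately show ?thesis
    using young unfolding div \<kappa>_def[symmetric] by (simp add: algebra_simps)
qed

text \<open>
  The integrand in the chart only has to be known off the exceptional set. Integrability is part of the
  claim, since the integral of a nonintegrable function would be 0 by convention.
\<close>

lemma hemisphere_integral_regular:
  fixes f :: "'n amb \<Rightarrow> real" and g :: "real ^ 'n \<Rightarrow> real"
  assumes cont: "continuous_on (ball 0 1 - S) g"
    and eq: "\<And>y. y \<in> ball 0 1 - S \<Longrightarrow> f (graph_chart y) = g y"
    and bound: "\<And>y. y \<in> ball 0 1 - S \<Longrightarrow> y \<in> K \<Longrightarrow> \<bar>g y\<bar> \<le> C * sing y"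
    and zero: "\<And>y. y \<notin> K \<Longrightarrow> g y = 0"
  shows "integrable lborel (\<lambda>y. indicator (ball 0 1) y * (g y / height y))"
    "(LINT x:upper_hemisphere|hemisphere_vol. f x)
      = (\<integral>y. indicator (ball 0 1) y * (g y / height y) \<partial>lborel)"
proof -
  have cS: "countable S" using finite_S by (rule countable_finite)
  have "(\<lambda>y. indicator (ball 0 1) y * f (graph_chart y)) \<in> borel_measurable borel"
    by (rule measurable_discrete_difference[OF regular_measurable[OF cont] cS])
      (auto simp: indicator_def eq)
  from hemisphere_integral_chart[OF this]
  have "(LINT x:upper_hemisphere|hemisphere_vol. f x)
      = (\<integral>y. indicator (ball 0 1) y * (f (graph_chart y) / height y) \<partial>lborel)"
    by (simp add: height_def)
  also have "\<dots> = (\<integral>y. indicator (ball 0 1) y * (g y / height y) \<partial>lborel)"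
    by (rule integral_discrete_difference[OF cS]) (auto simp: indicator_def eq)
  finally show "(LINT x:upper_hemisphere|hemisphere_vol. f x)
      = (\<integral>y. indicator (ball 0 1) y * (g y / height y) \<partial>lborel)" .
  obtain M where M: "M \<ge> 1" "\<And>y. y \<in> K \<Longrightarrow> 1 / height y \<le> M" using bound_on_K by auto
  have "continuous_on (ball 0 1 - S) (\<lambda>y. g y / height y)"
    using height_facts(1) by (intro continuous_intros cont continuous_on_regular) force
  from regular_measurable[OF this]
  have meas: "(\<lambda>y. indicator (ball 0 1) y * (g y / height y)) \<in> borel_measurable lborel" by simp
  show "integrable lborel (\<lambda>y. indicator (ball 0 1) y * (g y / height y))"
  proof (rule Bochner_Integration.integrable_bound[OF integrable_mult_right[OF integrable_sing, of "C * M"] meas])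
    have "AE y in lborel. y \<notin> S" using finite_S by (intro AE_not_in finite_imp_null_set_lborel)
    then show "AE y in lborel. norm (indicator (ball 0 1) y * (g y / height y)) \<le> norm (C * M * sing y)"
    proof eventually_elim
      case (elim y)
      show ?case
      proof (cases "y \<in> K")
        case True
        then have y: "y \<in> ball 0 1 - S" using elim K(2) by auto
        have z: "0 < height y" using height_facts(1) y by auto
        have "\<bar>g y\<bar> * (1 / height y) \<le> (C * sing y) * M"
          using bound[OF y True] M(2)[OF True] z by (intro mult_mono) auto
        also have "(C * sing y) * M = C * M * sing y" by (simp only: ac_simps)
        finally have "\<bar>g y\<bar> * (1 / height y) \<le> \<bar>C * M * sing y\<bar>" by linarith
        moreover have "\<bar>indicator (ball 0 1) y * (g y / height y)\<bar> = \<bar>g y\<bar> * (1 / height y)"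
          using y z by (simp add: abs_mult)
        ultimately show ?thesis unfolding real_norm_def by (simp only:)
      qed (simp add: zero)
    qed
  qed
qed

text \<open>
  Only \<open>T3\<close> needs care, for \<open>|v|^(p-4)\<close> is singular at the midpoint of the poles when \<open>p < 4\<close>. There
  \<open>(1 - G\<^sup>2) / d\<^sub>2\<^sup>2 = |v|\<^sup>2 - (v \<bullet> \<nabla>d\<^sub>1)\<^sup>2\<close> is at most \<open>|v|\<^sup>2\<close> and restores the order \<open>|v|^(p-2)\<close>.
\<close>

lemma T_bounds: "\<exists>C. \<forall>y. y \<in> ball 0 1 - S \<longrightarrow> y \<in> K \<longrightarrow>
   norm (grad y) powr p \<le> C * sing y \<and> \<bar>T1 y\<bar> \<le> C * sing y \<and> \<bar>T2 y\<bar> \<le> C * sing y \<and> \<bar>T3 y\<bar> \<le> C * sing y"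
proof -
  obtain M where M: "M \<ge> 1" "\<And>y. y \<in> K \<Longrightarrow> \<bar>U y\<bar> \<le> M" "\<And>y. y \<in> K \<Longrightarrow> norm (gU y) \<le> M"
    using bound_on_K by auto
  define A where "A = (2 * M) powr p * (4 + 2 * \<bar>c_const \<delta>\<bar> * pi\<^sup>2)"
  have c1: "1 \<le> 4 + 2 * \<bar>c_const \<delta>\<bar> * pi\<^sup>2" by simp
  have A1: "(2 * M) powr p \<le> A" "0 \<le> A" using mult_left_mono[OF c1, of "(2 * M) powr p"] by (simp_all add: A_def)
  have MA: "M powr p \<le> A" using powr_mono2[of p M "2 * M"] p M(1) A1 by simp
  show ?thesis
  proof (intro exI[of _ "A * 2 powr p"] allI impI)
    fix y assume y: "y \<in> ball 0 1 - S" and yK: "y \<in> K"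
    note r = regular_point[OF y]
    have y1: "y \<noteq> fst a1" and y2: "y \<noteq> fst a2" using r by auto
    note f1 = pole_facts[OF insertI1 r(1) y1]
    have a2in: "a2 \<in> {a1, a2}" by simp
    note f2 = pole_facts[OF a2in r(1) y2]
    let ?n = "norm (v y)" and ?d1 = "d a1 y" and ?d2 = "d a2 y"
    have n: "0 < ?n" using r by simp
    have Q: "1 \<le> Q y" using Q_bounds(1)[OF r(1-3)] .
    have *: "X \<le> A * 2 powr p * sing y" if "X \<le> A * Q y powr s" "s \<le> p" for X s
    proof -
      have "A * Q y powr s \<le> A * (2 powr p * sing y)"
        using Q_bounds(2)[OF r(1-3) that(2)] A1 by (intro mult_left_mono) auto
      then show ?thesis using that by (simp add: mult.assoc)
    qed
    have Up: "\<bar>U y\<bar> powr p \<le> M powr p" using M(2)[OF yK] p by (intro powr_mono2) auto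
    have nQ: "?n powr (p - 2) \<le> Q y powr (p - 2)" using norm_v_le(1)[OF r(1-3)] p by (intro powr_mono2) auto
    have Qp: "(Q y)\<^sup>2 * Q y powr (p - 2) = Q y powr p"
      using powr_add[of "Q y" "p - 2" 2] Q by (simp add: powr_numeral mult.commute)
    have "norm (grad y) \<le> norm (gU y) + \<bar>gU y \<bullet> y\<bar> * norm (graph_chart y)"
      unfolding grad_def using norm_triangle_ineq4[of "(gU y, 0)" "(gU y \<bullet> y) *\<^sub>R graph_chart y"]
      by (simp add: norm_Pair)
    also have "\<dots> \<le> norm (gU y) + norm (gU y) * 1"
    proof -
      have "norm (gU y) * norm y \<le> norm (gU y) * 1" using r(1) by (intro mult_left_mono) auto
      then show ?thesis using Cauchy_Schwarz_ineq2[of "gU y" y] f1(2) by simp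
    qed
    also have "\<dots> \<le> 2 * M" using M(3)[OF yK] by simp
    finally have "norm (grad y) powr p \<le> (2 * M) powr p" using p by (intro powr_mono2) auto
    \<comment> \<open>a constant is dominated as well, because \<open>Q \<ge> 1\<close>\<close>
    then have "norm (grad y) powr p \<le> A * Q y powr 0" using A1 Q by simp
    then have E: "norm (grad y) powr p \<le> A * 2 powr p * sing y" using p by (intro *[of _ 0]) auto
    have "\<bar>T2 y\<bar> \<le> Q y powr (p - 2) * M powr p"
      unfolding T2_def abs_mult using nQ Up by (intro mult_mono) auto
    also have "\<dots> \<le> A * Q y powr (p - 2)" using MA by (simp add: mult.commute mult_right_mono)
    finally have t2: "\<bar>T2 y\<bar> \<le> A * 2 powr p * sing y" by (intro *) auto
    have "\<bar>T1 y\<bar> = (norm (w a1 y - w a2 y))\<^sup>2 * ?n powr (p - 2) * \<bar>U y\<bar> powr p"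
      by (simp add: T1_def abs_mult)
    also have "\<dots> \<le> (Q y)\<^sup>2 * Q y powr (p - 2) * M powr p"
      using nQ Up norm_v_le(2)[OF r(1-3)] by (intro mult_mono power_mono) auto
    also have "\<dots> \<le> A * Q y powr p" unfolding Qp using MA by (simp add: mult.commute mult_right_mono)
    finally have t1: "\<bar>T1 y\<bar> \<le> A * 2 powr p * sing y" by (intro *) auto
    have G0: "0 \<le> 1 - (G y)\<^sup>2"
      using Cauchy_Schwarz_ineq2[of "?d1 *\<^sub>R w a1 y" "?d2 *\<^sub>R w a2 y"]
        norm_unit[OF insertI1 r(1) y1] norm_unit[OF a2in r(1) y2]
      by (simp add: G_def abs_square_le_1)
    have "(1 - (G y)\<^sup>2) / ?d2\<^sup>2 = ?n\<^sup>2 - (v y \<bullet> (?d1 *\<^sub>R w a1 y))\<^sup>2"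
    proof -
      define n1 where "n1 = ?d1 *\<^sub>R w a1 y"
      define n2 where "n2 = ?d2 *\<^sub>R w a2 y"
      have "norm n1 = 1" "norm n2 = 1"
        unfolding n1_def n2_def by (rule norm_unit[OF insertI1 r(1) y1] norm_unit[OF a2in r(1) y2])+
      then have nn: "n1 \<bullet> n1 = 1" "n2 \<bullet> n2 = 1" "n1 \<bullet> n2 = G y" "n2 \<bullet> n1 = G y"
        unfolding norm_eq_1 G_def n1_def[symmetric] n2_def[symmetric] by (simp_all add: inner_commute)
      have v: "v y = (1 / ?d1) *\<^sub>R n1 + (1 / ?d2) *\<^sub>R n2"
        using f1(5) f2(5) by (simp add: v_def n1_def n2_def)
      show ?thesis
        unfolding n1_def[symmetric] power2_norm_eq_inner v
        using f1(5) f2(5)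
        by (simp add: inner_add_left inner_add_right nn power2_eq_square field_simps)
    qed
    also have "\<dots> \<le> ?n\<^sup>2" by simp
    finally have g1: "(1 - (G y)\<^sup>2) / ?d2\<^sup>2 \<le> ?n\<^sup>2" .
    have "(1 - (G y)\<^sup>2) / (?d1\<^sup>2 * ?d2\<^sup>2) = (1 / ?d1)\<^sup>2 * ((1 - (G y)\<^sup>2) / ?d2\<^sup>2)"
      by (simp add: power_divide)
    also have "\<dots> \<le> (Q y)\<^sup>2 * ?n\<^sup>2"
    proof (intro mult_mono power_mono g1)
      have "0 \<le> 1 / norm (y - fst a2)" by simp
      then show "1 / ?d1 \<le> Q y" using f1(7) unfolding Q_def by linarith
      show "0 \<le> (1 - (G y)\<^sup>2) / ?d2\<^sup>2" using G0 by (intro divide_nonneg_nonneg) auto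
    qed (use f1(5) in auto)
    finally have g2: "(1 - (G y)\<^sup>2) / (?d1\<^sup>2 * ?d2\<^sup>2) \<le> (Q y)\<^sup>2 * ?n\<^sup>2" .
    have g0: "0 \<le> (1 - (G y)\<^sup>2) / (?d1\<^sup>2 * ?d2\<^sup>2)" using G0 by (intro divide_nonneg_nonneg) auto
    have "\<bar>T3 y\<bar> = \<bar>4 + c_const \<delta> * (?d1\<^sup>2 + ?d2\<^sup>2)\<bar> * ((1 - (G y)\<^sup>2) / (?d1\<^sup>2 * ?d2\<^sup>2)) * ?n powr (p - 4) * \<bar>U y\<bar> powr p"
      unfolding T3_def abs_mult abs_of_nonneg[OF g0] by simp
    also have "\<dots> \<le> (4 + 2 * \<bar>c_const \<delta>\<bar> * pi\<^sup>2) * ((Q y)\<^sup>2 * ?n\<^sup>2) * ?n powr (p - 4) * M powr p"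
    proof (intro mult_mono g2 Up mult_nonneg_nonneg g0)
      have "?d1\<^sup>2 \<le> pi\<^sup>2" "?d2\<^sup>2 \<le> pi\<^sup>2" using f1(5,6) f2(5,6) by (auto intro!: power_mono)
      then have "\<bar>c_const \<delta>\<bar> * (?d1\<^sup>2 + ?d2\<^sup>2) \<le> \<bar>c_const \<delta>\<bar> * (2 * pi\<^sup>2)" by (intro mult_left_mono) auto
      then show "\<bar>4 + c_const \<delta> * (?d1\<^sup>2 + ?d2\<^sup>2)\<bar> \<le> 4 + 2 * \<bar>c_const \<delta>\<bar> * pi\<^sup>2"
        using abs_triangle_ineq[of 4 "c_const \<delta> * (?d1\<^sup>2 + ?d2\<^sup>2)"] by (simp add: abs_mult)
    qed auto
    also have "\<dots> = (4 + 2 * \<bar>c_const \<delta>\<bar> * pi\<^sup>2) * M powr p * ((Q y)\<^sup>2 * (?n powr (p - 4) * ?n\<^sup>2))"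
      by (simp only: ac_simps)
    also have "\<dots> = (4 + 2 * \<bar>c_const \<delta>\<bar> * pi\<^sup>2) * M powr p * ((Q y)\<^sup>2 * ?n powr (p - 2))"
      by (simp only: powr_split_two[OF n])
    also have "\<dots> \<le> A * ((Q y)\<^sup>2 * Q y powr (p - 2))"
    proof (intro mult_mono nQ order_refl)
      have "M powr p \<le> (2 * M) powr p" using M(1) p by (intro powr_mono2) auto
      then show "(4 + 2 * \<bar>c_const \<delta>\<bar> * pi\<^sup>2) * M powr p \<le> A"
        unfolding A_def mult.commute[of "(2 * M) powr p"] by (intro mult_left_mono) auto
    qed (use A1 in auto)
    finally have t3: "\<bar>T3 y\<bar> \<le> A * 2 powr p * sing y" unfolding Qp by (intro *) auto
    show "norm (grad y) powr p \<le> A * 2 powr p * sing y \<and> \<bar>T1 y\<bar> \<le> A * 2 powr p * sing y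
        \<and> \<bar>T2 y\<bar> \<le> A * 2 powr p * sing y \<and> \<bar>T3 y\<bar> \<le> A * 2 powr p * sing y"
      using E t1 t2 t3 by blast
  qed
qed

lemma T_continuous:
  "continuous_on (ball 0 1 - S) (\<lambda>y. norm (grad y) powr p)"
  "continuous_on (ball 0 1 - S) T1" "continuous_on (ball 0 1 - S) T2" "continuous_on (ball 0 1 - S) T3"
proof -
  note r = regular_point
  have cU: "continuous_on (ball 0 1 - S) U" "continuous_on (ball 0 1 - S) gU"
    using continuous_on_regular(7) gU continuous_on_subset by blast+
  have Up: "continuous_on (ball 0 1 - S) (\<lambda>y. \<bar>U y\<bar> powr p)"
    using p by (intro continuous_on_powr' continuous_intros cU) auto
  have vp: "continuous_on (ball 0 1 - S) (\<lambda>y. norm (v y) powr s)" for s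
    using r(4) by (intro continuous_on_powr' continuous_intros continuous_on_regular) auto
  have cd: "continuous_on (ball 0 1 - S) (d a)" "\<And>y. y \<in> ball 0 1 - S \<Longrightarrow> d a y \<noteq> 0" if a: "a \<in> {a1, a2}" for a
  proof -
    have f: "- 1 < graph_chart y \<bullet> a" "graph_chart y \<bullet> a < 1" "d a y \<noteq> 0" if "y \<in> ball 0 1 - S" for y
      using pole_facts(3,4,5)[OF a r(1)[OF that]] r(2,3)[OF that] a by auto
    show "continuous_on (ball 0 1 - S) (d a)"
      unfolding d_def[abs_def]
    proof (intro continuous_intros ballI)
      fix y assume "y \<in> ball 0 1 - S"
      from f(1,2)[OF this] show "- 1 \<le> graph_chart y \<bullet> a \<and> graph_chart y \<bullet> a \<le> 1" by simp
    qed
    show "\<And>y. y \<in> ball 0 1 - S \<Longrightarrow> d a y \<noteq> 0" by (rule f(3))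
  qed
  have d1: "continuous_on (ball 0 1 - S) (d a1)" "\<And>y. y \<in> ball 0 1 - S \<Longrightarrow> d a1 y \<noteq> 0"
    and d2: "continuous_on (ball 0 1 - S) (d a2)" "\<And>y. y \<in> ball 0 1 - S \<Longrightarrow> d a2 y \<noteq> 0"
    using cd[of a1] cd[of a2] by auto
  have cG: "continuous_on (ball 0 1 - S) G"
    unfolding G_def[abs_def] by (intro continuous_intros d1 d2 continuous_on_regular)
  show "continuous_on (ball 0 1 - S) T1"
    unfolding T1_def[abs_def] by (intro continuous_intros Up vp continuous_on_regular)
  show "continuous_on (ball 0 1 - S) T2"
    unfolding T2_def[abs_def] by (intro continuous_intros Up vp)
  show "continuous_on (ball 0 1 - S) T3"
    unfolding T3_def[abs_def] using d1(2) d2(2) by (intro continuous_intros Up vp d1(1) d2(1) cG) auto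
  have "continuous_on (ball 0 1 - S) grad"
    unfolding grad_def[abs_def] by (intro continuous_intros cU)
  then show "continuous_on (ball 0 1 - S) (\<lambda>y. norm (grad y) powr p)"
    using p by (intro continuous_on_powr' continuous_intros) auto
qed

lemma T_off_K:
  assumes "y \<notin> K"
  shows "norm (grad y) powr p = 0" "T1 y = 0" "T2 y = 0" "T3 y = 0"
  using off_K[OF assms] by (simp_all add: grad_def T1_def T2_def T3_def)

text \<open>
  The integrands enter through their values at regular points only, so that they can be instantiated
  with expressions that are unspecified at the poles.
\<close>

lemma hemisphere_inequality:
  fixes f0 f1 f2 f3 :: "'n amb \<Rightarrow> real"
  defines "N \<equiv> CARD('n)"
  assumes f0: "\<And>y. y \<in> ball 0 1 - S \<Longrightarrow> f0 (graph_chart y) = norm (grad y) powr p"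
    and f1: "\<And>y. y \<in> ball 0 1 - S \<Longrightarrow> f1 (graph_chart y) = T1 y"
    and f2: "\<And>y. y \<in> ball 0 1 - S \<Longrightarrow> f2 (graph_chart y) = T2 y"
    and f3: "\<And>y. y \<in> ball 0 1 - S \<Longrightarrow> f3 (graph_chart y) = T3 y"
  shows "C1_2 N p * (LINT x:upper_hemisphere|hemisphere_vol. f1 x)
      + (real N - 1) * C2_2 N p * c_const \<delta> * (LINT x:upper_hemisphere|hemisphere_vol. f2 x)
      + (p - 2) * C2_2 N p * (LINT x:upper_hemisphere|hemisphere_vol. f3 x)
    \<le> (LINT x:upper_hemisphere|hemisphere_vol. f0 x)"
proof -
  obtain C where C: "\<And>y. y \<in> ball 0 1 - S \<Longrightarrow> y \<in> K \<Longrightarrow> norm (grad y) powr p \<le> C * sing y"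
    "\<And>y. y \<in> ball 0 1 - S \<Longrightarrow> y \<in> K \<Longrightarrow> \<bar>T1 y\<bar> \<le> C * sing y"
    "\<And>y. y \<in> ball 0 1 - S \<Longrightarrow> y \<in> K \<Longrightarrow> \<bar>T2 y\<bar> \<le> C * sing y"
    "\<And>y. y \<in> ball 0 1 - S \<Longrightarrow> y \<in> K \<Longrightarrow> \<bar>T3 y\<bar> \<le> C * sing y"
    using T_bounds by blast
  define I where "I = (\<lambda>g y. indicator (ball 0 1) y * (g y / height y) :: real)"
  have C0: "\<bar>norm (grad y) powr p\<bar> \<le> C * sing y" if "y \<in> ball 0 1 - S" "y \<in> K" for y
    using C(1)[OF that] by simp
  note i0 = hemisphere_integral_regular[OF T_continuous(1) f0 C0 T_off_K(1), folded I_def]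
  note i1 = hemisphere_integral_regular[OF T_continuous(2) f1 C(2) T_off_K(2), folded I_def]
  note i2 = hemisphere_integral_regular[OF T_continuous(3) f2 C(3) T_off_K(3), folded I_def]
  note i3 = hemisphere_integral_regular[OF T_continuous(4) f3 C(4) T_off_K(4), folded I_def]
  define k where "k = C2_2 N p"
  define b1 where "b1 = C1_2 N p"
  define b2 where "b2 = (real N - 1) * k * c_const \<delta>"
  define b3 where "b3 = (p - 2) * k"
  have I: "integrable lborel (I (\<lambda>y. norm (grad y) powr p))" "integrable lborel (I T1)"
    "integrable lborel (I T2)" "integrable lborel (I T3)"
    using i0(1) i1(1) i2(1) i3(1) by (simp_all add: I_def)
  have "(\<integral>y. b1 * I T1 y + b2 * I T2 y + b3 * I T3 y - I (\<lambda>y. norm (grad y) powr p) y \<partial>lborel)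
      \<le> (\<integral>y. k * (\<Sum>i\<in>UNIV. D i y) \<partial>lborel)"
  proof (rule integral_mono_AE)
    have "AE y in lborel. y \<notin> S" using finite_S by (intro AE_not_in finite_imp_null_set_lborel)
    then show "AE y in lborel. b1 * I T1 y + b2 * I T2 y + b3 * I T3 y - I (\<lambda>y. norm (grad y) powr p) y
        \<le> k * (\<Sum>i\<in>UNIV. D i y)"
    proof eventually_elim
      case (elim y)
      show ?case
      proof (cases "y \<in> ball 0 1")
        case True
        then have y: "y \<in> ball 0 1 - S" using elim by simp
        have z: "0 < height y" using height_facts(1)[OF True] .
        have "(b1 * T1 y + b2 * T2 y + b3 * T3 y - norm (grad y) powr p) / height y
            \<le> k * (height y * (\<Sum>i\<in>UNIV. D i y)) / height y"
          using pointwise_inequality[OF y] z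
          unfolding b1_def b2_def b3_def k_def N_def by (intro divide_right_mono) auto
        also have "\<dots> = k * (\<Sum>i\<in>UNIV. D i y)" using z by simp
        finally show ?thesis using True by (simp add: I_def diff_divide_distrib add_divide_distrib)
      next
        case False
        then have "y \<notin> K" using K(2) by blast
        then show ?thesis using False by (simp add: I_def off_K_zero)
      qed
    qed
    show "integrable lborel (\<lambda>y. k * (\<Sum>i\<in>UNIV. D i y))"
      by (intro integrable_mult_right Bochner_Integration.integrable_sum D_integral)
    show "integrable lborel (\<lambda>y. b1 * I T1 y + b2 * I T2 y + b3 * I T3 y - I (\<lambda>y. norm (grad y) powr p) y)"
      by (intro Bochner_Integration.integrable_diff Bochner_Integration.integrable_add integrable_mult_right I)
  qed
  also have "\<dots> = 0"
    by (simp add: Bochner_Integration.integral_sum D_integral)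
  finally have "b1 * (\<integral>y. I T1 y \<partial>lborel) + b2 * (\<integral>y. I T2 y \<partial>lborel) + b3 * (\<integral>y. I T3 y \<partial>lborel)
      - (\<integral>y. I (\<lambda>y. norm (grad y) powr p) y \<partial>lborel) \<le> 0"
    using I by simp
  then show ?thesis
    using i0(2) i1(2) i2(2) i3(2) by (simp add: I_def b1_def b2_def b3_def k_def)
qed

end

section \<open>Test functions in the chart\<close>

text \<open>
  The support is compact in the open hemisphere, so its image in the chart is compact in the open
  ball, and extension by zero preserves continuous differentiability.
\<close>

lemma test_function_chart:
  fixes u :: "'n::finite amb \<Rightarrow> real"
  assumes u: "u \<in> test_functions"
  obtains U gU K where "compact K" "K \<subseteq> ball 0 1"
    "\<And>y. (U has_derivative (\<lambda>h. gU y \<bullet> h)) (at y)" "continuous_on UNIV gU"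
    "\<And>y. y \<notin> K \<Longrightarrow> U y = 0" "\<And>y. y \<notin> K \<Longrightarrow> gU y = 0"
    "\<And>y. y \<in> ball 0 1 \<Longrightarrow> u (graph_chart y) = U y"
proof -
  define Z where "Z = closure (support_on upper_hemisphere u)"
  define K where "K = fst ` Z"
  define U where "U = (\<lambda>y. if y \<in> ball 0 1 then u (graph_chart y) else 0)"
  define u0 where "u0 = u \<circ> graph_chart"
  define gU where "gU = (\<lambda>y. if y \<in> ball 0 1 then \<Sum>b\<in>Basis. frechet_derivative u0 (at y) b *\<^sub>R b else 0)"
  have Ck: "Ck_on k (ball 0 1) u0" and Z: "compact Z" "Z \<subseteq> upper_hemisphere" for k
    using u by (auto simp: test_functions_def Z_def u0_def)
  have K: "compact K" unfolding K_def by (intro compact_continuous_image continuous_intros Z)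
  have Kb: "K \<subseteq> ball 0 1" unfolding K_def using Z(2) hemisphere_graph_chart(1) by blast
  have zero: "U y = 0" if "y \<notin> K" for y
  proof (rule ccontr)
    assume nz: "U y \<noteq> 0"
    then have y: "y \<in> ball 0 1" "u (graph_chart y) \<noteq> 0" by (auto simp: U_def split: if_splits)
    then have "graph_chart y \<in> support_on upper_hemisphere u"
      using graph_chart_hemisphere(1) by (simp add: support_on_def)
    then have "graph_chart y \<in> Z" unfolding Z_def using closure_subset by blast
    then have "fst (graph_chart y) \<in> K" unfolding K_def by (rule imageI)
    then show False using that by (simp add: graph_chart_hemisphere(2))
  qed
  have in_ball: "(U has_derivative (\<lambda>h. gU y \<bullet> h)) (at y)" if y: "y \<in> ball 0 1" for y
  proof -
    have "u0 differentiable (at y)" using Ck[of "Suc 0"] y by simp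
    then have D: "(u0 has_derivative frechet_derivative u0 (at y)) (at y)"
      by (simp add: frechet_derivative_works)
    have "frechet_derivative u0 (at y) h = gU y \<bullet> h" for h
    proof -
      have "frechet_derivative u0 (at y) h = frechet_derivative u0 (at y) (\<Sum>b\<in>Basis. (h \<bullet> b) *\<^sub>R b)"
        by (simp add: euclidean_representation)
      also have "\<dots> = (\<Sum>b\<in>Basis. (h \<bullet> b) * frechet_derivative u0 (at y) b)"
        using has_derivative_linear[OF D] by (simp add: linear_sum linear_cmul)
      also have "\<dots> = gU y \<bullet> h"
        using y by (simp add: gU_def inner_sum_left inner_commute[of h] mult.commute)
      finally show ?thesis .
    qed
    then have "frechet_derivative u0 (at y) = (\<lambda>h. gU y \<bullet> h)" by (rule ext)
    with D have "(u0 has_derivative (\<lambda>h. gU y \<bullet> h)) (at y)" by simp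
    then show ?thesis
      by (rule has_derivative_transform_within_open[where s = "ball 0 1"])
        (use y in \<open>auto simp: U_def u0_def\<close>)
  qed
  have openK: "open (- K)" using K by (simp add: compact_imp_closed open_Compl)
  have out: "(U has_derivative (\<lambda>h. 0)) (at y)" if y: "y \<notin> K" for y
  proof -
    have "((\<lambda>y. 0) has_derivative (\<lambda>h. 0)) (at y)" by simp
    then show ?thesis
      by (rule has_derivative_transform_within_open[where s = "- K"]) (use y zero openK in auto)
  qed
  have gzero: "gU y = 0" if y: "y \<notin> K" for y
  proof (cases "y \<in> ball 0 1")
    case True
    have "(\<lambda>h. gU y \<bullet> h) = (\<lambda>h. 0)"
      by (rule has_derivative_unique[OF in_ball[OF True] out[OF y]])
    from fun_cong[OF this, of "gU y"] show ?thesis by simp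
  qed (simp add: gU_def)
  have deriv: "(U has_derivative (\<lambda>h. gU y \<bullet> h)) (at y)" for y
  proof (cases "y \<in> K")
    case True
    then show ?thesis using Kb by (intro in_ball) auto
  next
    case False
    then show ?thesis using out gzero by simp
  qed
  have cont: "continuous_on UNIV gU"
  proof -
    have "continuous_on (ball 0 1) (\<lambda>y. \<Sum>b\<in>Basis. frechet_derivative u0 (at y) b *\<^sub>R b)"
      using Ck[of "Suc 0"] by (intro continuous_intros) auto
    then have 1: "continuous_on (ball 0 1) gU"
      by (rule continuous_on_eq) (simp add: gU_def)
    have "continuous_on (- K) (\<lambda>y. 0 :: real ^ 'n)" by simp
    then have 2: "continuous_on (- K) gU"
      by (rule continuous_on_eq) (simp add: gzero)
    have "continuous_on (ball 0 1 \<union> - K) gU"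
      by (rule continuous_on_open_Un[OF open_ball openK 1 2])
    moreover have "ball 0 1 \<union> - K = UNIV" using Kb by auto
    ultimately show ?thesis by simp
  qed
  show ?thesis
    by (rule that[OF K Kb deriv cont zero gzero]) (auto simp: U_def)
qed

theorem proposition5p2:
  fixes N :: nat and p :: real
    and a1 a2 :: "'n::finite amb" and u :: "'n amb \<Rightarrow> real"
  assumes "N = CARD('n)" and "N \<ge> 3"
    and "a1 \<in> upper_hemisphere" and "a2 \<in> upper_hemisphere" and "a1 \<noteq> a2"
    and "2 \<le> p" and "p < real N"
    and "u \<in> test_functions"
  shows
    "let d1 = (\<lambda>x. geodesic_dist x a1);
         d2 = (\<lambda>x. geodesic_dist x a2);
         \<delta> = max (geodesic_dist north_pole a1) (geodesic_dist north_pole a2);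
         w1 = (\<lambda>x. sphere_grad d1 x /\<^sub>R d1 x);
         w2 = (\<lambda>x. sphere_grad d2 x /\<^sub>R d2 x);
         v = (\<lambda>x. w1 x + w2 x);
         G12 = (\<lambda>x. sphere_grad d1 x \<bullet> sphere_grad d2 x)
     in
       (LINT x:upper_hemisphere|hemisphere_vol. norm (sphere_grad u x) powr p)
       \<ge> C1_2 N p *
           (LINT x:upper_hemisphere|hemisphere_vol.
              (norm (w1 x - w2 x))\<^sup>2 * norm (v x) powr (p - 2) * \<bar>u x\<bar> powr p)
         + (real N - 1) * C2_2 N p * c_const \<delta> *
           (LINT x:upper_hemisphere|hemisphere_vol.
              norm (v x) powr (p - 2) * \<bar>u x\<bar> powr p)
         + (p - 2) * C2_2 N p *
           (LINT x:upper_hemisphere|hemisphere_vol.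
              (4 + c_const \<delta> * ((d1 x)\<^sup>2 + (d2 x)\<^sup>2))
              * ((1 - (G12 x)\<^sup>2) / ((d1 x)\<^sup>2 * (d2 x)\<^sup>2))
              * norm (v x) powr (p - 4) * \<bar>u x\<bar> powr p)"
proof -
  obtain U gU K where UK: "compact K" "K \<subseteq> ball 0 1"
    "\<And>y. (U has_derivative (\<lambda>h. gU y \<bullet> h)) (at y)" "continuous_on UNIV gU"
    "\<And>y. y \<notin> K \<Longrightarrow> U y = 0" "\<And>y. y \<notin> K \<Longrightarrow> gU y = 0"
    and uU: "\<And>y. y \<in> ball 0 1 \<Longrightarrow> u (graph_chart y) = U y"
    by (rule test_function_chart[OF \<open>u \<in> test_functions\<close>]) blast
  interpret two_poles a1 a2 p U gU K
    using assms UK by unfold_locales auto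
  have np: "(north_pole :: 'n amb) \<in> upper_hemisphere"
    by (simp add: north_pole_def upper_hemisphere_def unit_sphere_def norm_prod_def)
  have delta: "max (geodesic_dist north_pole a1) (geodesic_dist north_pole a2) = \<delta>"
    by (simp add: \<delta>_def geodesic_dist_eq_arccos np a1 a2)
  have dist: "geodesic_dist (graph_chart y) a = d a y"
    "sphere_grad (\<lambda>x. geodesic_dist x a) (graph_chart y) = d a y *\<^sub>R w a y"
    "(d a y *\<^sub>R w a y) /\<^sub>R d a y = w a y"
    if a: "a \<in> {a1, a2}" and y: "y \<in> ball 0 1 - S" for a y
  proof -
    have ya: "y \<noteq> fst a" and yb: "y \<in> ball 0 1" using regular_point[OF y] a by auto
    have ah: "a \<in> upper_hemisphere" using a a1 a2 by auto
    note xh = graph_chart_hemisphere(1)[OF yb]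
    have ne: "graph_chart y \<noteq> a" using ya graph_chart_hemisphere(2)[of y] by auto
    note f = pole_facts[OF a yb ya]
    show "geodesic_dist (graph_chart y) a = d a y"
      by (simp add: geodesic_dist_eq_arccos[OF xh ah] d_def)
    show "sphere_grad (\<lambda>x. geodesic_dist x a) (graph_chart y) = d a y *\<^sub>R w a y"
      unfolding sphere_grad_geodesic_dist[OF xh ah ne] w_def log_grad_def log_coeff_def
      using f(5) by (simp add: d_def)
    show "(d a y *\<^sub>R w a y) /\<^sub>R d a y = w a y"
      using f(5) by simp
  qed
  note dist1 = dist[of a1, OF insertI1] and dist2 = dist[of a2, OF insertI2[OF insertI1]]
  have grad_u: "sphere_grad u (graph_chart y) = grad y" if "y \<in> ball 0 1" for y
    unfolding grad_def by (rule sphere_grad_chart[OF that UK(3) uU])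
  have ball: "y \<in> ball 0 1" if "y \<in> ball 0 1 - S" for y using that by simp
  show ?thesis
    unfolding Let_def delta \<open>N = CARD('n)\<close>
    by (rule hemisphere_inequality)
      (simp_all only: dist1 dist2 grad_u[OF ball] uU[OF ball] T1_def T2_def T3_def G_def v_def)
qed

end
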